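(* Assume $\mathcal I\neq\emptyset$ and that the graph $\mathcal G$ has no tadpoles. If the maximal isotropic subspace $\mathcal M\subset{}^d\mathcal K$ is locally strictly positive, then the Green function satisfies $r_{\mathcal M}(x,y;i\varkappa,\underline a)\succ0$ (all entries positive) for all sufficiently large $\varkappa\geq0$.
   Context: Let $\mathcal G=(V,\mathcal I,\mathcal E,\partial)$ be a finite connected graph: $V$ vertices, $\mathcal I$ internal edges, $\mathcal E$ external edges; $\partial$ assigns to $i\in\mathcal I$ an ordered pair $(\partial^-(i),\partial^+(i))$ of vertices and to $e\in\mathcal E$ a vertex $\partial(e)$; $i$ is a tadpole if $\partial^-(i)=\partial^+(i)$. Fix lengths $a_i>0$; $I_i=[0,a_i]$, $I_e=[0,\infty)$; $\mathcal H=\bigoplus_jL^2(I_j)$; $\mathcal D$ = $\psi\in\mathcal H$ with $\psi_j,\psi_j'$ absolutely continuous, $\psi_j''\in L^2$. $\mathcal K=\mathcal K_{\mathcal E}\oplus\mathcal K^{(-)}_{\mathcal I}\oplus\mathcal K^{(+)}_{\mathcal I}\cong\mathbb C^{|\mathcal E|}\oplus\mathbb C^{|\mathcal I|}\oplus\mathbb C^{|\mathcal I|}$ with elements $\chi=(\{\chi_e\},\{\chi^{(-)}_i\},\{\chi^{(+)}_i\})$; ${}^d\mathcal K=\mathcal K\oplus\mathcal K$ with symplectic form $\omega(\chi,\chi')=\langle\chi,J\chi'\rangle$, $J=\begin{pmatrix}0&\mathbb I\\-\mathbb I&0\end{pmatrix}$. For $\psi\in\mathcal D$: $\underline\psi=(\{\psi_e(0)\},\{\psi_i(0)\},\{\psi_i(a_i)\})$,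 $\underline\psi'=(\{\psi_e'(0)\},\{\psi_i'(0)\},\{-\psi_i'(a_i)\})$. Maximal isotropic subspaces are $\mathcal M(A,B)=\{\chi_1\oplus\chi_2:A\chi_1+B\chi_2=0\}$ with $(A,B)$ of rank $|\mathcal E|+2|\mathcal I|$ and $AB^\dagger$ self-adjoint. $\Delta(\mathcal M,\underline a)$ acts by $\psi_j''$ on $\{\psi\in\mathcal D:A\underline\psi+B\underline\psi'=0\}$ and is self-adjoint. For $\mathsf k$ with $\det(A+i\mathsf kB)\ne0$, $\mathfrak S(\mathsf k;\mathcal M)=-(A+i\mathsf kB)^{-1}(A-i\mathsf kB)$. For $v\in V$ let $\mathcal L_v\subset\mathcal K$ be the subspace of $\chi$ with $\chi_e=0$ unless $\partial(e)=v$, $\chi_i^{(-)}=0$ unless $\partial^-(i)=v$, $\chi_i^{(+)}=0$ unless $\partial^+(i)=v$; so $\mathcal K=\bigoplus_v\mathcal L_v$, and ${}^d\mathcal L_v=\mathcal L_v\oplus\mathcal L_v$ inherits the symplectic form. The boundary conditions are local if $\mathcal M=\bigoplus_{v}\mathcal M(v)$ with each $\mathcal M(v)$ a maximal isotropic subspace of ${}^d\mathcal L_v$; then $\mathfrak S(\mathsf k;\mathcal M(v))$ is the corresponding operator on $\mathcal L_v$ (matrix in the natural coordinate basis of $\mathcal L_v$). $\mathcal M$ is locally strictly positive if it is local and there is $\varkappa_0\geq0$ such that $\mathbb I+\mathfrak S(i\varkappa;\mathcal M(v))$ has all entries positive for all $\varkappa\ge\varkappa_0$ and all $v\in V$. The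 Green function $r_{\mathcal M}(x,y;i\varkappa,\underline a)$ is the $(|\mathcal E|+|\mathcal I|)\times(|\mathcal E|+|\mathcal I|)$ matrix integral kernel of $(-\Delta(\mathcal M,\underline a)+\varkappa^2)^{-1}$: $((-\Delta+\varkappa^2)^{-1}\varphi)_j(x_j)=\sum_{j'}\int_{I_{j'}}[r_{\mathcal M}]_{j,j'}\varphi_{j'}(y_{j'})dy_{j'}$. $C\succ0$ means all entries of $C$ are positive. *)

theory Defs
  imports "HOL-Analysis.Analysis"
begin

section \<open>Metric graphs\<close>

text \<open>Edges of the graph: external edges (type 'e, finite set E) and internal
edges (type 'i, finite set I).  An internal edge i has ordered endpoints
(dm i, dp i); an external edge e is attached to the vertex de e.\<close>

datatype ('e, 'i) edge = ExtE 'e | IntE 'i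

text \<open>Coordinates of K = K_E + K_I^(-) + K_I^(+).\<close>
datatype ('e, 'i) kidx = KE 'e | KM 'i | KP 'i

definition Edges :: "'e set \<Rightarrow> 'i set \<Rightarrow> ('e, 'i) edge set" where
  "Edges E I = ExtE ` E \<union> IntE ` I"

definition Kset :: "'e set \<Rightarrow> 'i set \<Rightarrow> ('e, 'i) kidx set" where
  "Kset E I = KE ` E \<union> KM ` I \<union> KP ` I"

text \<open>The interval I_j.\<close>
fun intv :: "('i \<Rightarrow> real) \<Rightarrow> ('e, 'i) edge \<Rightarrow> real set" where
  "intv a (ExtE e) = {0..}"
| "intv a (IntE i) = {0..a i}"

text \<open>Vertex to which a coordinate of K belongs.\<close>
fun vtx :: "('i \<Rightarrow> 'v) \<Rightarrow> ('i \<Rightarrow> 'v) \<Rightarrow> ('e \<Rightarrow> 'v) \<Rightarrow> ('e, 'i) kidx \<Rightarrow> 'v" where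
  "vtx dm dp de (KE e) = de e"
| "vtx dm dp de (KM i) = dm i"
| "vtx dm dp de (KP i) = dp i"

definition graph :: "'v set \<Rightarrow> 'e set \<Rightarrow> 'i set \<Rightarrow> ('i \<Rightarrow> 'v) \<Rightarrow> ('i \<Rightarrow> 'v) \<Rightarrow> ('e \<Rightarrow> 'v) \<Rightarrow> bool" where
  "graph V E I dm dp de \<longleftrightarrow> finite V \<and> finite E \<and> finite I \<and>
     (\<forall>i\<in>I. dm i \<in> V \<and> dp i \<in> V) \<and> (\<forall>e\<in>E. de e \<in> V)"

definition adj_rel :: "'i set \<Rightarrow> ('i \<Rightarrow> 'v) \<Rightarrow> ('i \<Rightarrow> 'v) \<Rightarrow> ('v \<times> 'v) set" where
  "adj_rel I dm dp = {(v, w). \<exists>i\<in>I. (dm i = v \<and> dp i = w) \<or> (dm i = w \<and> dp i = v)}"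

definition graph_connected :: "'v set \<Rightarrow> 'i set \<Rightarrow> ('i \<Rightarrow> 'v) \<Rightarrow> ('i \<Rightarrow> 'v) \<Rightarrow> bool" where
  "graph_connected V I dm dp \<longleftrightarrow> (\<forall>v\<in>V. \<forall>w\<in>V. (v, w) \<in> (adj_rel I dm dp)\<^sup>*)"

definition no_tadpoles :: "'i set \<Rightarrow> ('i \<Rightarrow> 'v) \<Rightarrow> ('i \<Rightarrow> 'v) \<Rightarrow> bool" where
  "no_tadpoles I dm dp \<longleftrightarrow> (\<forall>i\<in>I. dm i \<noteq> dp i)"

section \<open>Symplectic linear algebra on K + K\<close>

text \<open>Vectors are functions on coordinates; a vector of the subspace spanned by the
coordinates P vanishes outside P.\<close>
definition Lvec :: "('e, 'i) kidx set \<Rightarrow> (('e, 'i) kidx \<Rightarrow> complex) set" where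
  "Lvec P = {z. \<forall>p. p \<notin> P \<longrightarrow> z p = 0}"

definition dL :: "('e, 'i) kidx set \<Rightarrow> ((('e, 'i) kidx \<Rightarrow> complex) \<times> (('e, 'i) kidx \<Rightarrow> complex)) set" where
  "dL P = Lvec P \<times> Lvec P"

text \<open>omega(chi, chi') = <chi, J chi'> with J(chi1', chi2') = (chi2', - chi1').\<close>
definition symp :: "('e, 'i) kidx set \<Rightarrow> (('e, 'i) kidx \<Rightarrow> complex) \<times> (('e, 'i) kidx \<Rightarrow> complex)
    \<Rightarrow> (('e, 'i) kidx \<Rightarrow> complex) \<times> (('e, 'i) kidx \<Rightarrow> complex) \<Rightarrow> complex" where
  "symp P x y = (\<Sum>p\<in>P. cnj (fst x p) * snd y p - cnj (snd x p) * fst y p)"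

definition csubspace :: "((('e, 'i) kidx \<Rightarrow> complex) \<times> (('e, 'i) kidx \<Rightarrow> complex)) set \<Rightarrow> bool" where
  "csubspace N \<longleftrightarrow> ((\<lambda>p. 0), (\<lambda>p. 0)) \<in> N \<and>
     (\<forall>x\<in>N. \<forall>y\<in>N. ((\<lambda>p. fst x p + fst y p), (\<lambda>p. snd x p + snd y p)) \<in> N) \<and>
     (\<forall>c::complex. \<forall>x\<in>N. ((\<lambda>p. c * fst x p), (\<lambda>p. c * snd x p)) \<in> N)"

definition isotropic :: "('e, 'i) kidx set \<Rightarrow> ((('e, 'i) kidx \<Rightarrow> complex) \<times> (('e, 'i) kidx \<Rightarrow> complex)) set \<Rightarrow> bool" where
  "isotropic P N \<longleftrightarrow> N \<subseteq> dL P \<and> csubspace N \<and> (\<forall>x\<in>N. \<forall>y\<in>N. symp P x y = 0)"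

definition max_isotropic :: "('e, 'i) kidx set \<Rightarrow> ((('e, 'i) kidx \<Rightarrow> complex) \<times> (('e, 'i) kidx \<Rightarrow> complex)) set \<Rightarrow> bool" where
  "max_isotropic P N \<longleftrightarrow> isotropic P N \<and> (\<forall>N'. isotropic P N' \<and> N \<subseteq> N' \<longrightarrow> N' = N)"

text \<open>The coordinates of L_v.\<close>
definition Lv :: "'e set \<Rightarrow> 'i set \<Rightarrow> ('i \<Rightarrow> 'v) \<Rightarrow> ('i \<Rightarrow> 'v) \<Rightarrow> ('e \<Rightarrow> 'v) \<Rightarrow> 'v \<Rightarrow> ('e, 'i) kidx set" where
  "Lv E I dm dp de v = {p \<in> Kset E I. vtx dm dp de p = v}"

definition restr :: "('e, 'i) kidx set \<Rightarrow> (('e, 'i) kidx \<Rightarrow> complex) \<Rightarrow> ('e, 'i) kidx \<Rightarrow> complex" where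
  "restr P z p = (if p \<in> P then z p else 0)"

text \<open>M is local: M = direct sum over v of maximal isotropic subspaces Mv v of dL_v.\<close>
definition local_decomp :: "'v set \<Rightarrow> 'e set \<Rightarrow> 'i set \<Rightarrow> ('i \<Rightarrow> 'v) \<Rightarrow> ('i \<Rightarrow> 'v) \<Rightarrow> ('e \<Rightarrow> 'v)
    \<Rightarrow> ((('e, 'i) kidx \<Rightarrow> complex) \<times> (('e, 'i) kidx \<Rightarrow> complex)) set
    \<Rightarrow> ('v \<Rightarrow> ((('e, 'i) kidx \<Rightarrow> complex) \<times> (('e, 'i) kidx \<Rightarrow> complex)) set) \<Rightarrow> bool" where
  "local_decomp V E I dm dp de M Mv \<longleftrightarrow>
     (\<forall>v\<in>V. max_isotropic (Lv E I dm dp de v) (Mv v)) \<and>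
     M = {x \<in> dL (Kset E I). \<forall>v\<in>V.
            (restr (Lv E I dm dp de v) (fst x), restr (Lv E I dm dp de v) (snd x)) \<in> Mv v}"

text \<open>Scattering matrix S(k; N) = -(A + ik B)^{-1} (A - ik B) for N = M(A,B) in dL_P.
  Since (A + ikB) chi' = -(A - ikB) chi iff A(chi + chi') + B(ik(chi' - chi)) = 0,
  S(k;N) chi is the unique chi' in L_P with (chi + chi', ik(chi' - chi)) in N;
  det(A + ikB) \<noteq> 0 iff this chi' exists uniquely for every chi.\<close>
definition scat_defined :: "complex \<Rightarrow> ('e, 'i) kidx set \<Rightarrow> ((('e, 'i) kidx \<Rightarrow> complex) \<times> (('e, 'i) kidx \<Rightarrow> complex)) set \<Rightarrow> bool" where
  "scat_defined k P N \<longleftrightarrow> (\<forall>z\<in>Lvec P. \<exists>!w. w \<in> Lvec P \<and>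
       ((\<lambda>p. z p + w p), (\<lambda>p. \<i> * k * (w p - z p))) \<in> N)"

definition scat :: "complex \<Rightarrow> ('e, 'i) kidx set \<Rightarrow> ((('e, 'i) kidx \<Rightarrow> complex) \<times> (('e, 'i) kidx \<Rightarrow> complex)) set
    \<Rightarrow> (('e, 'i) kidx \<Rightarrow> complex) \<Rightarrow> ('e, 'i) kidx \<Rightarrow> complex" where
  "scat k P N z = (THE w. w \<in> Lvec P \<and>
       ((\<lambda>p. z p + w p), (\<lambda>p. \<i> * k * (w p - z p))) \<in> N)"

text \<open>Matrix entry (p, q) in the natural coordinate basis.\<close>
definition scat_entry :: "complex \<Rightarrow> ('e, 'i) kidx set \<Rightarrow> ((('e, 'i) kidx \<Rightarrow> complex) \<times> (('e, 'i) kidx \<Rightarrow> complex)) set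
    \<Rightarrow> ('e, 'i) kidx \<Rightarrow> ('e, 'i) kidx \<Rightarrow> complex" where
  "scat_entry k P N p q = scat k P N (\<lambda>r. if r = q then 1 else 0) p"

text \<open>A complex number is positive: real and > 0.\<close>
definition cpos :: "complex \<Rightarrow> bool" where
  "cpos z \<longleftrightarrow> Im z = 0 \<and> Re z > 0"

definition locally_strictly_positive :: "'v set \<Rightarrow> 'e set \<Rightarrow> 'i set \<Rightarrow> ('i \<Rightarrow> 'v) \<Rightarrow> ('i \<Rightarrow> 'v) \<Rightarrow> ('e \<Rightarrow> 'v)
    \<Rightarrow> ((('e, 'i) kidx \<Rightarrow> complex) \<times> (('e, 'i) kidx \<Rightarrow> complex)) set \<Rightarrow> bool" where
  "locally_strictly_positive V E I dm dp de M \<longleftrightarrow>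
     (\<exists>Mv. local_decomp V E I dm dp de M Mv \<and>
       (\<exists>\<kappa>0\<ge>0. \<forall>\<kappa>::real. \<kappa> \<ge> \<kappa>0 \<longrightarrow> (\<forall>v\<in>V.
          scat_defined (\<i> * complex_of_real \<kappa>) (Lv E I dm dp de v) (Mv v) \<and>
          (\<forall>p\<in>Lv E I dm dp de v. \<forall>q\<in>Lv E I dm dp de v.
             cpos ((if p = q then 1 else 0) + scat_entry (\<i> * complex_of_real \<kappa>) (Lv E I dm dp de v) (Mv v) p q)))))"

section \<open>Function spaces and the Laplacian\<close>

definition L2 :: "real set \<Rightarrow> (real \<Rightarrow> complex) \<Rightarrow> bool" where
  "L2 S f \<longleftrightarrow> f measurable_on S \<and> (\<lambda>x. (cmod (f x))\<^sup>2) integrable_on S"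

text \<open>f, f' (locally) absolutely continuous on S = [0, b] or [0, \<infinity>), with
  derivatives f' and f'' (a.e.), f and f'' in L2.  Absolute continuity is expressed
  through the fundamental theorem of calculus for Lebesgue integrals.\<close>
definition H2 :: "real set \<Rightarrow> (real \<Rightarrow> complex) \<Rightarrow> (real \<Rightarrow> complex) \<Rightarrow> (real \<Rightarrow> complex) \<Rightarrow> bool" where
  "H2 S f f' f'' \<longleftrightarrow> L2 S f \<and> L2 S f'' \<and>
     (\<forall>x\<in>S. f'' absolutely_integrable_on {0..x} \<and> f' x = f' 0 + integral {0..x} f'') \<and>
     (\<forall>x\<in>S. f' absolutely_integrable_on {0..x} \<and> f x = f 0 + integral {0..x} f')"

fun bval :: "('i \<Rightarrow> real) \<Rightarrow> (('e, 'i) edge \<Rightarrow> real \<Rightarrow> complex) \<Rightarrow> ('e, 'i) kidx \<Rightarrow> complex" where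
  "bval a \<psi> (KE e) = \<psi> (ExtE e) 0"
| "bval a \<psi> (KM i) = \<psi> (IntE i) 0"
| "bval a \<psi> (KP i) = \<psi> (IntE i) (a i)"

fun bder :: "('i \<Rightarrow> real) \<Rightarrow> (('e, 'i) edge \<Rightarrow> real \<Rightarrow> complex) \<Rightarrow> ('e, 'i) kidx \<Rightarrow> complex" where
  "bder a \<psi>' (KE e) = \<psi>' (ExtE e) 0"
| "bder a \<psi>' (KM i) = \<psi>' (IntE i) 0"
| "bder a \<psi>' (KP i) = - \<psi>' (IntE i) (a i)"

text \<open>psi lies in the domain of Delta(M, a), with derivatives psi' and psi''.\<close>
definition in_domain :: "'e set \<Rightarrow> 'i set \<Rightarrow> ('i \<Rightarrow> real)
    \<Rightarrow> ((('e, 'i) kidx \<Rightarrow> complex) \<times> (('e, 'i) kidx \<Rightarrow> complex)) set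
    \<Rightarrow> (('e, 'i) edge \<Rightarrow> real \<Rightarrow> complex) \<Rightarrow> (('e, 'i) edge \<Rightarrow> real \<Rightarrow> complex)
    \<Rightarrow> (('e, 'i) edge \<Rightarrow> real \<Rightarrow> complex) \<Rightarrow> bool" where
  "in_domain E I a M \<psi> \<psi>' \<psi>'' \<longleftrightarrow>
     (\<forall>j\<in>Edges E I. H2 (intv a j) (\<psi> j) (\<psi>' j) (\<psi>'' j)) \<and>
     (restr (Kset E I) (bval a \<psi>), restr (Kset E I) (bder a \<psi>')) \<in> M"

text \<open>r is the integral kernel of (-Delta(M,a) + kappa^2)^{-1}: for every phi in H,
  u_j(x) = sum_{j'} int_{I_j'} r_{j,j'}(x,y) phi_{j'}(y) dy lies in the domain and
  solves -u'' + kappa^2 u = phi (a.e. on every edge).\<close>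
definition green_kernel :: "'e set \<Rightarrow> 'i set \<Rightarrow> ('i \<Rightarrow> real)
    \<Rightarrow> ((('e, 'i) kidx \<Rightarrow> complex) \<times> (('e, 'i) kidx \<Rightarrow> complex)) set \<Rightarrow> real
    \<Rightarrow> (('e, 'i) edge \<Rightarrow> ('e, 'i) edge \<Rightarrow> real \<Rightarrow> real \<Rightarrow> complex) \<Rightarrow> bool" where
  "green_kernel E I a M \<kappa> r \<longleftrightarrow>
     (\<forall>\<phi>. (\<forall>j\<in>Edges E I. L2 (intv a j) (\<phi> j)) \<longrightarrow>
        (\<forall>j\<in>Edges E I. \<forall>j'\<in>Edges E I. \<forall>x\<in>intv a j.
            (\<lambda>y. r j j' x y * \<phi> j' y) absolutely_integrable_on intv a j') \<and>
        (let u = (\<lambda>j x. \<Sum>j'\<in>Edges E I. integral (intv a j') (\<lambda>y. r j j' x y * \<phi> j' y))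
         in \<exists>u' u''. in_domain E I a M u u' u'' \<and>
              (\<forall>j\<in>Edges E I. \<exists>N. negligible N \<and>
                 (\<forall>x\<in>intv a j - N. - u'' j x + complex_of_real (\<kappa>\<^sup>2) * u j x = \<phi> j x))))"

definition kernel_continuous :: "'e set \<Rightarrow> 'i set \<Rightarrow> ('i \<Rightarrow> real)
    \<Rightarrow> (('e, 'i) edge \<Rightarrow> ('e, 'i) edge \<Rightarrow> real \<Rightarrow> real \<Rightarrow> complex) \<Rightarrow> bool" where
  "kernel_continuous E I a r \<longleftrightarrow>
     (\<forall>j\<in>Edges E I. \<forall>j'\<in>Edges E I. continuous_on (intv a j \<times> intv a j') (\<lambda>(x, y). r j j' x y))"

end

theory Submission
  imports Defs "HOL-Real_Asymp.Real_Asymp"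
begin

text \<open>
  On every edge the resolvent is the Dirichlet resolvent plus the solution of the homogeneous
  equation with the boundary values \<open>f\<close> of the solution, and the inward derivatives \<open>g\<close> at the ends
  are given by the Dirichlet-to-Neumann map,
  \<open>g_p = - \<kappa> coth (\<kappa> a) f_p + \<kappa> / sinh (\<kappa> a) f_{opp p} + \<beta>_p\<close> with a source term \<open>\<beta>\<close>. The Dirichlet
  kernel and the homogeneous solutions with boundary values 0 and 1 are nonnegative, so it suffices
  to show that \<open>f\<close> is obtained from \<open>\<beta>\<close> by a matrix with positive entries.

  The boundary condition reads \<open>f = G (\<kappa>' f + g)\<close> with \<open>G = (I + S(i\<kappa>')) / (2 \<kappa>')\<close>, for every large \<open>\<kappa>'\<close>,
  which need not be the spectral parameter \<open>\<kappa>\<close>. Choosing \<open>\<kappa>' = \<kappa> coth (\<kappa> min a) \<ge> \<kappa>\<close> makes all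
  coefficients \<open>\<kappa>' - \<kappa> coth (\<kappa> a_p)\<close> and \<open>\<kappa> / sinh (\<kappa> a_p)\<close> nonnegative; they are exponentially small.
  Since the entries of \<open>G\<close> are nonnegative, the resolvent identity makes them decreasing in \<open>\<kappa>'\<close>,
  hence bounded. So the linear system for \<open>f\<close> is solved by a Neumann series with nonnegative terms,
  and connectedness of the graph makes all entries of the solution matrix positive.
\<close>

section \<open>Boundary conditions in terms of the scattering matrix\<close>

text \<open>With the scattering matrix read at the spectral parameter itself, the diagonal
  coefficients \<open>\<kappa> - \<kappa> coth (\<kappa> a_i)\<close> would be negative and the
  series would have terms of both signs. The subspace \<open>M\<close> does not depend on the
  parameter at which its scattering matrix is read; that is why \<open>\<kappa>'\<close> is free.
  Since coth decreases, the shortest edge decides how large \<open>\<kappa>'\<close> has to be. The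
  boundary matrix \<open>G\<close> is block diagonal over the vertices, so an entry of the solution
  matrix between different vertices comes only from those terms of the series that follow a path of
  internal edges, with one factor \<open>\<kappa> / sinh (\<kappa> a_i)\<close> per edge. The
  theorem concerns every continuous resolvent kernel, so the construction of a positive one is
  complemented by uniqueness: a square integrable homogeneous solution satisfying the boundary
  conditions obeys the same linear system with \<open>\<beta> = 0\<close>, hence vanishes. Sources
  are merely square integrable, so the differential equations are handled in integrated
  form.\<close>

lemma csubspace_sum:
  assumes "csubspace N" "finite A" "\<And>q. q \<in> A \<Longrightarrow> x q \<in> N"
  shows "((\<lambda>p. \<Sum>q\<in>A. c q * fst (x q) p), (\<lambda>p. \<Sum>q\<in>A. c q * snd (x q) p)) \<in> N"
  using assms(2,3)
proof (induction A rule: finite_induct)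
  case empty
  then show ?case using assms(1) by (simp add: csubspace_def)
next
  case (insert q A)
  have 1: "((\<lambda>p. c q * fst (x q) p), (\<lambda>p. c q * snd (x q) p)) \<in> N"
    using assms(1) insert.prems by (simp add: csubspace_def)
  have 2: "((\<lambda>p. \<Sum>q\<in>A. c q * fst (x q) p), (\<lambda>p. \<Sum>q\<in>A. c q * snd (x q) p)) \<in> N"
    using insert by simp
  have add: "\<And>u v. u \<in> N \<Longrightarrow> v \<in> N \<Longrightarrow> ((\<lambda>p. fst u p + fst v p), (\<lambda>p. snd u p + snd v p)) \<in> N"
    using assms(1) by (simp add: csubspace_def)
  show ?case using add[OF 1 2] insert.hyps by simp
qed

lemma csubspace_diff:
  assumes "csubspace N" "(f, g) \<in> N" "(f', g') \<in> N"
  shows "((\<lambda>p. f p - f' p), (\<lambda>p. g p - g' p)) \<in> N"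
  using csubspace_sum[OF assms(1), of "{True, False}"
      "\<lambda>b. if b then (f, g) else (f', g')" "\<lambda>b. if b then 1 else - 1"] assms(2,3)
  by simp

lemma
  assumes "scat_defined k P N" "z \<in> Lvec P"
  shows scat_Lvec: "scat k P N z \<in> Lvec P"
    and scat_mem: "((\<lambda>p. z p + scat k P N z p), (\<lambda>p. \<i> * k * (scat k P N z p - z p))) \<in> N"
proof -
  have "\<exists>!w. w \<in> Lvec P \<and> ((\<lambda>p. z p + w p), (\<lambda>p. \<i> * k * (w p - z p))) \<in> N"
    using assms by (auto simp: scat_defined_def)
  from theI'[OF this] show "scat k P N z \<in> Lvec P"
    "((\<lambda>p. z p + scat k P N z p), (\<lambda>p. \<i> * k * (scat k P N z p - z p))) \<in> N"
    unfolding scat_def by auto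
qed

lemma scat_eqI:
  assumes "scat_defined k P N" "z \<in> Lvec P" "w \<in> Lvec P"
    "((\<lambda>p. z p + w p), (\<lambda>p. \<i> * k * (w p - z p))) \<in> N"
  shows "scat k P N z = w"
  using assms scat_Lvec[OF assms(1,2)] scat_mem[OF assms(1,2)]
  unfolding scat_defined_def by blast

text \<open>Linearity comes from uniqueness: the combination of the columns satisfies the defining
  relation of the scattering vector because \<open>N\<close> is a subspace.\<close>

lemma scat_eq_sum_entries:
  assumes "scat_defined k P N" "csubspace N" "finite P" "z \<in> Lvec P"
  shows "scat k P N z p = (\<Sum>q\<in>P. z q * scat_entry k P N p q)"
proof -
  let ?e = "\<lambda>q r. if r = q then 1 else (0::complex)"
  have e: "?e q \<in> Lvec P" if "q \<in> P" for q
    using that by (auto simp: Lvec_def)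
  have z: "(\<Sum>q\<in>P. z q * ?e q p) = z p" for p
    using assms(3,4) by (cases "p \<in> P") (auto simp: Lvec_def sum.delta if_distrib cong: if_cong)
  define w where "w = (\<lambda>p. \<Sum>q\<in>P. z q * scat k P N (?e q) p)"
  have "((\<lambda>p. \<Sum>q\<in>P. z q * fst ((\<lambda>p. ?e q p + scat k P N (?e q) p), (\<lambda>p. \<i> * k * (scat k P N (?e q) p - ?e q p))) p),
      (\<lambda>p. \<Sum>q\<in>P. z q * snd ((\<lambda>p. ?e q p + scat k P N (?e q) p), (\<lambda>p. \<i> * k * (scat k P N (?e q) p - ?e q p))) p)) \<in> N"
    by (intro csubspace_sum assms scat_mem e)
  moreover have "(\<Sum>q\<in>P. z q * (?e q p + scat k P N (?e q) p)) = z p + w p" for p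
    by (simp only: distrib_left sum.distrib z w_def)
  moreover have "(\<Sum>q\<in>P. z q * (\<i> * k * (scat k P N (?e q) p - ?e q p))) = \<i> * k * (w p - z p)" for p
    unfolding w_def z[symmetric, of p]
    by (simp only: sum_distrib_left sum_subtractf[symmetric]) (auto intro!: sum.cong simp: algebra_simps)
  ultimately have m: "((\<lambda>p. z p + w p), (\<lambda>p. \<i> * k * (w p - z p))) \<in> N"
    by simp
  have "w \<in> Lvec P"
    using scat_Lvec[OF assms(1) e] unfolding w_def Lvec_def by (auto intro!: sum.neutral)
  from scat_eqI[OF assms(1,4) this m] show ?thesis
    unfolding w_def scat_entry_def by simp
qed

lemma Lvec_eq_iff: "f \<in> Lvec P \<Longrightarrow> g \<in> Lvec P \<Longrightarrow> f = g \<longleftrightarrow> (\<forall>p\<in>P. f p = g p)"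
  by (auto simp: Lvec_def fun_eq_iff)

text \<open>If N is \<open>g = - L f\<close> together with a Dirichlet condition on the complement, these are the
  entries of \<open>(\<kappa> - L)^{-1} = (I + S(i\<kappa>)) / (2 \<kappa>)\<close>.\<close>
definition bdry_res :: "real \<Rightarrow> ('e, 'i) kidx set \<Rightarrow> ((('e, 'i) kidx \<Rightarrow> complex) \<times> (('e, 'i) kidx \<Rightarrow> complex)) set
    \<Rightarrow> ('e, 'i) kidx \<Rightarrow> ('e, 'i) kidx \<Rightarrow> complex" where
  "bdry_res \<kappa> P N p q = ((if p = q then 1 else 0) + scat_entry (\<i> * complex_of_real \<kappa>) P N p q) / of_real (2 * \<kappa>)"

text \<open>Every pair splits as \<open>f = z + w\<close>, \<open>g = - \<kappa> (w - z)\<close>,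
  because \<open>\<i> * (\<i> * \<kappa>) = - \<kappa>\<close>. Membership therefore says
  \<open>w = S z\<close>, that is \<open>f = (I + S) z\<close>, and
  \<open>2 \<kappa> z = \<kappa> f + g\<close>.\<close>

lemma mem_iff_bdry_res:
  assumes "scat_defined (\<i> * complex_of_real \<kappa>) P N" "csubspace N" "finite P" "\<kappa> > 0"
    "f \<in> Lvec P" "g \<in> Lvec P"
  shows "(f, g) \<in> N \<longleftrightarrow> (\<forall>p\<in>P. f p = (\<Sum>q\<in>P. bdry_res \<kappa> P N p q * (of_real \<kappa> * f q + g q)))"
proof -
  let ?k = "\<i> * complex_of_real \<kappa>"
  define z where "z = (\<lambda>p. (f p + g p / of_real \<kappa>) / 2)"
  define w where "w = (\<lambda>p. (f p - g p / of_real \<kappa>) / 2)"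
  have zw: "z \<in> Lvec P" "w \<in> Lvec P"
    using assms(5,6) by (auto simp: z_def w_def Lvec_def)
  have fg: "(\<lambda>p. z p + w p) = f" "(\<lambda>p. \<i> * ?k * (w p - z p)) = g"
    using assms(4) by (auto simp: z_def w_def field_simps)
  have "(f, g) \<in> N \<longleftrightarrow> scat ?k P N z = w"
  proof
    assume "(f, g) \<in> N"
    then show "scat ?k P N z = w" by (intro scat_eqI[OF assms(1) zw]) (simp only: fg)
  next
    assume e: "scat ?k P N z = w"
    show "(f, g) \<in> N" using scat_mem[OF assms(1) zw(1)] unfolding e fg .
  qed
  also have "\<dots> \<longleftrightarrow> (\<forall>p\<in>P. scat ?k P N z p = w p)"
    using Lvec_eq_iff[OF scat_Lvec[OF assms(1) zw(1)] zw(2)] .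
  also have "\<dots> \<longleftrightarrow> (\<forall>p\<in>P. f p = (\<Sum>q\<in>P. bdry_res \<kappa> P N p q * (of_real \<kappa> * f q + g q)))"
  proof (intro ball_cong refl)
    fix p assume p: "p \<in> P"
    have "(\<Sum>q\<in>P. bdry_res \<kappa> P N p q * (of_real \<kappa> * f q + g q))
        = (\<Sum>q\<in>P. (if p = q then z q else 0) + z q * scat_entry ?k P N p q)"
      using assms(4) by (intro sum.cong) (auto simp: bdry_res_def z_def field_simps)
    also have "\<dots> = z p + scat ?k P N z p"
      using p assms(3) by (simp add: sum.distrib sum.delta scat_eq_sum_entries[OF assms(1-3) zw(1)])
    finally show "scat ?k P N z p = w p \<longleftrightarrow> f p = (\<Sum>q\<in>P. bdry_res \<kappa> P N p q * (of_real \<kappa> * f q + g q))"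
      using fun_cong[OF fg(1), of p] by auto
  qed
  finally show ?thesis .
qed

lemma finite_Kset: "graph V E I dm dp de \<Longrightarrow> finite (Kset E I)"
  by (auto simp: graph_def Kset_def)

lemma restr_Lvec [simp]: "restr P z \<in> Lvec P"
  by (simp add: restr_def Lvec_def)

text \<open>The vertex blocks are assembled into one matrix that is zero between coordinates of
  different vertices. Positivity in the sense of \<open>cpos\<close> includes being real, so taking
  \<open>Re\<close> loses nothing. The threshold is \<open>\<kappa>0 + 1\<close> because
  \<open>\<kappa>0\<close> may be 0 and \<open>bdry_res\<close> divides by
  \<open>2 * \<kappa>\<close>.\<close>

lemma local_bdry_res:
  fixes V :: "'v set" and E :: "'e set" and I :: "'i set"
    and M :: "((('e, 'i) kidx \<Rightarrow> complex) \<times> (('e, 'i) kidx \<Rightarrow> complex)) set"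
  assumes gr: "graph V E I dm dp de"
    and pos: "locally_strictly_positive V E I dm dp de M"
  obtains \<kappa>1 and G :: "real \<Rightarrow> ('e, 'i) kidx \<Rightarrow> ('e, 'i) kidx \<Rightarrow> real" where "\<kappa>1 > 0"
    "\<And>\<kappa> p q. \<kappa> \<ge> \<kappa>1 \<Longrightarrow> p \<in> Kset E I \<Longrightarrow> q \<in> Kset E I \<Longrightarrow> vtx dm dp de p = vtx dm dp de q \<Longrightarrow> G \<kappa> p q > 0"
    "\<And>\<kappa> p q. \<kappa> \<ge> \<kappa>1 \<Longrightarrow> G \<kappa> p q \<ge> 0"
    "\<And>\<kappa> f g. \<kappa> \<ge> \<kappa>1 \<Longrightarrow> (restr (Kset E I) f, restr (Kset E I) g) \<in> M \<longleftrightarrow>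
       (\<forall>p\<in>Kset E I. f p = (\<Sum>q\<in>Kset E I. of_real (G \<kappa> p q) * (of_real \<kappa> * f q + g q)))"
proof -
  let ?P = "Kset E I" and ?L = "Lv E I dm dp de" and ?vtx = "vtx dm dp de"
  obtain Mv \<kappa>0 where Mv: "local_decomp V E I dm dp de M Mv" and k0: "\<kappa>0 \<ge> 0"
    and sp: "\<And>\<kappa> v. \<kappa> \<ge> \<kappa>0 \<Longrightarrow> v \<in> V \<Longrightarrow> scat_defined (\<i> * complex_of_real \<kappa>) (?L v) (Mv v)"
      "\<And>\<kappa> v p q. \<kappa> \<ge> \<kappa>0 \<Longrightarrow> v \<in> V \<Longrightarrow> p \<in> ?L v \<Longrightarrow> q \<in> ?L v \<Longrightarrow>
        cpos ((if p = q then 1 else 0) + scat_entry (\<i> * complex_of_real \<kappa>) (?L v) (Mv v) p q)"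
    using pos unfolding locally_strictly_positive_def by metis
  have finP: "finite ?P" using finite_Kset[OF gr] .
  have vtxV: "?vtx p \<in> V" if "p \<in> ?P" for p
    using that gr by (auto simp: Kset_def graph_def)
  have Lsub: "?L v \<subseteq> ?P" for v by (auto simp: Lv_def)
  have finL: "finite (?L v)" for v using Lsub finP by (rule finite_subset)
  have cs: "csubspace (Mv v)" if "v \<in> V" for v
    using Mv that by (auto simp: local_decomp_def max_isotropic_def isotropic_def)
  define G where "G = (\<lambda>\<kappa> p q. if p \<in> ?P \<and> q \<in> ?P \<and> ?vtx p = ?vtx q
      then Re (bdry_res \<kappa> (?L (?vtx p)) (Mv (?vtx p)) p q) else 0)"
  have Gp: "Re (bdry_res \<kappa> (?L v) (Mv v) p q) > 0" "of_real (Re (bdry_res \<kappa> (?L v) (Mv v) p q)) = bdry_res \<kappa> (?L v) (Mv v) p q"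
    if "\<kappa> \<ge> \<kappa>0 + 1" "v \<in> V" "p \<in> ?L v" "q \<in> ?L v" for \<kappa> v p q
  proof -
    have "cpos (bdry_res \<kappa> (?L v) (Mv v) p q)"
      using sp(2)[of \<kappa>, OF _ that(2-4)] that(1) k0 unfolding bdry_res_def cpos_def
      by (simp add: Re_divide_of_real Im_divide_of_real del: of_real_mult)
    then show "Re (bdry_res \<kappa> (?L v) (Mv v) p q) > 0" "of_real (Re (bdry_res \<kappa> (?L v) (Mv v) p q)) = bdry_res \<kappa> (?L v) (Mv v) p q"
      by (auto simp: cpos_def complex_eq_iff)
  qed
  have inL: "p \<in> ?L (?vtx p)" if "p \<in> ?P" for p using that by (auto simp: Lv_def)
  have Gpos: "G \<kappa> p q > 0" if "\<kappa> \<ge> \<kappa>0 + 1" "p \<in> ?P" "q \<in> ?P" "?vtx p = ?vtx q" for \<kappa> p q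
    unfolding G_def using that Gp(1)[OF that(1) vtxV[OF that(2)] inL[OF that(2)]] inL[OF that(3)] by auto
  show ?thesis
  proof (rule that[of "\<kappa>0 + 1" G])
    show "\<kappa>0 + 1 > 0" using k0 by simp
    show "G \<kappa> p q > 0" if "\<kappa> \<ge> \<kappa>0 + 1" "p \<in> ?P" "q \<in> ?P" "?vtx p = ?vtx q" for \<kappa> p q
      using Gpos that .
    show "G \<kappa> p q \<ge> 0" if "\<kappa> \<ge> \<kappa>0 + 1" for \<kappa> p q
      using Gpos[OF that, of p q] by (cases "p \<in> ?P \<and> q \<in> ?P \<and> ?vtx p = ?vtx q") (auto simp: G_def)
    fix \<kappa> f g assume k: "\<kappa> \<ge> \<kappa>0 + 1"
    have sumG: "(\<Sum>q\<in>?P. of_real (G \<kappa> p q) * (of_real \<kappa> * f q + g q))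
        = (\<Sum>q\<in>?L v. bdry_res \<kappa> (?L v) (Mv v) p q * (of_real \<kappa> * restr (?L v) f q + restr (?L v) g q))"
      if v: "v \<in> V" and p: "p \<in> ?L v" for v p
    proof -
      have "(\<Sum>q\<in>?P. of_real (G \<kappa> p q) * (of_real \<kappa> * f q + g q))
        = (\<Sum>q\<in>?L v. of_real (G \<kappa> p q) * (of_real \<kappa> * f q + g q))"
        using p by (intro sum.mono_neutral_right finP Lsub) (auto simp: G_def Lv_def)
      also have "\<dots> = (\<Sum>q\<in>?L v. bdry_res \<kappa> (?L v) (Mv v) p q * (of_real \<kappa> * restr (?L v) f q + restr (?L v) g q))"
      proof (intro sum.cong refl)
        fix q assume q: "q \<in> ?L v"
        have "of_real (G \<kappa> p q) = bdry_res \<kappa> (?L v) (Mv v) p q"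
          using Gp(2)[OF k v p q] p q by (auto simp: G_def Lv_def)
        then show "of_real (G \<kappa> p q) * (of_real \<kappa> * f q + g q)
            = bdry_res \<kappa> (?L v) (Mv v) p q * (of_real \<kappa> * restr (?L v) f q + restr (?L v) g q)"
          using q by (simp add: restr_def)
      qed
      finally show ?thesis .
    qed
    have rr: "restr (?L v) (restr ?P h) = restr (?L v) h" for v h
      using Lsub[of v] by (auto simp: restr_def fun_eq_iff)
    have "(restr ?P f, restr ?P g) \<in> M \<longleftrightarrow> (\<forall>v\<in>V. (restr (?L v) f, restr (?L v) g) \<in> Mv v)"
      using Mv by (auto simp: local_decomp_def dL_def rr)
    also have "\<dots> \<longleftrightarrow> (\<forall>v\<in>V. \<forall>p\<in>?L v. f p = (\<Sum>q\<in>?P. of_real (G \<kappa> p q) * (of_real \<kappa> * f q + g q)))"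
    proof (intro ball_cong refl)
      fix v assume v: "v \<in> V"
      have "(restr (?L v) f, restr (?L v) g) \<in> Mv v \<longleftrightarrow> (\<forall>p\<in>?L v. restr (?L v) f p =
          (\<Sum>q\<in>?L v. bdry_res \<kappa> (?L v) (Mv v) p q * (of_real \<kappa> * restr (?L v) f q + restr (?L v) g q)))"
        using k k0 by (intro mem_iff_bdry_res sp(1) v cs finL) auto
      also have "\<dots> \<longleftrightarrow> (\<forall>p\<in>?L v. f p = (\<Sum>q\<in>?P. of_real (G \<kappa> p q) * (of_real \<kappa> * f q + g q)))"
        using sumG[OF v] by (intro ball_cong refl) (simp add: restr_def)
      finally show "(restr (?L v) f, restr (?L v) g) \<in> Mv v \<longleftrightarrow>
        (\<forall>p\<in>?L v. f p = (\<Sum>q\<in>?P. of_real (G \<kappa> p q) * (of_real \<kappa> * f q + g q)))" .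
    qed
    also have "\<dots> \<longleftrightarrow> (\<forall>p\<in>\<Union>v\<in>V. ?L v. f p = (\<Sum>q\<in>?P. of_real (G \<kappa> p q) * (of_real \<kappa> * f q + g q)))"
      by simp
    also have "(\<Union>v\<in>V. ?L v) = ?P"
      using vtxV by (auto simp: Lv_def)
    finally show "(restr ?P f, restr ?P g) \<in> M \<longleftrightarrow> (\<forall>p\<in>?P. f p = (\<Sum>q\<in>?P. of_real (G \<kappa> p q) * (of_real \<kappa> * f q + g q)))" .
  qed
qed

text \<open>The resolvent identity is \<open>G \<kappa> = G \<kappa>1 - (\<kappa> - \<kappa>1) G \<kappa>1 G \<kappa>\<close>.\<close>
lemma bdry_res_decreasing:
  fixes G :: "real \<Rightarrow> ('e, 'i) kidx \<Rightarrow> ('e, 'i) kidx \<Rightarrow> real"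
  assumes fin: "finite P" and "\<kappa>1 \<le> \<kappa>" "q \<in> P" "p \<in> P"
    and nonneg: "\<And>\<kappa> p q. \<kappa> \<ge> \<kappa>1 \<Longrightarrow> G \<kappa> p q \<ge> 0"
    and M: "\<And>\<kappa> f g. \<kappa> \<ge> \<kappa>1 \<Longrightarrow> (restr P f, restr P g) \<in> M \<longleftrightarrow>
       (\<forall>p\<in>P. f p = (\<Sum>q\<in>P. of_real (G \<kappa> p q) * (of_real \<kappa> * f q + g q)))"
  shows "G \<kappa> p q \<le> G \<kappa>1 p q"
proof -
  \<comment> \<open>\<open>f\<close> is the column \<open>q\<close> of \<open>G \<kappa>\<close>,
    and \<open>g\<close> is chosen so that \<open>\<kappa> f + g\<close> is the unit vector at
    \<open>q\<close>. Hence the pair lies in \<open>M\<close> by the criterion at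
    \<open>\<kappa>\<close>, and the criterion at \<open>\<kappa>1\<close> then expresses the same
    column.\<close>
  define f where "f = (\<lambda>p. complex_of_real (G \<kappa> p q))"
  define g where "g = (\<lambda>p. (if p = q then 1 else 0) - of_real \<kappa> * f p)"
  have delta: "(\<Sum>r\<in>P. h r * (if r = q then 1 else 0)) = h q" for h :: "_ \<Rightarrow> complex"
    using fin assms(3) by (simp add: sum.delta if_distrib cong: if_cong)
  have "f p = (\<Sum>r\<in>P. of_real (G \<kappa> p r) * (of_real \<kappa> * f r + g r))" for p
    using delta[of "\<lambda>r. of_real (G \<kappa> p r)"] by (simp add: g_def f_def)
  then have "(restr P f, restr P g) \<in> M"
    using iffD2[OF M[OF assms(2)]] by blast
  then have "f p = (\<Sum>r\<in>P. of_real (G \<kappa>1 p r) * (of_real \<kappa>1 * f r + g r))"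
    using iffD1[OF M[OF order_refl]] assms(4) by blast
  also have "\<dots> = (\<Sum>r\<in>P. of_real (G \<kappa>1 p r) * (if r = q then 1 else 0)
      - of_real ((\<kappa> - \<kappa>1) * (G \<kappa>1 p r * G \<kappa> r q)))"
    by (intro sum.cong) (auto simp: g_def f_def algebra_simps)
  also have "\<dots> = of_real (G \<kappa>1 p q - (\<Sum>r\<in>P. (\<kappa> - \<kappa>1) * (G \<kappa>1 p r * G \<kappa> r q)))"
    unfolding sum_subtractf delta by simp
  finally have "G \<kappa> p q = G \<kappa>1 p q - (\<Sum>r\<in>P. (\<kappa> - \<kappa>1) * (G \<kappa>1 p r * G \<kappa> r q))"
    unfolding f_def of_real_eq_iff .
  moreover have "(\<Sum>r\<in>P. (\<kappa> - \<kappa>1) * (G \<kappa>1 p r * G \<kappa> r q)) \<ge> 0"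
    using assms(2) nonneg by (intro sum_nonneg mult_nonneg_nonneg) auto
  ultimately show ?thesis by simp
qed

section \<open>Small nonnegative linear systems\<close>

text \<open>Abstract form of the boundary system: \<open>d\<close> will be the diagonal coefficient
  \<open>\<kappa>' - \<kappa> coth\<close>, \<open>t\<close> the coupling
  \<open>\<kappa> / sinh\<close> to the other end of the edge. The assumption \<open>small\<close>
  bounds the row sums, so the associated operator at least halves the maximum norm.\<close>

locale small_nonneg_system =
  fixes P :: "'k set" and G :: "'k \<Rightarrow> 'k \<Rightarrow> real" and d t :: "'k \<Rightarrow> real" and opp :: "'k \<Rightarrow> 'k"
  assumes finP: "finite P"
    and opp: "\<And>q. q \<in> P \<Longrightarrow> opp q \<in> P"
    and G: "\<And>p q. p \<in> P \<Longrightarrow> q \<in> P \<Longrightarrow> G p q \<ge> 0"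
    and d: "\<And>q. q \<in> P \<Longrightarrow> d q \<ge> 0"
    and t: "\<And>q. q \<in> P \<Longrightarrow> t q \<ge> 0"
    and small: "\<And>p. p \<in> P \<Longrightarrow> (\<Sum>q\<in>P. G p q * (d q + t q)) \<le> 1 / 2"
begin

text \<open>Polymorphic because the positive matrix is built from real vectors, whereas the boundary
  values of solutions are complex.\<close>

definition T :: "('k \<Rightarrow> 'b) \<Rightarrow> 'k \<Rightarrow> ('b::real_normed_vector)" where
  "T f p = (\<Sum>q\<in>P. G p q *\<^sub>R (d q *\<^sub>R f q + t q *\<^sub>R f (opp q)))"

lemma norm_T_le:
  assumes "\<And>q. q \<in> P \<Longrightarrow> norm (f q) \<le> B" "p \<in> P"
  shows "norm (T f p) \<le> B / 2"
proof -
  have B: "B \<ge> 0" using assms norm_ge_zero order_trans by blast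
  have "norm (T f p) \<le> (\<Sum>q\<in>P. (G p q * (d q + t q)) * B)"
    unfolding T_def
  proof (rule sum_norm_le)
    fix q assume q: "q \<in> P"
    have "norm (d q *\<^sub>R f q + t q *\<^sub>R f (opp q)) \<le> d q * norm (f q) + t q * norm (f (opp q))"
      using d[OF q] t[OF q] norm_triangle_ineq[of "d q *\<^sub>R f q" "t q *\<^sub>R f (opp q)"] by simp
    also have "\<dots> \<le> d q * B + t q * B"
      using d[OF q] t[OF q] assms(1)[OF q] assms(1)[OF opp[OF q]] by (intro add_mono mult_left_mono)
    finally show "norm (G p q *\<^sub>R (d q *\<^sub>R f q + t q *\<^sub>R f (opp q))) \<le> (G p q * (d q + t q)) * B"
      using G[OF assms(2) q] by (simp add: mult.assoc distrib_right mult_left_mono)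
  qed
  also have "\<dots> = (\<Sum>q\<in>P. G p q * (d q + t q)) * B"
    by (simp add: sum_distrib_right)
  also have "\<dots> \<le> 1 / 2 * B" using small[OF assms(2)] B by (rule mult_right_mono)
  finally show ?thesis by simp
qed

lemma T_fixpoint_zero:
  assumes "\<And>p. p \<in> P \<Longrightarrow> v p = T v p" "p \<in> P"
  shows "v p = 0"
proof -
  define m where "m = Max ((\<lambda>p. norm (v p)) ` P)"
  have le: "norm (v q) \<le> m" if "q \<in> P" for q
    unfolding m_def using that finP by (intro Max_ge) auto
  have "m \<in> (\<lambda>p. norm (v p)) ` P"
    unfolding m_def using assms(2) finP by (intro Max_in) auto
  then obtain q where q: "q \<in> P" "m = norm (v q)" by auto
  have "m \<le> m / 2" using norm_T_le[of v m, OF le q(1)] assms(1)[OF q(1)] q(2) by simp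
  then have "norm (v p) \<le> 0" using le[OF assms(2)] by linarith
  then show ?thesis by simp
qed

lemma T_nonneg: "T f p \<ge> 0" if "p \<in> P" "\<And>q. q \<in> P \<Longrightarrow> f q \<ge> 0" for f :: "'k \<Rightarrow> real"
  unfolding T_def using that G d t opp by (intro sum_nonneg) (auto intro!: mult_nonneg_nonneg add_nonneg_nonneg)

text \<open>Neumann series: the iterates of \<open>T\<close> on \<open>b\<close> stay nonnegative
  and decay like \<open>B * (1/2)^n\<close>.\<close>

lemma nonneg_solution:
  fixes b :: "'k \<Rightarrow> real"
  assumes b: "\<And>p. p \<in> P \<Longrightarrow> b p \<ge> 0"
  obtains f where "\<And>p. p \<in> P \<Longrightarrow> f p = T f p + b p" "\<And>p. p \<in> P \<Longrightarrow> f p \<ge> 0"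
proof -
  define x where "x n = (T ^^ n) b" for n
  \<comment> \<open>The inserted 0 keeps \<open>Max\<close> meaningful when \<open>P\<close> is
    empty.\<close>
  define B where "B = Max (insert 0 (b ` P))"
  have xS: "x (Suc n) = T (x n)" for n by (simp add: x_def)
  have x: "0 \<le> x n p \<and> norm (x n p) \<le> B * (1/2)^n" if "p \<in> P" for n p
    using that
  proof (induction n arbitrary: p)
    case 0
    then show ?case using b finP by (auto simp: x_def B_def)
  next
    case (Suc n)
    have "norm (x (Suc n) p) \<le> (B * (1/2)^n) / 2"
      unfolding xS using Suc by (intro norm_T_le) blast+
    moreover have "0 \<le> x (Suc n) p"
      unfolding xS using Suc by (intro T_nonneg) auto
    ultimately show ?case by simp
  qed
  have summ: "summable (\<lambda>n. x n p)" if "p \<in> P" for p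
  proof (rule summable_comparison_test'[where g = "\<lambda>n. B * (1/2)^n" and N = 0])
    show "summable (\<lambda>n. B * (1/2)^n :: real)" by (intro summable_mult summable_geometric) simp
    show "norm (x n p) \<le> B * (1/2)^n" for n using x[OF that] by blast
  qed
  define f where "f p = (\<Sum>n. x n p)" for p
  have sums: "(\<lambda>n. x n p) sums f p" if "p \<in> P" for p
    using summ[OF that] by (simp add: f_def summable_sums)
  show ?thesis
  proof (rule that[of f])
    fix p assume p: "p \<in> P"
    have "(\<lambda>n. T (x n) p) sums T f p"
      unfolding T_def by (intro sums_sum sums_scaleR_right sums_add sums opp)
    then have "(\<lambda>n. x (Suc n) p) sums T f p" by (simp only: xS)
    then have "(\<lambda>n. x n p) sums (T f p + x 0 p)" by (rule sums_Suc)
    then show "f p = T f p + b p"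
      using sums[OF p] sums_unique2 by (force simp: x_def)
    show "f p \<ge> 0"
      unfolding f_def using x p by (intro suminf_nonneg summ) auto
  qed
qed

text \<open>The column \<open>H q\<close> is the nonnegative solution with source
  \<open>G _ q\<close>. It dominates this source, so it is positive at all coordinates of the vertex
  of \<open>q\<close>; positivity then spreads from vertex to vertex along \<open>A\<close>, by
  induction on the path. General sources follow by superposition, and contraction makes the solution
  unique.\<close>

lemma positive_matrix:
  fixes vt :: "'k \<Rightarrow> 'v"
  assumes pos: "\<And>p q. p \<in> P \<Longrightarrow> q \<in> P \<Longrightarrow> vt p = vt q \<Longrightarrow> G p q > 0"
    and adj: "\<And>w w'. (w, w') \<in> A \<Longrightarrow> \<exists>r\<in>P. t r > 0 \<and> vt r = w' \<and> vt (opp r) = w"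
    and conn: "\<And>p q. p \<in> P \<Longrightarrow> q \<in> P \<Longrightarrow> (vt p, vt q) \<in> A\<^sup>*"
  shows "\<exists>F :: 'k \<Rightarrow> 'k \<Rightarrow> real. (\<forall>p\<in>P. \<forall>q\<in>P. F p q > 0) \<and> (\<forall>f \<beta> :: 'k \<Rightarrow> complex.
      (\<forall>p\<in>P. f p = (\<Sum>q\<in>P. of_real (G p q) * (of_real (d q) * f q + of_real (t q) * f (opp q) + \<beta> q)))
      \<longleftrightarrow> (\<forall>p\<in>P. f p = (\<Sum>q\<in>P. of_real (F p q) * \<beta> q)))"
proof -
  have "\<exists>f. \<forall>p\<in>P. f p = T f p + G p q \<and> f p \<ge> 0" if "q \<in> P" for q
    using nonneg_solution[of "\<lambda>p. G p q"] G that by metis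
  then obtain H where H: "\<And>p q. p \<in> P \<Longrightarrow> q \<in> P \<Longrightarrow> H q p = T (H q) p + G p q"
      "\<And>p q. p \<in> P \<Longrightarrow> q \<in> P \<Longrightarrow> H q p \<ge> 0"
    by metis
  have Hpos: "H q p > 0" if q: "q \<in> P" and "p \<in> P" for p q
  proof -
    have "\<forall>p\<in>P. vt p = w \<longrightarrow> H q p > 0" if "(vt q, w) \<in> A\<^sup>*" for w
      using that
    proof (induction rule: rtrancl_induct)
      case base
      show ?case
      proof (intro ballI impI)
        fix p assume "p \<in> P" "vt p = vt q"
        then show "H q p > 0"
          using H(1)[of p q] T_nonneg[of p "H q"] pos[of p q] H(2) q by fastforce
      qed
    next
      case (step w w')
      obtain r where r: "r \<in> P" "t r > 0" "vt r = w'" "vt (opp r) = w"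
        using adj[OF step(2)] by auto
      show ?case
      proof (intro ballI impI)
        fix p assume p: "p \<in> P" "vt p = w'"
        \<comment> \<open>Here \<open>r\<close> is the end at \<open>w'\<close> of an edge whose
          other end \<open>opp r\<close> lies at \<open>w\<close>, where positivity is already
          known. One summand of \<open>T (H q) p\<close> suffices, as all of them are
          nonnegative.\<close>
        have "0 < G p r * (d r * H q r + t r * H q (opp r))"
          using r p pos[of p r] d[OF r(1)] H(2)[OF r(1) q] step(3) opp[OF r(1)]
          by (intro mult_pos_pos add_nonneg_pos mult_nonneg_nonneg) auto
        also have "\<dots> \<le> T (H q) p"
          unfolding T_def using G d t opp H(2) q p
          by (subst real_scaleR_def[symmetric])+ (intro member_le_sum r finP, auto)
        also have "\<dots> \<le> H q p" using H(1)[OF p(1) q] G[OF p(1) q] by simp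
        finally show "H q p > 0" .
      qed
    qed
    from this[OF conn[OF that]] \<open>p \<in> P\<close> show ?thesis by auto
  qed
  \<comment> \<open>Superposition: the columns \<open>H q\<close>, weighted by
    \<open>\<beta> q\<close>, solve the system with the weighted source.\<close>
  have key: "f p = T f p + (\<Sum>q\<in>P. G p q *\<^sub>R \<beta> q)"
    if f: "f = (\<lambda>p. \<Sum>q\<in>P. H q p *\<^sub>R \<beta> q)" and p: "p \<in> P" for f \<beta> :: "'k \<Rightarrow> complex" and p
  proof -
    have "T f p = (\<Sum>r\<in>P. \<Sum>q\<in>P. (G p r * (d r * H q r + t r * H q (opp r))) *\<^sub>R \<beta> q)"
      unfolding T_def f
      by (simp add: scaleR_sum_right sum.distrib[symmetric] algebra_simps)
    also have "\<dots> = (\<Sum>q\<in>P. T (H q) p *\<^sub>R \<beta> q)"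
      by (subst sum.swap) (simp add: T_def scaleR_sum_left)
    finally show ?thesis
      using p unfolding f by (simp add: H(1) scaleR_left_distrib sum.distrib cong: sum.cong)
  qed
  show ?thesis
  proof (intro exI[of _ "\<lambda>p q. H q p"] conjI ballI allI)
    show "H q p > 0" if "p \<in> P" "q \<in> P" for p q using Hpos that by blast
    fix f \<beta> :: "'k \<Rightarrow> complex"
    define h where "h = (\<lambda>p. \<Sum>q\<in>P. H q p *\<^sub>R \<beta> q)"
    have e: "(\<Sum>q\<in>P. of_real (G p q) * (of_real (d q) * f q + of_real (t q) * f (opp q) + \<beta> q))
        = T f p + (\<Sum>q\<in>P. G p q *\<^sub>R \<beta> q)" for f :: "'k \<Rightarrow> complex" and p
      unfolding T_def sum.distrib[symmetric] by (simp add: scaleR_conv_of_real algebra_simps)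
    have e2: "(\<Sum>q\<in>P. of_real (H q p) * \<beta> q) = h p" for p
      by (simp add: h_def scaleR_conv_of_real)
    show "(\<forall>p\<in>P. f p = (\<Sum>q\<in>P. of_real (G p q) * (of_real (d q) * f q + of_real (t q) * f (opp q) + \<beta> q)))
      \<longleftrightarrow> (\<forall>p\<in>P. f p = (\<Sum>q\<in>P. of_real (H q p) * \<beta> q))"
      unfolding e e2
    proof
      assume L: "\<forall>p\<in>P. f p = T f p + (\<Sum>q\<in>P. G p q *\<^sub>R \<beta> q)"
      \<comment> \<open>\<open>f\<close> and \<open>h\<close> solve the equation with the same
        source, so their difference is a fixed point of the contraction.\<close>
      have "(\<lambda>p. f p - h p) p = T (\<lambda>p. f p - h p) p" if "p \<in> P" for p
      proof -
        have "T (\<lambda>p. f p - h p) p = T f p - T h p"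
          unfolding T_def sum_subtractf[symmetric] by (simp add: algebra_simps)
        also have "\<dots> = f p - h p"
          using bspec[OF L that] key[OF h_def that] by (metis add_diff_cancel_right)
        finally show ?thesis by simp
      qed
      from T_fixpoint_zero[OF this] show "\<forall>p\<in>P. f p = h p" by auto
    next
      assume R: "\<forall>p\<in>P. f p = h p"
      have "T f p = T h p" for p
        unfolding T_def using R opp by (intro sum.cong) auto
      then show "\<forall>p\<in>P. f p = T f p + (\<Sum>q\<in>P. G p q *\<^sub>R \<beta> q)"
        using R key[OF h_def] by simp
    qed
  qed
qed

end

section \<open>The boundary response\<close>

fun opp :: "('e, 'i) kidx \<Rightarrow> ('e, 'i) kidx" where
  "opp (KE e) = KE e" | "opp (KM i) = KP i" | "opp (KP i) = KM i"

text \<open>For an external edge \<open>opp\<close> is the identity and the two coefficients take their limits 1 and 0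
  as the length tends to infinity.\<close>
fun dn_coth :: "('i \<Rightarrow> real) \<Rightarrow> real \<Rightarrow> ('e, 'i) kidx \<Rightarrow> real" where
  "dn_coth a \<kappa> (KE e) = 1"
| "dn_coth a \<kappa> (KM i) = cosh (\<kappa> * a i) / sinh (\<kappa> * a i)"
| "dn_coth a \<kappa> (KP i) = cosh (\<kappa> * a i) / sinh (\<kappa> * a i)"

fun dn_csch :: "('i \<Rightarrow> real) \<Rightarrow> real \<Rightarrow> ('e, 'i) kidx \<Rightarrow> real" where
  "dn_csch a \<kappa> (KE e) = 0"
| "dn_csch a \<kappa> (KM i) = 1 / sinh (\<kappa> * a i)"
| "dn_csch a \<kappa> (KP i) = 1 / sinh (\<kappa> * a i)"

definition dn_data :: "('i \<Rightarrow> real) \<Rightarrow> real \<Rightarrow> (('e, 'i) kidx \<Rightarrow> complex) \<Rightarrow> (('e, 'i) kidx \<Rightarrow> complex)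
    \<Rightarrow> ('e, 'i) kidx \<Rightarrow> complex" where
  "dn_data a \<kappa> \<beta> f p = of_real (\<kappa> * dn_csch a \<kappa> p) * f (opp p) - of_real (\<kappa> * dn_coth a \<kappa> p) * f p + \<beta> p"

text \<open>After clearing denominators this is \<open>sinh (y - x) \<ge> 0\<close>.\<close>

lemma coth_antimono: "0 < x \<Longrightarrow> x \<le> y \<Longrightarrow> cosh y / sinh y \<le> cosh x / sinh (x::real)"
  using sinh_real_nonneg_iff[of "y - x"] by (simp add: sinh_diff divide_simps mult.commute)

lemma sinh_less_cosh: "sinh x < cosh (x::real)"
  by (simp add: sinh_def cosh_def)

text \<open>Reading the scattering matrix at \<open>\<kappa>' = \<kappa> coth (\<kappa> min a) \<ge> \<kappa> coth (\<kappa> a_i)\<close> instead of at \<open>\<kappa>\<close>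
  makes every coefficient of the boundary system nonnegative.\<close>
lemma positive_boundary_response:
  fixes V :: "'v set" and E :: "'e set" and I :: "'i set"
    and M :: "((('e, 'i) kidx \<Rightarrow> complex) \<times> (('e, 'i) kidx \<Rightarrow> complex)) set"
  assumes gr: "graph V E I dm dp de" and con: "graph_connected V I dm dp"
    and "I \<noteq> {}" and a: "\<forall>i\<in>I. a i > 0"
    and pos: "locally_strictly_positive V E I dm dp de M"
  obtains \<kappa>2 and F :: "real \<Rightarrow> ('e, 'i) kidx \<Rightarrow> ('e, 'i) kidx \<Rightarrow> real" where "\<kappa>2 > 0"
    "\<And>\<kappa> p q. \<kappa> \<ge> \<kappa>2 \<Longrightarrow> p \<in> Kset E I \<Longrightarrow> q \<in> Kset E I \<Longrightarrow> F \<kappa> p q > 0"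
    "\<And>\<kappa> f \<beta>. \<kappa> \<ge> \<kappa>2 \<Longrightarrow> (restr (Kset E I) f, restr (Kset E I) (dn_data a \<kappa> \<beta> f)) \<in> M \<longleftrightarrow>
       (\<forall>p\<in>Kset E I. f p = (\<Sum>q\<in>Kset E I. of_real (F \<kappa> p q) * \<beta> q))"
proof (rule local_bdry_res[OF gr pos], goal_cases)
  case (1 \<kappa>1 G)
  note k1 = 1(2) and Gpos = 1(3) and G0 = 1(4) and GM = 1(5)
  let ?P = "Kset E I"
  have finP: "finite ?P" using finite_Kset[OF gr] .
  define am where "am = Min (a ` I)"
  have finI: "finite I" using gr by (simp add: graph_def)
  have am: "am > 0" "\<And>i. i \<in> I \<Longrightarrow> am \<le> a i"
    using a assms(3) finI by (auto simp: am_def)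
  \<comment> \<open>\<open>\<Gamma>\<close> bounds every row sum of \<open>G\<close> at the fixed
    parameter \<open>\<kappa>1\<close>. Below, \<open>\<delta> \<kappa>\<close> bounds
    \<open>d p + t p\<close> at every coordinate: its first summand is
    \<open>\<kappa>' - \<kappa>\<close>, its second the coupling on an edge of the minimal length
    \<open>am\<close>.\<close>
  define \<Gamma> where "\<Gamma> = (\<Sum>p\<in>?P. \<Sum>q\<in>?P. G \<kappa>1 p q)"
  define \<delta> where "\<delta> \<kappa> = \<kappa> * (cosh (\<kappa> * am) / sinh (\<kappa> * am) - 1) + \<kappa> * (1 / sinh (\<kappa> * am))" for \<kappa>
  have "((\<lambda>\<kappa>. \<Gamma> * \<delta> \<kappa>) \<longlongrightarrow> 0) at_top"
    unfolding \<delta>_def using am(1) by real_asymp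
  then have "eventually (\<lambda>\<kappa>. \<Gamma> * \<delta> \<kappa> < 1/2) at_top"
    by (rule order_tendstoD) simp
  then obtain \<kappa>2 where k2: "\<And>\<kappa>. \<kappa> \<ge> \<kappa>2 \<Longrightarrow> \<Gamma> * \<delta> \<kappa> < 1/2"
    by (auto simp: eventually_at_top_linorder)
  \<comment> \<open>A predicate of \<open>\<kappa>\<close> and \<open>F\<close>, so that one matrix
    per \<open>\<kappa>\<close> can be chosen at the end.\<close>
  define resp where "resp \<kappa> F \<longleftrightarrow> (\<forall>p\<in>?P. \<forall>q\<in>?P. F p q > 0) \<and>
    (\<forall>f \<beta>. (restr ?P f, restr ?P (dn_data a \<kappa> \<beta> f)) \<in> M \<longleftrightarrow>
       (\<forall>p\<in>?P. f p = (\<Sum>q\<in>?P. of_real (F p q :: real) * \<beta> q)))" for \<kappa> F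
  have "\<exists>F. resp \<kappa> F"
    if k: "\<kappa> \<ge> max \<kappa>1 \<kappa>2" for \<kappa>
  proof -
    define \<kappa>' where "\<kappa>' = \<kappa> * (cosh (\<kappa> * am) / sinh (\<kappa> * am))"
    have kp: "\<kappa> > 0" using k k1 max.cobounded1[of \<kappa>1 \<kappa>2] by linarith
    have "1 \<le> cosh (\<kappa> * am) / sinh (\<kappa> * am)"
      using kp am sinh_less_cosh[of "\<kappa> * am"] by (simp add: divide_simps)
    then have kk: "\<kappa> \<le> \<kappa>'" using kp mult_left_mono[of 1 _ \<kappa>] unfolding \<kappa>'_def by fastforce
    then have k'1: "\<kappa>' \<ge> \<kappa>1" using k by simp
    define d where "d p = \<kappa>' - \<kappa> * dn_coth a \<kappa> p" for p :: "('e, 'i) kidx"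
    define t where "t p = \<kappa> * dn_csch a \<kappa> p" for p :: "('e, 'i) kidx"
    have ka: "0 < \<kappa> * am" "\<kappa> * am \<le> \<kappa> * a i" if "i \<in> I" for i
      using kp am that by auto
    have d0: "d p \<ge> 0" if "p \<in> ?P" for p
    proof -
      have "\<kappa> * dn_coth a \<kappa> p \<le> \<kappa>'" if "dn_coth a \<kappa> p \<le> cosh (\<kappa> * am) / sinh (\<kappa> * am)"
        using that kp unfolding \<kappa>'_def by (intro mult_left_mono) auto
      moreover have "dn_coth a \<kappa> p \<le> cosh (\<kappa> * am) / sinh (\<kappa> * am)"
        using that coth_antimono[OF ka] \<open>1 \<le> cosh (\<kappa> * am) / sinh (\<kappa> * am)\<close> unfolding Kset_def by auto
      ultimately show ?thesis by (simp add: d_def)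
    qed
    have t0: "t p \<ge> 0" if "p \<in> ?P" for p
      using that kp a by (auto simp: Kset_def t_def)
    have dt: "d p + t p \<le> \<delta> \<kappa>" if "p \<in> ?P" for p
    proof (rule order_trans)
      have c1: "1 \<le> dn_coth a \<kappa> p"
        using that a kp less_imp_le[OF sinh_less_cosh] by (auto simp: Kset_def le_divide_eq)
      have c2: "dn_csch a \<kappa> p \<le> 1 / sinh (\<kappa> * am)"
      proof -
        have "1 / sinh (\<kappa> * a i) \<le> 1 / sinh (\<kappa> * am)" if "i \<in> I" for i
          using ka[OF that] by (intro divide_left_mono mult_pos_pos) auto
        moreover have "0 \<le> sinh (\<kappa> * am)" using am(1) kp by simp
        ultimately show ?thesis using that by (auto simp: Kset_def)
      qed
      have "d p \<le> \<kappa>' - \<kappa> * 1"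
        unfolding d_def using c1 kp by (intro diff_left_mono mult_left_mono) auto
      moreover have "t p \<le> \<kappa> * (1 / sinh (\<kappa> * am))"
        unfolding t_def using c2 kp by (intro mult_left_mono) auto
      ultimately show "d p + t p \<le> (\<kappa>' - \<kappa> * 1) + \<kappa> * (1 / sinh (\<kappa> * am))" by (rule add_mono)
      show "(\<kappa>' - \<kappa> * 1) + \<kappa> * (1 / sinh (\<kappa> * am)) \<le> \<delta> \<kappa>"
        by (simp add: \<delta>_def \<kappa>'_def algebra_simps)
    qed
    interpret small_nonneg_system ?P "G \<kappa>'" d t opp
    proof
      show "finite ?P" by (rule finP)
      show "opp q \<in> ?P" if "q \<in> ?P" for q using that by (auto simp: Kset_def)
      show "G \<kappa>' p q \<ge> 0" for p q using G0[OF k'1] .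
      show "d q \<ge> 0" "t q \<ge> 0" if "q \<in> ?P" for q using d0[OF that] t0[OF that] .
      fix p assume p: "p \<in> ?P"
      \<comment> \<open>Monotonicity replaces \<open>G \<kappa>'\<close>, which moves with
        \<open>\<kappa>\<close>, by the fixed \<open>G \<kappa>1\<close>.\<close>
      have "(\<Sum>q\<in>?P. G \<kappa>' p q * (d q + t q)) \<le> (\<Sum>q\<in>?P. G \<kappa>1 p q * \<delta> \<kappa>)"
        using bdry_res_decreasing[OF finP k'1 _ p G0 GM] G0[OF order_refl] dt d0 t0
        by (intro sum_mono mult_mono) auto
      also have "\<dots> = (\<Sum>q\<in>?P. G \<kappa>1 p q) * \<delta> \<kappa>" by (simp add: sum_distrib_right)
      also have "\<dots> \<le> \<Gamma> * \<delta> \<kappa>"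
      proof (rule mult_right_mono)
        show "(\<Sum>q\<in>?P. G \<kappa>1 p q) \<le> \<Gamma>"
          unfolding \<Gamma>_def using p finP G0[OF order_refl]
          by (intro member_le_sum[of p _ "\<lambda>p. \<Sum>q\<in>?P. G \<kappa>1 p q"] sum_nonneg) auto
        show "\<delta> \<kappa> \<ge> 0" using dt[OF p] d0[OF p] t0[OF p] by linarith
      qed
      also have "\<dots> \<le> 1/2" using k2[of \<kappa>] k by simp
      finally show "(\<Sum>q\<in>?P. G \<kappa>' p q * (d q + t q)) \<le> 1/2" .
    qed
    have "\<exists>F :: _ \<Rightarrow> _ \<Rightarrow> real. (\<forall>p\<in>?P. \<forall>q\<in>?P. F p q > 0) \<and> (\<forall>f \<beta> :: ('e, 'i) kidx \<Rightarrow> complex.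
      (\<forall>p\<in>?P. f p = (\<Sum>q\<in>?P. of_real (G \<kappa>' p q) * (of_real (d q) * f q + of_real (t q) * f (opp q) + \<beta> q)))
      \<longleftrightarrow> (\<forall>p\<in>?P. f p = (\<Sum>q\<in>?P. of_real (F p q) * \<beta> q)))"
    proof (rule positive_matrix[of "vtx dm dp de" "adj_rel I dm dp"])
      show "0 < G \<kappa>' p q" if "p \<in> ?P" "q \<in> ?P" "vtx dm dp de p = vtx dm dp de q" for p q
        using Gpos[OF k'1 that] .
      show "\<exists>r\<in>?P. t r > 0 \<and> vtx dm dp de r = w' \<and> vtx dm dp de (opp r) = w"
        if "(w, w') \<in> adj_rel I dm dp" for w w'
      proof -
        have tp: "t (KM i) > 0" "t (KP i) > 0" if "i \<in> I" for i
          using that a kp by (auto simp: t_def)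
        from that consider i where "i \<in> I" "dm i = w" "dp i = w'" | i where "i \<in> I" "dm i = w'" "dp i = w"
          by (auto simp: adj_rel_def)
        then show ?thesis
        proof cases
          case 1
          then show ?thesis using tp by (intro bexI[of _ "KP i"]) (auto simp: Kset_def)
        next
          case 2
          then show ?thesis using tp by (intro bexI[of _ "KM i"]) (auto simp: Kset_def)
        qed
      qed
      show "(vtx dm dp de p, vtx dm dp de q) \<in> (adj_rel I dm dp)\<^sup>*" if "p \<in> ?P" "q \<in> ?P" for p q
      proof -
        have "vtx dm dp de p \<in> V" "vtx dm dp de q \<in> V"
          using that gr by (auto simp: Kset_def graph_def)
        then show ?thesis using con by (simp add: graph_connected_def)
      qed
    qed
    \<comment> \<open>Adding \<open>\<kappa>' f\<close> to the Dirichlet-to-Neumann data turns the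
      coefficient \<open>- \<kappa> coth\<close> of \<open>f\<close> into the nonnegative
      \<open>d\<close>; this matches the boundary condition with the abstract system.\<close>
    moreover have "of_real \<kappa>' * f q + dn_data a \<kappa> \<beta> f q = of_real (d q) * f q + of_real (t q) * f (opp q) + \<beta> q"
      for f \<beta> and q :: "('e, 'i) kidx"
      by (simp add: dn_data_def d_def t_def algebra_simps)
    ultimately show ?thesis unfolding resp_def GM[OF k'1] by simp
  qed
  then obtain F where "\<And>\<kappa>. \<kappa> \<ge> max \<kappa>1 \<kappa>2 \<Longrightarrow> resp \<kappa> (F \<kappa>)"
    by metis
  then show ?thesis using k1 by (intro that[of "max \<kappa>1 \<kappa>2" F]) (auto simp: resp_def)
qed

section \<open>Linear differential equations with integrable source\<close>

lemma integral_diff_Icc: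
  fixes f :: "real \<Rightarrow> 'a::euclidean_space"
  assumes "f integrable_on {0..b}" "0 \<le> s" "s \<le> t" "t \<le> b"
  shows "integral {0..t} f - integral {0..s} f = integral {s..t} f"
  using Henstock_Kurzweil_Integration.integral_combine[of 0 s t f]
    integrable_on_subinterval[OF assms(1), of 0 t] assms by (simp add: algebra_simps)

lemma continuous_on_scale_absolutely_integrable:
  fixes \<phi> :: "real \<Rightarrow> 'a::euclidean_space" and E :: "real \<Rightarrow> real"
  assumes "\<phi> absolutely_integrable_on {0..b}" "continuous_on {0..b} E"
  shows "(\<lambda>s. E s *\<^sub>R \<phi> s) absolutely_integrable_on {0..b}"
proof -
  have bil: "bilinear ((*\<^sub>R) :: real \<Rightarrow> 'a \<Rightarrow> 'a)"
    by (simp add: bilinear_conv_bounded_bilinear bounded_bilinear_scaleR)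
  show ?thesis
    using assms(2)
    by (intro absolutely_integrable_bounded_measurable_product[OF bil _ _ _ assms(1)])
      (auto simp: continuous_imp_measurable_on_sets_lebesgue compact_imp_bounded compact_continuous_image)
qed

text \<open>Integration by parts of a smooth against an absolutely continuous function: the defect \<open>H\<close>
  of the formula satisfies \<open>|H t - H s| \<le> C |t - s| |N t - N s|\<close> with \<open>N\<close> continuous.\<close>
lemma integral_by_parts_indefinite:
  fixes \<psi> :: "real \<Rightarrow> 'a::euclidean_space" and E E' :: "real \<Rightarrow> real"
  assumes psi: "\<psi> absolutely_integrable_on {0..b}"
    and E: "\<And>x. (E has_real_derivative E' x) (at x)" and E': "continuous_on UNIV E'"
    and x: "x \<in> {0..b}"
  shows "E x *\<^sub>R integral {0..x} \<psi> = integral {0..x} (\<lambda>s. E' s *\<^sub>R integral {0..s} \<psi> + E s *\<^sub>R \<psi> s)"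
proof -
  define \<Psi> where "\<Psi> x = integral {0..x} \<psi>" for x
  define N where "N x = integral {0..x} (\<lambda>y. norm (\<psi> y))" for x
  define J where "J s = E' s *\<^sub>R \<Psi> s + E s *\<^sub>R \<psi> s" for s
  define H where "H x = E x *\<^sub>R \<Psi> x - integral {0..x} J" for x
  have contE: "continuous_on S E" for S
    using E by (intro DERIV_continuous_on) (blast intro: has_field_derivative_at_within)
  have contE': "continuous_on S E'" for S
    using E' continuous_on_subset by blast
  have psi_i: "\<psi> integrable_on {0..b}" "(\<lambda>y. norm (\<psi> y)) integrable_on {0..b}"
    using psi by (auto simp: absolutely_integrable_on_def)
  have cont\<Psi>: "continuous_on {0..b} \<Psi>" and contN: "continuous_on {0..b} N"
    unfolding \<Psi>_def N_def using psi_i by (auto intro: indefinite_integral_continuous_1)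
  have E\<psi>: "(\<lambda>s. E s *\<^sub>R \<psi> s) integrable_on {0..b}"
    using continuous_on_scale_absolutely_integrable[OF psi contE] by (rule set_lebesgue_integral_eq_integral(1))
  have E'\<Psi>: "(\<lambda>s. E' s *\<^sub>R \<Psi> s) integrable_on {0..b}"
    by (intro integrable_continuous_real continuous_intros contE' cont\<Psi>)
  have Ji: "J integrable_on {0..b}"
    unfolding J_def by (intro integrable_add E\<psi> E'\<Psi>)
  obtain K where K: "\<And>s. s \<in> {0..b} \<Longrightarrow> \<bar>E' s\<bar> \<le> K"
    using compact_imp_bounded[OF compact_continuous_image[OF contE'[of "{0..b}"] compact_Icc]]
    unfolding bounded_iff real_norm_def by blast
  have Kpos: "0 \<le> K" using K[OF x] by linarith
  have Ediff: "\<bar>E t - E r\<bar> \<le> K * (t - r)" if "0 \<le> r" "r \<le> t" "t \<le> b" for r t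
  proof (cases "r = t")
    case False
    then have "r < t" using that by simp
    from MVT2[OF this, of E E'] E obtain z where z: "r < z" "z < t" "E t - E r = (t - r) * E' z"
      by blast
    then show ?thesis using K[of z] that by (simp add: abs_mult mult.commute mult_left_mono)
  qed simp
  \<comment> \<open>On \<open>{s..t}\<close> the factor \<open>\<Psi>\<close> is frozen at
    \<open>s\<close> and \<open>E\<close> at \<open>t\<close>. The remainders are the integrals of
    \<open>E' r (\<Psi> s - \<Psi> r)\<close> and \<open>(E t - E r) \<psi> r\<close>; each is at
    most \<open>K (t - s) (N t - N s)\<close>.\<close>
  have le: "norm (H t - H s) \<le> 2 * K * (t - s) * (N t - N s)" if st: "0 \<le> s" "s \<le> t" "t \<le> b" for s t
  proof -
    have sub: "{s..t} \<subseteq> {0..b}" using st by auto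
    have Nd: "N t - N s = integral {s..t} (\<lambda>y. norm (\<psi> y))"
      unfolding N_def using integral_diff_Icc[OF psi_i(2) st] .
    have i1: "(\<lambda>r. E' r *\<^sub>R (\<Psi> s - \<Psi> r)) integrable_on {s..t}"
      by (intro integrable_continuous_real continuous_intros contE' continuous_on_subset[OF cont\<Psi> sub])
    have i2: "\<psi> integrable_on {s..t}" "(\<lambda>r. E r *\<^sub>R \<psi> r) integrable_on {s..t}"
      "(\<lambda>y. norm (\<psi> y)) integrable_on {s..t}" "J integrable_on {s..t}"
      using integrable_on_subinterval[OF _ sub] psi_i E\<psi> Ji by auto
    have i3: "(\<lambda>r. (E t - E r) *\<^sub>R \<psi> r) integrable_on {s..t}"
      unfolding scaleR_left_diff_distrib by (intro integrable_diff integrable_cmul i2)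
    have i4: "E' integrable_on {s..t}" "(\<lambda>r. E' r *\<^sub>R \<Psi> s) integrable_on {s..t}"
      by (intro integrable_continuous_real continuous_intros contE')+
    have FTC: "integral {s..t} E' = E t - E s"
      by (intro integral_unique fundamental_theorem_of_calculus[OF st(2)]
          has_vector_derivative_at_within[OF E[unfolded has_real_derivative_iff_has_vector_derivative]])
    have "H t - H s = E t *\<^sub>R \<Psi> t - E s *\<^sub>R \<Psi> s - integral {s..t} J"
      unfolding H_def using integral_diff_Icc[OF Ji st] by (simp add: algebra_simps)
    also have "E t *\<^sub>R \<Psi> t - E s *\<^sub>R \<Psi> s = integral {s..t} (\<lambda>r. E' r *\<^sub>R \<Psi> s) + integral {s..t} (\<lambda>r. E t *\<^sub>R \<psi> r)"
    proof -
      have "integral {s..t} (\<lambda>r. E' r *\<^sub>R \<Psi> s) = (E t - E s) *\<^sub>R \<Psi> s"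
        unfolding FTC[symmetric] using has_integral_scaleR_left[OF integrable_integral[OF i4(1)]]
        by (rule integral_unique)
      moreover have "integral {s..t} (\<lambda>r. E t *\<^sub>R \<psi> r) = E t *\<^sub>R (\<Psi> t - \<Psi> s)"
        unfolding \<Psi>_def using integral_diff_Icc[OF psi_i(1) st] by simp
      moreover have "E t *\<^sub>R \<Psi> t - E s *\<^sub>R \<Psi> s = (E t - E s) *\<^sub>R \<Psi> s + E t *\<^sub>R (\<Psi> t - \<Psi> s)"
        by (simp add: algebra_simps)
      ultimately show ?thesis by (simp only:)
    qed
    also have "\<dots> - integral {s..t} J = integral {s..t} (\<lambda>r. (E' r *\<^sub>R \<Psi> s + E t *\<^sub>R \<psi> r) - J r)"
      using i2 i4 by (simp add: integral_diff integral_add integrable_add integrable_cmul)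
    also have "\<dots> = integral {s..t} (\<lambda>r. E' r *\<^sub>R (\<Psi> s - \<Psi> r) + (E t - E r) *\<^sub>R \<psi> r)"
      unfolding J_def by (simp add: algebra_simps)
    also have "\<dots> = integral {s..t} (\<lambda>r. E' r *\<^sub>R (\<Psi> s - \<Psi> r)) + integral {s..t} (\<lambda>r. (E t - E r) *\<^sub>R \<psi> r)"
      by (rule integral_add[OF i1 i3])
    finally have eq: "H t - H s = \<dots>" .
    have b1: "norm (integral {s..t} (\<lambda>r. E' r *\<^sub>R (\<Psi> s - \<Psi> r))) \<le> K * (N t - N s) * (t - s)"
    proof (rule integral_bound)
      show "s \<le> t" by fact
      show "continuous_on {s..t} (\<lambda>r. E' r *\<^sub>R (\<Psi> s - \<Psi> r))"
        by (intro continuous_intros contE' continuous_on_subset[OF cont\<Psi> sub])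
      fix r assume r: "r \<in> {s..t}"
      have "norm (\<Psi> r - \<Psi> s) = norm (integral {s..r} \<psi>)"
        unfolding \<Psi>_def using r st by (subst integral_diff_Icc[OF psi_i(1)]) auto
      also have "\<dots> \<le> integral {s..r} (\<lambda>y. norm (\<psi> y))"
        using r st by (intro integral_norm_bound_integral integrable_on_subinterval[OF psi_i(1)]
            integrable_on_subinterval[OF psi_i(2)]) auto
      also have "\<dots> \<le> integral {s..t} (\<lambda>y. norm (\<psi> y))"
        using r st by (intro integral_subset_le integrable_on_subinterval[OF psi_i(2)]) auto
      finally show "norm (E' r *\<^sub>R (\<Psi> s - \<Psi> r)) \<le> K * (N t - N s)"
        unfolding Nd using K[of r] r st Kpos by (auto simp: norm_minus_commute intro!: mult_mono)
    qed
    have "norm (integral {s..t} (\<lambda>r. (E t - E r) *\<^sub>R \<psi> r)) \<le> integral {s..t} (\<lambda>r. (K * (t - s)) *\<^sub>R norm (\<psi> r))"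
    proof (rule integral_norm_bound_integral[OF i3])
      show "(\<lambda>r. (K * (t - s)) *\<^sub>R norm (\<psi> r)) integrable_on {s..t}" by (rule integrable_cmul[OF i2(3)])
      fix r assume r: "r \<in> {s..t}"
      have "\<bar>E t - E r\<bar> \<le> K * (t - r)" using r st by (intro Ediff) auto
      also have "\<dots> \<le> K * (t - s)" using r Kpos by (intro mult_left_mono) auto
      finally show "norm ((E t - E r) *\<^sub>R \<psi> r) \<le> (K * (t - s)) *\<^sub>R norm (\<psi> r)"
        by (simp add: mult_right_mono)
    qed
    also have "\<dots> = K * (t - s) * (N t - N s)" unfolding Nd by simp
    finally have b2: "norm (integral {s..t} (\<lambda>r. (E t - E r) *\<^sub>R \<psi> r)) \<le> K * (t - s) * (N t - N s)" .
    show ?thesis unfolding eq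
      using order_trans[OF norm_triangle_ineq add_mono[OF b1 b2]] by (simp add: algebra_simps)
  qed
  have le': "norm (H t - H s) \<le> (2 * K * \<bar>N t - N s\<bar>) * \<bar>t - s\<bar>" if st: "s \<in> {0..b}" "t \<in> {0..b}" for s t
  proof -
    have *: "norm (H t - H s) \<le> (2 * K * \<bar>N t - N s\<bar>) * \<bar>t - s\<bar>" if "0 \<le> s" "s \<le> t" "t \<le> b" for s t
    proof (rule order_trans[OF le[OF that]])
      have "2 * K * (t - s) * (N t - N s) \<le> 2 * K * (t - s) * \<bar>N t - N s\<bar>"
        using that Kpos by (intro mult_left_mono) auto
      moreover have "\<bar>t - s\<bar> = t - s" using that by simp
      ultimately show "2 * K * (t - s) * (N t - N s) \<le> (2 * K * \<bar>N t - N s\<bar>) * \<bar>t - s\<bar>"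
        by (simp only: mult_ac)
    qed
    show ?thesis using *[of s t] *[of t s] st
      by (cases "s \<le> t") (auto simp: norm_minus_commute abs_minus_commute)
  qed
  \<comment> \<open>After division by \<open>\<bar>y - s\<bar>\<close> the bound is
    \<open>2 K \<bar>N y - N s\<bar>\<close>, which tends to 0 by continuity of \<open>N\<close>. So
    \<open>H\<close> has derivative 0 at every point, even where \<open>\<Psi>\<close> has no
    derivative.\<close>
  have "(H has_derivative (\<lambda>h. 0)) (at s within {0..b})" if s: "s \<in> {0..b}" for s
    unfolding has_derivative_within
  proof (intro conjI)
    have "((\<lambda>y. 2 * K * \<bar>N y - N s\<bar>) \<longlongrightarrow> 2 * K * \<bar>N s - N s\<bar>) (at s within {0..b})"
      using contN s by (intro tendsto_intros) (auto simp: continuous_on_def)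
    then have l: "((\<lambda>y. 2 * K * \<bar>N y - N s\<bar>) \<longlongrightarrow> 0) (at s within {0..b})" by simp
    show "((\<lambda>y. (1 / norm (y - s)) *\<^sub>R (H y - (H s + 0))) \<longlongrightarrow> 0) (at s within {0..b})"
    proof (rule Lim_null_comparison[OF _ l])
      show "\<forall>\<^sub>F y in at s within {0..b}. norm ((1 / norm (y - s)) *\<^sub>R (H y - (H s + 0))) \<le> 2 * K * \<bar>N y - N s\<bar>"
        using le'[OF s] by (auto simp: eventually_at_filter divide_simps)
    qed
  qed simp
  then have "H x = H 0"
    using has_derivative_zero_unique[of "{0..b}" H x 0] x by auto
  also have "H 0 = 0" by (simp add: H_def \<Psi>_def)
  finally show ?thesis unfolding H_def J_def \<Psi>_def by simp
qed

text \<open>Duhamel's formula for \<open>w' = l w + \<phi>\<close>, \<open>w 0 = c\<close>, in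
  integrated form. It is the integration by parts of \<open>exp (l x)\<close> against the indefinite
  integral of \<open>exp (- l y) \<phi> y\<close>.\<close>

lemma first_order_linear_ode:
  fixes \<phi> w :: "real \<Rightarrow> 'a::euclidean_space"
  assumes phi: "\<phi> absolutely_integrable_on {0..b}"
    and w: "\<And>x. w x = exp (l * x) *\<^sub>R (c + integral {0..x} (\<lambda>y. exp (- l * y) *\<^sub>R \<phi> y))"
  shows "continuous_on {0..b} w"
    and "x \<in> {0..b} \<Longrightarrow> w x = c + integral {0..x} (\<lambda>s. l *\<^sub>R w s + \<phi> s)"
proof -
  define \<psi> where "\<psi> y = exp (- l * y) *\<^sub>R \<phi> y" for y
  have psi: "\<psi> absolutely_integrable_on {0..b}"
    unfolding \<psi>_def by (intro continuous_on_scale_absolutely_integrable[OF phi] continuous_intros)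
  show cont: "continuous_on {0..b} w"
    using indefinite_integral_continuous_1[of \<psi> 0 b] psi unfolding w \<psi>_def absolutely_integrable_on_def
    by (intro continuous_intros) auto
  assume x: "x \<in> {0..b}"
  have parts: "exp (l * x) *\<^sub>R integral {0..x} \<psi>
      = integral {0..x} (\<lambda>s. (l * exp (l * s)) *\<^sub>R integral {0..s} \<psi> + exp (l * s) *\<^sub>R \<psi> s)"
    using x by (intro integral_by_parts_indefinite[OF psi])
      (auto intro!: derivative_eq_intros continuous_intros)
  have D: "((\<lambda>s. exp (l * s) *\<^sub>R c) has_vector_derivative (l * exp (l * s)) *\<^sub>R c) (at s within {0..x})" for s
    by (rule derivative_eq_intros refl)+ simp
  have fc: "((\<lambda>s. (l * exp (l * s)) *\<^sub>R c) has_integral exp (l * x) *\<^sub>R c - exp (l * 0) *\<^sub>R c) {0..x}"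
    using x by (intro fundamental_theorem_of_calculus D) auto
  have int: "(\<lambda>s. (l * exp (l * s)) *\<^sub>R integral {0..s} \<psi> + exp (l * s) *\<^sub>R \<psi> s) integrable_on {0..x}"
  proof -
    have "continuous_on {0..b} (\<lambda>s. integral {0..s} \<psi>)"
      using indefinite_integral_continuous_1[of \<psi> 0 b] psi unfolding absolutely_integrable_on_def by auto
    then have "(\<lambda>s. (l * exp (l * s)) *\<^sub>R integral {0..s} \<psi>) integrable_on {0..b}"
      by (intro integrable_continuous_real continuous_intros)
    moreover have "(\<lambda>s. exp (l * s) *\<^sub>R \<psi> s) integrable_on {0..b}"
      by (intro set_lebesgue_integral_eq_integral(1) continuous_on_scale_absolutely_integrable psi continuous_intros)
    ultimately have "(\<lambda>s. (l * exp (l * s)) *\<^sub>R integral {0..s} \<psi> + exp (l * s) *\<^sub>R \<psi> s) integrable_on {0..b}"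
      by (rule integrable_add)
    then show ?thesis using x by (elim integrable_on_subinterval) auto
  qed
  have "w x = c + (integral {0..x} (\<lambda>s. (l * exp (l * s)) *\<^sub>R c)
       + integral {0..x} (\<lambda>s. (l * exp (l * s)) *\<^sub>R integral {0..s} \<psi> + exp (l * s) *\<^sub>R \<psi> s))"
    unfolding integral_unique[OF fc] parts[symmetric] w \<psi>_def[symmetric] by (simp add: scaleR_right_distrib)
  also have "\<dots> = c + integral {0..x} (\<lambda>s. (l * exp (l * s)) *\<^sub>R c +
       ((l * exp (l * s)) *\<^sub>R integral {0..s} \<psi> + exp (l * s) *\<^sub>R \<psi> s))"
    using integral_add[OF has_integral_integrable[OF fc] int] by simp
  also have "\<dots> = c + integral {0..x} (\<lambda>s. l *\<^sub>R w s + \<phi> s)"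
  proof -
    have "exp (l * s) *\<^sub>R \<psi> s = \<phi> s" for s by (simp add: \<psi>_def exp_minus)
    then show ?thesis
      unfolding w \<psi>_def[symmetric] by (simp add: scaleR_right_distrib add_ac)
  qed
  finally show "w x = c + integral {0..x} (\<lambda>s. l *\<^sub>R w s + \<phi> s)" .
qed

text \<open>The equation \<open>u'' = \<kappa>\<^sup>2 u - \<phi>\<close> is split into two
  first-order ones, \<open>w' = l w - \<phi> / (2 l)\<close> for \<open>l = \<kappa>\<close> and
  \<open>l = - \<kappa>\<close>. Their sources cancel in
  \<open>u = w \<kappa> + w (- \<kappa>)\<close> and add up to \<open>- \<phi>\<close> in the
  derivative of \<open>u' = \<kappa> (w \<kappa> - w (- \<kappa>))\<close>. The splitting is
  exported as well, since it separates the growing from the decaying exponential on external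
  edges.\<close>

lemma second_order_linear_ode:
  fixes \<phi> u u' :: "real \<Rightarrow> complex" and w :: "real \<Rightarrow> real \<Rightarrow> complex"
  assumes phi: "\<phi> absolutely_integrable_on {0..b}" and k: "\<kappa> > 0"
    and u: "\<And>x. u x = cosh (\<kappa> * x) *\<^sub>R f + (sinh (\<kappa> * x) / \<kappa>) *\<^sub>R g
              - integral {0..x} (\<lambda>y. (sinh (\<kappa> * (x - y)) / \<kappa>) *\<^sub>R \<phi> y)"
    and u': "\<And>x. u' x = (\<kappa> * sinh (\<kappa> * x)) *\<^sub>R f + cosh (\<kappa> * x) *\<^sub>R g
              - integral {0..x} (\<lambda>y. cosh (\<kappa> * (x - y)) *\<^sub>R \<phi> y)"
    and w: "\<And>l x. w l x = exp (l * x) *\<^sub>R ((1/2) *\<^sub>R (f + g /\<^sub>R l) + integral {0..x} (\<lambda>y. exp (- l * y) *\<^sub>R ((- 1 / (2 * l)) *\<^sub>R \<phi> y)))"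
  shows "continuous_on {0..b} u" "continuous_on {0..b} u'"
    and "x \<in> {0..b} \<Longrightarrow> u x = f + integral {0..x} u'"
    and "x \<in> {0..b} \<Longrightarrow> u' x = g + integral {0..x} (\<lambda>s. \<kappa>\<^sup>2 *\<^sub>R u s - \<phi> s)"
    and "x \<in> {0..b} \<Longrightarrow> u x = w \<kappa> x + w (- \<kappa>) x"
proof -
  have phis: "(\<lambda>y. (- 1 / (2 * l)) *\<^sub>R \<phi> y) absolutely_integrable_on {0..b}" for l
    by (intro continuous_on_scale_absolutely_integrable phi continuous_intros)
  have ei: "(\<lambda>y. exp (l * y) *\<^sub>R \<phi> y) integrable_on {0..x}" if "x \<in> {0..b}" for l x
  proof -
    have "(\<lambda>y. exp (l * y) *\<^sub>R \<phi> y) integrable_on {0..b}"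
      by (intro set_lebesgue_integral_eq_integral(1) continuous_on_scale_absolutely_integrable phi continuous_intros)
    then show ?thesis using that by (elim integrable_on_subinterval) auto
  qed
  define \<Psi> where "\<Psi> l x = integral {0..x} (\<lambda>y. exp (l * y) *\<^sub>R \<phi> y)" for l x
  have w\<Psi>: "w l x = exp (l * x) *\<^sub>R ((1/2) *\<^sub>R (f + g /\<^sub>R l) - (1 / (2 * l)) *\<^sub>R \<Psi> (- l) x)" for l x
  proof -
    have "integral {0..x} (\<lambda>y. exp (- l * y) *\<^sub>R ((- 1 / (2 * l)) *\<^sub>R \<phi> y)) = (- 1 / (2 * l)) *\<^sub>R \<Psi> (- l) x"
      unfolding \<Psi>_def integral_cmul[symmetric] by (simp add: mult.commute)
    then show ?thesis unfolding w by simp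
  qed
  have S: "integral {0..x} (\<lambda>y. (sinh (\<kappa> * (x - y)) / \<kappa>) *\<^sub>R \<phi> y)
      = (1 / (2 * \<kappa>)) *\<^sub>R (exp (\<kappa> * x) *\<^sub>R \<Psi> (- \<kappa>) x - exp (- \<kappa> * x) *\<^sub>R \<Psi> \<kappa> x)"
    and C: "integral {0..x} (\<lambda>y. cosh (\<kappa> * (x - y)) *\<^sub>R \<phi> y)
      = (1 / 2) *\<^sub>R (exp (\<kappa> * x) *\<^sub>R \<Psi> (- \<kappa>) x + exp (- \<kappa> * x) *\<^sub>R \<Psi> \<kappa> x)"
    if x: "x \<in> {0..b}" for x
  proof -
    have h: "((\<lambda>y. c *\<^sub>R (exp (\<kappa> * x) *\<^sub>R (exp (- \<kappa> * y) *\<^sub>R \<phi> y) + d *\<^sub>R (exp (- \<kappa> * x) *\<^sub>R (exp (\<kappa> * y) *\<^sub>R \<phi> y))))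
      has_integral c *\<^sub>R (exp (\<kappa> * x) *\<^sub>R \<Psi> (- \<kappa>) x + d *\<^sub>R (exp (- \<kappa> * x) *\<^sub>R \<Psi> \<kappa> x))) {0..x}" for c d
      unfolding \<Psi>_def by (intro has_integral_cmul has_integral_add integrable_integral ei x)
    have "(sinh (\<kappa> * (x - y)) / \<kappa>) *\<^sub>R \<phi> y = (1 / (2 * \<kappa>)) *\<^sub>R (exp (\<kappa> * x) *\<^sub>R (exp (- \<kappa> * y) *\<^sub>R \<phi> y) + (- 1) *\<^sub>R (exp (- \<kappa> * x) *\<^sub>R (exp (\<kappa> * y) *\<^sub>R \<phi> y)))" for y
      using k by (simp add: sinh_def right_diff_distrib exp_diff exp_minus field_simps exp_add[symmetric] flip: scaleR_left_diff_distrib)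
    then show "integral {0..x} (\<lambda>y. (sinh (\<kappa> * (x - y)) / \<kappa>) *\<^sub>R \<phi> y)
      = (1 / (2 * \<kappa>)) *\<^sub>R (exp (\<kappa> * x) *\<^sub>R \<Psi> (- \<kappa>) x - exp (- \<kappa> * x) *\<^sub>R \<Psi> \<kappa> x)"
      using integral_unique[OF h[of "1 / (2 * \<kappa>)" "- 1"]] by simp
    have "cosh (\<kappa> * (x - y)) *\<^sub>R \<phi> y = (1 / 2) *\<^sub>R (exp (\<kappa> * x) *\<^sub>R (exp (- \<kappa> * y) *\<^sub>R \<phi> y) + 1 *\<^sub>R (exp (- \<kappa> * x) *\<^sub>R (exp (\<kappa> * y) *\<^sub>R \<phi> y)))" for y
      by (simp add: cosh_def right_diff_distrib exp_diff exp_minus field_simps flip: scaleR_left_distrib)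
    then show "integral {0..x} (\<lambda>y. cosh (\<kappa> * (x - y)) *\<^sub>R \<phi> y)
      = (1 / 2) *\<^sub>R (exp (\<kappa> * x) *\<^sub>R \<Psi> (- \<kappa>) x + exp (- \<kappa> * x) *\<^sub>R \<Psi> \<kappa> x)"
      using integral_unique[OF h[of "1 / 2" 1]] by simp
  qed
  have uw: "u x = w \<kappa> x + w (- \<kappa>) x" and u'w: "u' x = \<kappa> *\<^sub>R w \<kappa> x - \<kappa> *\<^sub>R w (- \<kappa>) x" if "x \<in> {0..b}" for x
    unfolding u u' w\<Psi> S[OF that] C[OF that] using k
    by (simp_all add: complex_eq_iff cosh_def sinh_def field_simps)
  note ode = first_order_linear_ode[OF phis w]
  show "continuous_on {0..b} u" "continuous_on {0..b} u'"
    using ode(1)[of \<kappa>] ode(1)[of "- \<kappa>"]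
    by (simp_all only: uw u'w cong: continuous_on_cong) (intro continuous_intros; simp)+
  have wi: "(\<lambda>s. l *\<^sub>R w l s + (- 1 / (2 * l)) *\<^sub>R \<phi> s) integrable_on {0..x}" if "x \<in> {0..b}" for l x
  proof -
    have "(\<lambda>s. l *\<^sub>R w l s + (- 1 / (2 * l)) *\<^sub>R \<phi> s) integrable_on {0..b}"
      using phis[of l] by (intro integrable_add integrable_continuous_real continuous_intros ode(1)
          set_lebesgue_integral_eq_integral(1))
    then show ?thesis using that by (elim integrable_on_subinterval) auto
  qed
  have w': "((\<lambda>s. l *\<^sub>R w l s + (- 1 / (2 * l)) *\<^sub>R \<phi> s) has_integral w l x - (1/2) *\<^sub>R (f + g /\<^sub>R l)) {0..x}" if "x \<in> {0..b}" for l x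
  proof -
    have "integral {0..x} (\<lambda>s. l *\<^sub>R w l s + (- 1 / (2 * l)) *\<^sub>R \<phi> s) = w l x - (1/2) *\<^sub>R (f + g /\<^sub>R l)"
      unfolding eq_diff_eq by (subst ode(2)[OF that, of l]) (rule add.commute)
    with integrable_integral[OF wi[OF that, of l]] show ?thesis by (simp only:)
  qed
  show "u x = w \<kappa> x + w (- \<kappa>) x" if "x \<in> {0..b}" using uw[OF that] .
  show "u x = f + integral {0..x} u'" if x: "x \<in> {0..b}"
  proof -
    have "(u' has_integral (w \<kappa> x - (1/2) *\<^sub>R (f + g /\<^sub>R \<kappa>)) + (w (- \<kappa>) x - (1/2) *\<^sub>R (f + g /\<^sub>R (- \<kappa>)))) {0..x}"
      by (rule has_integral_eq[OF _ has_integral_add[OF w'[OF x] w'[OF x]]])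
        (use x k in \<open>auto simp: u'w\<close>)
    from integral_unique[OF this] show ?thesis
      using k unfolding uw[OF x] by (simp add: complex_eq_iff field_simps)
  qed
  show "u' x = g + integral {0..x} (\<lambda>s. \<kappa>\<^sup>2 *\<^sub>R u s - \<phi> s)" if x: "x \<in> {0..b}"
  proof -
    have "((\<lambda>s. \<kappa>\<^sup>2 *\<^sub>R u s - \<phi> s) has_integral \<kappa> *\<^sub>R (w \<kappa> x - (1/2) *\<^sub>R (f + g /\<^sub>R \<kappa>)) - \<kappa> *\<^sub>R (w (- \<kappa>) x - (1/2) *\<^sub>R (f + g /\<^sub>R (- \<kappa>)))) {0..x}"
      by (rule has_integral_eq[OF _ has_integral_diff[OF has_integral_cmul[OF w'[OF x]] has_integral_cmul[OF w'[OF x]]]])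
        (use x k in \<open>auto simp: uw complex_eq_iff power2_eq_square field_simps\<close>)
    from integral_unique[OF this] show ?thesis
      using k unfolding u'w[OF x] by (simp add: complex_eq_iff field_simps)
  qed
qed

text \<open>The integral equations make \<open>v\<close> continuous, hence \<open>v'\<close>
  continuous, hence both differentiable in the classical sense. Then
  \<open>exp (- l s) (v' s + l v s)\<close> has derivative zero whenever
  \<open>l\<^sup>2 = \<kappa>\<^sup>2\<close>, and the two choices of \<open>l\<close> determine
  \<open>v\<close> and \<open>v'\<close>.\<close>

lemma exponentials_of_ode:
  fixes v v' :: "real \<Rightarrow> complex"
  assumes v: "\<And>x. x \<in> {0..b} \<Longrightarrow> v x = v 0 + integral {0..x} v'"
    and v': "\<And>x. x \<in> {0..b} \<Longrightarrow> v' x = v' 0 + integral {0..x} (\<lambda>s. \<kappa>\<^sup>2 *\<^sub>R v s)"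
    and i: "v' integrable_on {0..b}" and k: "\<kappa> \<noteq> 0" and x: "x \<in> {0..b}"
  shows "v x = cosh (\<kappa> * x) *\<^sub>R v 0 + (sinh (\<kappa> * x) / \<kappa>) *\<^sub>R v' 0"
    and "v' x = (\<kappa> * sinh (\<kappa> * x)) *\<^sub>R v 0 + cosh (\<kappa> * x) *\<^sub>R v' 0"
proof -
  have cv: "continuous_on {0..b} v"
    using indefinite_integral_continuous_1[OF i] by (subst continuous_on_cong[OF refl v]) (auto intro!: continuous_intros)
  have i2: "continuous_on {0..b} (\<lambda>s. \<kappa>\<^sup>2 *\<^sub>R v s)" by (intro continuous_intros cv)
  have cv': "continuous_on {0..b} v'"
    using indefinite_integral_continuous_1[OF integrable_continuous_real[OF i2]]
    by (subst continuous_on_cong[OF refl v']) (auto intro!: continuous_intros)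
  have dv: "(v has_vector_derivative v' s) (at s within {0..b})" if "s \<in> {0..b}" for s
  proof -
    have "((\<lambda>x. v 0 + integral {0..x} v') has_vector_derivative v' s) (at s within {0..b})"
      using integral_has_vector_derivative[OF cv' that] by (intro derivative_eq_intros) auto
    then show ?thesis by (rule has_vector_derivative_transform[OF that, rotated]) (rule v)
  qed
  have dv': "(v' has_vector_derivative \<kappa>\<^sup>2 *\<^sub>R v s) (at s within {0..b})" if "s \<in> {0..b}" for s
  proof -
    have "((\<lambda>x. v' 0 + integral {0..x} (\<lambda>s. \<kappa>\<^sup>2 *\<^sub>R v s)) has_vector_derivative \<kappa>\<^sup>2 *\<^sub>R v s) (at s within {0..b})"
      using integral_has_vector_derivative[OF i2 that] by (intro derivative_eq_intros) auto
    then show ?thesis by (rule has_vector_derivative_transform[OF that, rotated]) (rule v')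
  qed
  have first_order: "v' x + l *\<^sub>R v x = exp (l * x) *\<^sub>R (v' 0 + l *\<^sub>R v 0)" if "l\<^sup>2 = \<kappa>\<^sup>2" for l
  proof -
    define h where "h s = exp (- l * s) *\<^sub>R (v' s + l *\<^sub>R v s)" for s
    have "(h has_vector_derivative 0) (at s within {0..b})" if "s \<in> {0..b}" for s
    proof -
      have "(h has_vector_derivative exp (- l * s) *\<^sub>R (\<kappa>\<^sup>2 *\<^sub>R v s + l *\<^sub>R v' s)
          + (exp (- l * s) * (- l)) *\<^sub>R (v' s + l *\<^sub>R v s)) (at s within {0..b})"
        unfolding h_def
      proof (rule has_vector_derivative_scaleR)
        show "((\<lambda>s. exp (- l * s)) has_field_derivative exp (- l * s) * (- l)) (at s within {0..b})"
          by (rule derivative_eq_intros refl)+ simp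
        show "((\<lambda>s. v' s + l *\<^sub>R v s) has_vector_derivative \<kappa>\<^sup>2 *\<^sub>R v s + l *\<^sub>R v' s) (at s within {0..b})"
          by (intro has_vector_derivative_add dv'[OF that]
              bounded_linear.has_vector_derivative[OF bounded_linear_scaleR_right dv[OF that]])
      qed
      also have "exp (- l * s) *\<^sub>R (\<kappa>\<^sup>2 *\<^sub>R v s + l *\<^sub>R v' s) + (exp (- l * s) * (- l)) *\<^sub>R (v' s + l *\<^sub>R v s) = 0"
        unfolding \<open>l\<^sup>2 = \<kappa>\<^sup>2\<close>[symmetric] by (simp add: complex_eq_iff power2_eq_square algebra_simps)
      finally show ?thesis .
    qed
    then have "h x = h 0"
      using has_derivative_zero_unique[of "{0..b}" h x 0] x by (auto simp: has_vector_derivative_def)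
    then have "exp (l * x) *\<^sub>R h x = exp (l * x) *\<^sub>R h 0" by simp
    then show ?thesis by (simp add: h_def exp_minus)
  qed
  show "v x = cosh (\<kappa> * x) *\<^sub>R v 0 + (sinh (\<kappa> * x) / \<kappa>) *\<^sub>R v' 0"
    and "v' x = (\<kappa> * sinh (\<kappa> * x)) *\<^sub>R v 0 + cosh (\<kappa> * x) *\<^sub>R v' 0"
    using first_order[of \<kappa>] first_order[of "- \<kappa>"] k
    by (auto simp: complex_eq_iff cosh_def sinh_def field_simps)
qed

section \<open>Square integrability\<close>

lemma L2_iff:
  assumes "S \<in> sets lebesgue"
  shows "L2 S f \<longleftrightarrow> f \<in> borel_measurable (lebesgue_on S) \<and> (\<lambda>x. (cmod (f x))\<^sup>2) integrable_on S"
  by (simp add: L2_def measurable_on_iff_borel_measurable[OF assms])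

lemma L2_mult_absolutely_integrable:
  assumes "S \<in> sets lebesgue" "L2 S f" "L2 S g"
  shows "(\<lambda>x. f x * g x) absolutely_integrable_on S"
proof (rule measurable_bounded_by_integrable_imp_absolutely_integrable[OF _ assms(1)])
  show "(\<lambda>x. f x * g x) \<in> borel_measurable (lebesgue_on S)"
    using assms by (auto simp: L2_iff)
  show "(\<lambda>x. (cmod (f x))\<^sup>2 + (cmod (g x))\<^sup>2) integrable_on S"
    using assms by (intro integrable_add) (auto simp: L2_iff)
  show "norm (f x * g x) \<le> (cmod (f x))\<^sup>2 + (cmod (g x))\<^sup>2" for x
    using sum_squares_bound[of "cmod (f x)" "cmod (g x)"] mult_nonneg_nonneg[OF norm_ge_zero[of "f x"] norm_ge_zero[of "g x"]]
    unfolding norm_mult by linarith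
qed

lemma L2_of_norm_bound:
  assumes "S \<in> sets lebesgue" "f \<in> borel_measurable (lebesgue_on S)"
    "K integrable_on S" "\<And>x. x \<in> S \<Longrightarrow> (cmod (f x))\<^sup>2 \<le> K x"
  shows "L2 S f"
  using assms measurable_bounded_by_integrable_imp_integrable[of "\<lambda>x. (cmod (f x))\<^sup>2" S K]
  by (auto simp: L2_iff)

lemma L2_cmult: "S \<in> sets lebesgue \<Longrightarrow> L2 S f \<Longrightarrow> L2 S (\<lambda>x. c * f x)"
  by (rule L2_of_norm_bound[where K = "\<lambda>x. (cmod c)\<^sup>2 *\<^sub>R (cmod (f x))\<^sup>2"])
    (auto simp: L2_iff norm_mult power_mult_distrib intro: integrable_on_mult_right)

lemma L2_add:
  assumes "S \<in> sets lebesgue" "L2 S f" "L2 S g"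
  shows "L2 S (\<lambda>x. f x + g x)"
proof (rule L2_of_norm_bound[OF assms(1)])
  show "(\<lambda>x. f x + g x) \<in> borel_measurable (lebesgue_on S)"
    using assms by (auto simp: L2_iff)
  show "(\<lambda>x. 2 *\<^sub>R (cmod (f x))\<^sup>2 + 2 *\<^sub>R (cmod (g x))\<^sup>2) integrable_on S"
    using assms by (intro integrable_add integrable_cmul) (auto simp: L2_iff)
  show "(cmod (f x + g x))\<^sup>2 \<le> 2 *\<^sub>R (cmod (f x))\<^sup>2 + 2 *\<^sub>R (cmod (g x))\<^sup>2" for x
    using power_mono[OF norm_triangle_ineq[of "f x" "g x"], of 2] sum_squares_bound[of "cmod (f x)" "cmod (g x)"]
    by (simp add: power2_sum)
qed

lemma L2_imp_absolutely_integrable_Icc: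
  assumes "L2 S f" "S \<in> sets lebesgue" "{0..b} \<subseteq> S"
  shows "f absolutely_integrable_on {0..b}"
proof (rule measurable_bounded_by_integrable_imp_absolutely_integrable)
  show "f \<in> borel_measurable (lebesgue_on {0..b})"
    using assms by (auto simp: L2_iff intro: measurable_restrict_mono)
  have "(\<lambda>x. (cmod (f x))\<^sup>2) integrable_on {0..b}"
    using assms by (auto simp: L2_iff intro: integrable_on_subinterval)
  then show "(\<lambda>x. 1 + (cmod (f x))\<^sup>2) integrable_on {0..b}"
    by (intro integrable_add) auto
  show "norm (f x) \<le> 1 + (cmod (f x))\<^sup>2" for x
  proof -
    have "2 * norm (f x) \<le> 1 + (cmod (f x))\<^sup>2" using sum_squares_bound[of 1 "cmod (f x)"] by simp
    then show ?thesis using norm_ge_zero[of "f x"] by linarith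
  qed
qed auto

lemma continuous_on_Ici_real:
  fixes f :: "real \<Rightarrow> 'a::topological_space"
  assumes "\<And>b. continuous_on {0..b} f"
  shows "continuous_on {0..} f"
proof (clarsimp simp: continuous_on_eq_continuous_within)
  fix x :: real assume x: "0 \<le> x"
  have "at x within {0..} = at x within {0..x + 1}"
    by (rule at_within_nhd[of x "{..<x + 1}"]) auto
  then show "continuous (at x within {0..}) f"
    using assms[of "x + 1"] x by (auto simp: continuous_on_eq_continuous_within)
qed

text \<open>Monotone convergence along the truncations to \<open>{0..n}\<close>.\<close>

lemma integrable_on_Ici_nonneg:
  fixes f :: "real \<Rightarrow> real"
  assumes int: "\<And>b. f integrable_on {0..b}" and nonneg: "\<And>x. x \<ge> 0 \<Longrightarrow> f x \<ge> 0"
    and bound: "\<And>b. b \<ge> 0 \<Longrightarrow> integral {0..b} f \<le> K"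
  shows "f integrable_on {0..}"
proof -
  let ?g = "\<lambda>n x. if x \<in> {0..real n} then f x else 0"
  have I: "{0..real n} \<inter> {0..} = {0..real n}" for n by auto
  have "f integrable_on {0..} \<and> (\<lambda>n. integral {0..} (?g n)) \<longlonglongrightarrow> integral {0..} f"
  proof (rule monotone_convergence_increasing)
    show "?g n integrable_on {0..}" for n
      using int by (simp only: integrable_restrict_Int I)
    show "?g n x \<le> ?g (Suc n) x" if "x \<in> {0..}" for n x using nonneg that by auto
    show "(\<lambda>n. ?g n x) \<longlonglongrightarrow> f x" if "x \<in> {0..}" for x
    proof (rule tendsto_eventually)
      obtain N where "x \<le> real N" using real_arch_simple by blast
      then show "\<forall>\<^sub>F n in sequentially. ?g n x = f x"
        using that by (intro eventually_sequentiallyI[of N]) auto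
    qed
    have "norm (integral {0..} (?g n)) \<le> K" for n
      unfolding integral_restrict_Int I using bound[of "real n"] integral_nonneg[OF int, of "real n"] nonneg by auto
    then show "bounded (range (\<lambda>n. integral {0..} (?g n)))"
      unfolding bounded_iff by blast
  qed
  then show ?thesis ..
qed

text \<open>The integral of \<open>e (f - t)\<^sup>2\<close> is a quadratic polynomial in
  \<open>t\<close> that is never negative; evaluating it at its minimum \<open>A / W\<close> gives
  the inequality.\<close>

lemma weighted_Cauchy_Schwarz:
  fixes e f :: "real \<Rightarrow> real"
  assumes i: "e integrable_on S" "(\<lambda>x. e x * f x) integrable_on S" "(\<lambda>x. e x * (f x)\<^sup>2) integrable_on S"
    and e: "\<And>x. x \<in> S \<Longrightarrow> e x \<ge> 0"
  shows "(integral S (\<lambda>x. e x * f x))\<^sup>2 \<le> integral S e * integral S (\<lambda>x. e x * (f x)\<^sup>2)"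
proof -
  define W A C where "W = integral S e" and "A = integral S (\<lambda>x. e x * f x)" and "C = integral S (\<lambda>x. e x * (f x)\<^sup>2)"
  have quad: "0 \<le> C - 2 * t * A + t\<^sup>2 * W" for t
  proof -
    have "((\<lambda>x. (e x * (f x)\<^sup>2 - (2 * t) *\<^sub>R (e x * f x)) + t\<^sup>2 *\<^sub>R e x) has_integral (C - (2 * t) *\<^sub>R A) + t\<^sup>2 *\<^sub>R W) S"
      unfolding W_def A_def C_def by (intro has_integral_add has_integral_diff has_integral_cmul integrable_integral i)
    moreover have "(e x * (f x)\<^sup>2 - (2 * t) *\<^sub>R (e x * f x)) + t\<^sup>2 *\<^sub>R e x = e x * (f x - t)\<^sup>2" for x
      by (simp add: power2_eq_square algebra_simps)
    ultimately have "((\<lambda>x. e x * (f x - t)\<^sup>2) has_integral (C - (2 * t) *\<^sub>R A) + t\<^sup>2 *\<^sub>R W) S" by simp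
    then have "0 \<le> (C - (2 * t) *\<^sub>R A) + t\<^sup>2 *\<^sub>R W"
      by (rule has_integral_nonneg) (simp add: e)
    then show ?thesis by simp
  qed
  have "W \<ge> 0" unfolding W_def using integral_nonneg[OF i(1) e] .
  have "A\<^sup>2 \<le> W * C"
  proof (cases "W = 0")
    case True
    \<comment> \<open>With zero total weight the polynomial is the affine function
      \<open>C - 2 t A\<close>; if \<open>A\<close> were nonzero, this \<open>t\<close> would give
      it the value -1.\<close>
    then have "A = 0" using quad[of "(C + 1) / (2 * A)"] by (cases "A = 0") auto
    then show ?thesis using True by simp
  next
    case False
    then have "W > 0" using \<open>W \<ge> 0\<close> by simp
    have "0 \<le> W * (C - 2 * (A / W) * A + (A / W)\<^sup>2 * W)"
      using quad[of "A / W"] \<open>W > 0\<close> by (intro mult_nonneg_nonneg) auto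
    also have "\<dots> = W * C - A\<^sup>2" using \<open>W > 0\<close> by (simp add: field_simps power2_eq_square)
    finally show ?thesis by simp
  qed
  then show ?thesis by (simp add: W_def A_def C_def)
qed

section \<open>Convolutions with exponentials on the half-line\<close>

lemma Ici_lebesgue [simp]: "{a::real..} \<in> sets lebesgue"
  by (auto intro: sets_completionI_sets)

lemma exp_L2: "\<kappa> > 0 \<Longrightarrow> L2 {0..} (\<lambda>x. complex_of_real (exp (- \<kappa> * x)))"
proof (rule L2_of_norm_bound)
  assume k: "\<kappa> > 0"
  show "(\<lambda>x. complex_of_real (exp (- \<kappa> * x))) \<in> borel_measurable (lebesgue_on {0..})"
    by (intro continuous_imp_measurable_on_sets_lebesgue continuous_intros) simp
  show "(\<lambda>x. exp (- (2 * \<kappa>) * x)) integrable_on {0..}"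
    using has_integral_exp_minus_to_infinity[of "2 * \<kappa>" 0] k by (auto simp: integrable_on_def)
qed (auto simp flip: exp_double simp: mult_ac)

lemma integrable_weighted:
  fixes \<psi> :: "real \<Rightarrow> 'a::euclidean_space" and e :: "real \<Rightarrow> real"
  assumes "\<psi> absolutely_integrable_on S" "S \<in> sets lebesgue" "continuous_on S e" "\<And>x. x \<in> S \<Longrightarrow> \<bar>e x\<bar> \<le> 1"
  shows "(\<lambda>y. e y *\<^sub>R \<psi> y) absolutely_integrable_on S"
proof -
  have bil: "bilinear ((*\<^sub>R) :: real \<Rightarrow> 'a \<Rightarrow> 'a)"
    by (simp add: bilinear_conv_bounded_bilinear bounded_bilinear_scaleR)
  show ?thesis
    using assms
    by (intro absolutely_integrable_bounded_measurable_product[OF bil _ _ _ assms(1)])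
      (auto simp: continuous_imp_measurable_on_sets_lebesgue bounded_iff)
qed

text \<open>Cauchy-Schwarz with an exponential weight bounds the squared modulus by
  \<open>B / \<kappa>\<close>, where \<open>B\<close> is the same convolution applied to
  \<open>q\<close>, the squared modulus of \<open>\<psi>\<close>. Since
  \<open>B' = - \<kappa> B + q\<close>, \<open>B 0 = 0\<close> and \<open>B \<ge> 0\<close>,
  integrating this equation bounds \<open>\<kappa>\<close> times the integral of \<open>B\<close> by
  the integral of \<open>q\<close>, which replaces an interchange of integrations.\<close>

lemma L2_decaying_convolution:
  fixes \<psi> :: "real \<Rightarrow> complex"
  assumes k: "\<kappa> > 0" and psi: "L2 {0..} \<psi>"
  shows "L2 {0..} (\<lambda>x. exp (- \<kappa> * x) *\<^sub>R integral {0..x} (\<lambda>y. exp (\<kappa> * y) *\<^sub>R \<psi> y))"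
proof -
  \<comment> \<open>Written with \<open>0 +\<close> and \<open>- (- \<kappa>)\<close> to be
    literally an instance of \<open>first_order_linear_ode\<close> with \<open>c = 0\<close> and
    \<open>l = - \<kappa>\<close>; likewise \<open>B\<close>.\<close>
  define w where "w x = exp (- \<kappa> * x) *\<^sub>R (0 + integral {0..x} (\<lambda>y. exp (- (- \<kappa>) * y) *\<^sub>R \<psi> y))" for x
  define q where "q y = (cmod (\<psi> y))\<^sup>2" for y
  define B where "B x = exp (- \<kappa> * x) *\<^sub>R (0 + integral {0..x} (\<lambda>y. exp (- (- \<kappa>) * y) *\<^sub>R q y))" for x
  have psi_i: "\<psi> absolutely_integrable_on {0..b}" for b
    by (intro L2_imp_absolutely_integrable_Icc[OF psi]) auto
  have q0: "q y \<ge> 0" for y by (simp add: q_def)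
  have q_I: "q integrable_on {0..}" using psi unfolding q_def[abs_def] by (simp add: L2_iff)
  have q_i: "q absolutely_integrable_on {0..b}" for b
    using integrable_on_subinterval[OF q_I, of 0 b] q0 by (intro nonnegative_absolutely_integrable_1) auto
  note odew = first_order_linear_ode[OF psi_i w_def] and odeB = first_order_linear_ode[OF q_i B_def]
  have iE: "(\<lambda>y. exp (\<kappa> * y)) integrable_on {0..x}"
    "(\<lambda>y. exp (\<kappa> * y) * cmod (\<psi> y)) integrable_on {0..x}"
    "(\<lambda>y. exp (\<kappa> * y) * q y) integrable_on {0..x}"
    "(\<lambda>y. exp (\<kappa> * y) *\<^sub>R \<psi> y) integrable_on {0..x}" for x
  proof -
    show "(\<lambda>y. exp (\<kappa> * y)) integrable_on {0..x}"
      by (intro integrable_continuous_real continuous_intros)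
    have a: "(\<lambda>y. exp (\<kappa> * y) *\<^sub>R \<psi> y) absolutely_integrable_on {0..x}"
      by (intro continuous_on_scale_absolutely_integrable psi_i continuous_intros)
    then show "(\<lambda>y. exp (\<kappa> * y) *\<^sub>R \<psi> y) integrable_on {0..x}" "(\<lambda>y. exp (\<kappa> * y) * cmod (\<psi> y)) integrable_on {0..x}"
      by (auto simp: absolutely_integrable_on_def)
    have "(\<lambda>y. exp (\<kappa> * y) *\<^sub>R q y) absolutely_integrable_on {0..x}"
      by (intro continuous_on_scale_absolutely_integrable q_i continuous_intros)
    then show "(\<lambda>y. exp (\<kappa> * y) * q y) integrable_on {0..x}"
      by (auto simp: absolutely_integrable_on_def)
  qed
  have B0: "B x \<ge> 0" for x
    unfolding B_def using integral_nonneg[OF iE(3)] q0 by simp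
  have bound: "(cmod (w x))\<^sup>2 \<le> B x / \<kappa>" if x: "x \<ge> 0" for x
  proof -
    have W: "integral {0..x} (\<lambda>y. exp (\<kappa> * y)) = (exp (\<kappa> * x) - 1) / \<kappa>"
    proof -
      have "((\<lambda>y. exp (\<kappa> * y)) has_integral exp (\<kappa> * x) / \<kappa> - exp (\<kappa> * 0) / \<kappa>) {0..x}"
        using x k by (intro fundamental_theorem_of_calculus)
          (auto intro!: derivative_eq_intros simp flip: has_real_derivative_iff_has_vector_derivative)
      then show ?thesis by (simp add: integral_unique diff_divide_distrib)
    qed
    have "cmod (integral {0..x} (\<lambda>y. exp (\<kappa> * y) *\<^sub>R \<psi> y)) \<le> integral {0..x} (\<lambda>y. exp (\<kappa> * y) * cmod (\<psi> y))"
      by (intro integral_norm_bound_integral iE) simp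
    then have "(cmod (integral {0..x} (\<lambda>y. exp (\<kappa> * y) *\<^sub>R \<psi> y)))\<^sup>2 \<le> (integral {0..x} (\<lambda>y. exp (\<kappa> * y) * cmod (\<psi> y)))\<^sup>2"
      by (intro power_mono) auto
    also have "\<dots> \<le> integral {0..x} (\<lambda>y. exp (\<kappa> * y)) * integral {0..x} (\<lambda>y. exp (\<kappa> * y) * q y)"
      using iE unfolding q_def by (intro weighted_Cauchy_Schwarz) auto
    also have "\<dots> \<le> (exp (\<kappa> * x) / \<kappa>) * integral {0..x} (\<lambda>y. exp (\<kappa> * y) * q y)"
      unfolding W using k q0 integral_nonneg[OF iE(3)] by (intro mult_right_mono) (auto simp: divide_right_mono)
    finally have "(exp (- \<kappa> * x))\<^sup>2 * (cmod (integral {0..x} (\<lambda>y. exp (\<kappa> * y) *\<^sub>R \<psi> y)))\<^sup>2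
        \<le> (exp (- \<kappa> * x))\<^sup>2 * ((exp (\<kappa> * x) / \<kappa>) * integral {0..x} (\<lambda>y. exp (\<kappa> * y) * q y))"
      by (rule mult_left_mono) simp
    then show ?thesis
      by (simp add: w_def B_def power_mult_distrib power2_eq_square exp_minus field_simps)
  qed
  have "B integrable_on {0..}"
  proof (rule integrable_on_Ici_nonneg)
    show iB: "B integrable_on {0..b}" for b by (intro integrable_continuous_real odeB(1))
    show "integral {0..b} B \<le> integral {0..} q / \<kappa>" if b: "b \<ge> 0" for b
    proof -
      have qi: "q integrable_on {0..b}" by (rule integrable_on_subinterval[OF q_I]) auto
      have "B b = integral {0..b} (\<lambda>s. - \<kappa> *\<^sub>R B s + q s)" using odeB(2)[of b b] b by simp
      also have "\<dots> = - \<kappa> * integral {0..b} B + integral {0..b} q"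
        using integral_add[OF integrable_cmul[OF iB, of "- \<kappa>"] qi] by simp
      finally have "\<kappa> * integral {0..b} B \<le> integral {0..b} q" using B0[of b] by linarith
      also have "\<dots> \<le> integral {0..} q"
        using q0 by (intro integral_subset_le qi q_I) auto
      finally show ?thesis using k by (simp add: field_simps)
    qed
  qed (rule B0)
  then have "(\<lambda>x. B x / \<kappa>) integrable_on {0..}" by (rule integrable_on_divide)
  moreover have "continuous_on {0..} w" by (intro continuous_on_Ici_real odew(1))
  ultimately have "L2 {0..} w"
    using bound by (intro L2_of_norm_bound[of _ _ "\<lambda>x. B x / \<kappa>"] continuous_imp_measurable_on_sets_lebesgue) auto
  then show ?thesis unfolding w_def[abs_def] by simp
qed

lemma integral_Ici_split:
  fixes f :: "real \<Rightarrow> 'a::euclidean_space"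
  assumes "f absolutely_integrable_on {0..}" "x \<ge> 0"
  shows "f integrable_on {x..}" "integral {0..} f = integral {0..x} f + integral {x..} f"
proof -
  have i: "f integrable_on {0..x}" "f integrable_on {x..}"
    using assms by (auto intro!: set_lebesgue_integral_eq_integral(1) intro: set_integrable_subset)
  have "{0..x} \<inter> {x..} = {x}" "{0..x} \<union> {x..} = {0..}" using assms(2) by auto
  then show "integral {0..} f = integral {0..x} f + integral {x..} f"
    using integral_Un[OF i] by simp
  show "f integrable_on {x..}" by (rule i(2))
qed

text \<open>The mirror image of the decaying case: the difference of integrals is the tail from
  \<open>x\<close> to infinity, weighted by the growing exponential. Now
  \<open>B' = \<kappa> B - q\<close>, so the value of \<open>B\<close> at the right end has the
  unfavourable sign; its tail form bounds it, because \<open>exp (\<kappa> (b - y)) \<le> 1\<close>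
  for \<open>y \<ge> b\<close>.\<close>

lemma L2_tail_convolution:
  fixes \<psi> :: "real \<Rightarrow> complex"
  assumes k: "\<kappa> > 0" and psi: "L2 {0..} \<psi>"
  shows "L2 {0..} (\<lambda>x. exp (\<kappa> * x) *\<^sub>R (integral {0..} (\<lambda>y. exp (- \<kappa> * y) *\<^sub>R \<psi> y) - integral {0..x} (\<lambda>y. exp (- \<kappa> * y) *\<^sub>R \<psi> y)))"
proof -
  define q where "q y = (cmod (\<psi> y))\<^sup>2" for y
  define D0 where "D0 = integral {0..} (\<lambda>y. exp (- \<kappa> * y) *\<^sub>R \<psi> y)"
  define C0 where "C0 = integral {0..} (\<lambda>y. exp (- \<kappa> * y) *\<^sub>R q y)"
  define w where "w x = exp (\<kappa> * x) *\<^sub>R (D0 + integral {0..x} (\<lambda>y. exp (- \<kappa> * y) *\<^sub>R - \<psi> y))" for x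
  define B where "B x = exp (\<kappa> * x) *\<^sub>R (C0 + integral {0..x} (\<lambda>y. exp (- \<kappa> * y) *\<^sub>R - q y))" for x
  have psi_i: "(\<lambda>y. - \<psi> y) absolutely_integrable_on {0..b}" for b
    using L2_imp_absolutely_integrable_Icc[OF psi, of b] by (auto simp: absolutely_integrable_on_def intro: integrable_neg)
  have q0: "q y \<ge> 0" for y by (simp add: q_def)
  have q_I: "q integrable_on {0..}" using psi unfolding q_def[abs_def] by (simp add: L2_iff)
  have q_A: "q absolutely_integrable_on {0..}" using q_I q0 by (intro nonnegative_absolutely_integrable_1) auto
  have q_ib: "q integrable_on {0..b}" for b by (rule integrable_on_subinterval[OF q_I]) auto
  have q_i: "(\<lambda>y. - q y) absolutely_integrable_on {0..b}" for b
    using q_ib[of b] q0 by (auto simp: absolutely_integrable_on_def intro: integrable_neg)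
  note odew = first_order_linear_ode[OF psi_i w_def] and odeB = first_order_linear_ode[OF q_i B_def]
  have eq_A: "(\<lambda>y. exp (- \<kappa> * y) *\<^sub>R q y) absolutely_integrable_on {0..}"
    using k by (intro integrable_weighted q_A continuous_intros) auto
  have epsi_A: "(\<lambda>y. exp (- \<kappa> * y) *\<^sub>R \<psi> y) absolutely_integrable_on {0..}"
    using L2_mult_absolutely_integrable[OF _ exp_L2[OF k] psi] by (simp add: scaleR_conv_of_real)
  have nepsi_A: "(\<lambda>y. exp (- \<kappa> * y) * cmod (\<psi> y)) absolutely_integrable_on {0..}"
    using absolutely_integrable_norm[OF epsi_A] by (simp add: o_def)
  have e_A: "(\<lambda>y. exp (- \<kappa> * y)) integrable_on {x..}" "integral {x..} (\<lambda>y. exp (- \<kappa> * y)) = exp (- \<kappa> * x) / \<kappa>" for x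
    using has_integral_exp_minus_to_infinity[OF k, of x] by (auto simp: integrable_on_def integral_unique)
  have Btail: "B x = exp (\<kappa> * x) * integral {x..} (\<lambda>y. exp (- \<kappa> * y) * q y)" if "x \<ge> 0" for x
    using integral_Ici_split(2)[OF eq_A that] unfolding B_def C0_def by simp
  have wtail: "w x = exp (\<kappa> * x) *\<^sub>R integral {x..} (\<lambda>y. exp (- \<kappa> * y) *\<^sub>R \<psi> y)" if "x \<ge> 0" for x
    using integral_Ici_split(2)[OF epsi_A that] unfolding w_def D0_def by simp
  have iT: "(\<lambda>y. exp (- \<kappa> * y) * q y) integrable_on {x..}" "(\<lambda>y. exp (- \<kappa> * y) *\<^sub>R \<psi> y) integrable_on {x..}"
    "(\<lambda>y. exp (- \<kappa> * y) * cmod (\<psi> y)) integrable_on {x..}" "q integrable_on {x..}" if "x \<ge> 0" for x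
    using integral_Ici_split(1)[OF eq_A that] integral_Ici_split(1)[OF epsi_A that]
      integral_Ici_split(1)[OF nepsi_A that] integral_Ici_split(1)[OF q_A that] by simp_all
  have B0: "B x \<ge> 0" if "x \<ge> 0" for x
    unfolding Btail[OF that] using q0 by (intro mult_nonneg_nonneg integral_nonneg iT that) auto
  have bound: "(cmod (w x))\<^sup>2 \<le> B x / \<kappa>" if x: "x \<ge> 0" for x
  proof -
    have "cmod (integral {x..} (\<lambda>y. exp (- \<kappa> * y) *\<^sub>R \<psi> y)) \<le> integral {x..} (\<lambda>y. exp (- \<kappa> * y) * cmod (\<psi> y))"
      by (intro integral_norm_bound_integral iT x) simp
    then have "(cmod (integral {x..} (\<lambda>y. exp (- \<kappa> * y) *\<^sub>R \<psi> y)))\<^sup>2 \<le> (integral {x..} (\<lambda>y. exp (- \<kappa> * y) * cmod (\<psi> y)))\<^sup>2"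
      by (intro power_mono) auto
    also have "\<dots> \<le> integral {x..} (\<lambda>y. exp (- \<kappa> * y)) * integral {x..} (\<lambda>y. exp (- \<kappa> * y) * q y)"
      using iT[OF x] e_A unfolding q_def by (intro weighted_Cauchy_Schwarz) auto
    finally have "(exp (\<kappa> * x))\<^sup>2 * (cmod (integral {x..} (\<lambda>y. exp (- \<kappa> * y) *\<^sub>R \<psi> y)))\<^sup>2
        \<le> (exp (\<kappa> * x))\<^sup>2 * ((exp (- \<kappa> * x) / \<kappa>) * integral {x..} (\<lambda>y. exp (- \<kappa> * y) * q y))"
      unfolding e_A by (rule mult_left_mono) simp
    then show ?thesis
      unfolding wtail[OF x] Btail[OF x]
      by (simp add: power_mult_distrib power2_eq_square exp_minus field_simps)
  qed
  have "B integrable_on {0..}"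
  proof (rule integrable_on_Ici_nonneg)
    show iB: "B integrable_on {0..b}" for b by (intro integrable_continuous_real odeB(1))
    \<comment> \<open>The factor 2 collects one integral of \<open>q\<close> from the source and one
      from the bound on \<open>B b\<close>.\<close>
    show "integral {0..b} B \<le> 2 * integral {0..} q / \<kappa>" if b: "b \<ge> 0" for b
    proof -
      have "B b = C0 + integral {0..b} (\<lambda>s. \<kappa> *\<^sub>R B s + - q s)" using odeB(2)[of b b] b by simp
      also have "integral {0..b} (\<lambda>s. \<kappa> *\<^sub>R B s + - q s) = \<kappa> * integral {0..b} B - integral {0..b} q"
        using integral_diff[OF integrable_cmul[OF iB, of \<kappa>] q_ib] by simp
      finally have "\<kappa> * integral {0..b} B = B b - C0 + integral {0..b} q" by linarith
      moreover have "C0 \<ge> 0" using B0[of 0] by (simp add: B_def)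
      moreover have "B b \<le> integral {0..} q"
      proof -
        have "B b = integral {b..} (\<lambda>y. exp (\<kappa> * b) *\<^sub>R (exp (- \<kappa> * y) * q y))"
          unfolding Btail[OF b] by simp
        also have "\<dots> \<le> integral {b..} q"
        proof (rule integral_le[OF integrable_cmul[OF iT(1)[OF b]] iT(4)[OF b]])
          fix y assume y: "y \<in> {b..}"
          have "exp (\<kappa> * b) *\<^sub>R (exp (- \<kappa> * y) * q y) = exp (\<kappa> * (b - y)) * q y"
            by (simp add: right_diff_distrib exp_diff exp_minus field_simps)
          also have "\<dots> \<le> 1 * q y"
            using y k q0 by (intro mult_right_mono) (auto simp: mult_le_0_iff)
          finally show "exp (\<kappa> * b) *\<^sub>R (exp (- \<kappa> * y) * q y) \<le> q y" by simp
        qed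
        also have "\<dots> \<le> integral {0..} q" using b q0 by (intro integral_subset_le iT q_I) auto
        finally show ?thesis .
      qed
      moreover have "integral {0..b} q \<le> integral {0..} q"
        using q0 by (intro integral_subset_le q_ib q_I) auto
      ultimately show ?thesis using k by (simp add: field_simps)
    qed
  qed (use B0 in auto)
  then have "(\<lambda>x. B x / \<kappa>) integrable_on {0..}" by (rule integrable_on_divide)
  moreover have "continuous_on {0..} w" by (intro continuous_on_Ici_real odew(1))
  ultimately have "L2 {0..} w"
    using bound by (intro L2_of_norm_bound[of _ _ "\<lambda>x. B x / \<kappa>"] continuous_imp_measurable_on_sets_lebesgue) auto
  then show ?thesis unfolding w_def[abs_def] D0_def by simp
qed

section \<open>The resolvent\<close>

fun ends :: "('e, 'i) edge \<Rightarrow> ('e, 'i) kidx set" where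
  "ends (ExtE e) = {KE e}" | "ends (IntE i) = {KM i, KP i}"

fun start :: "('e, 'i) edge \<Rightarrow> ('e, 'i) kidx" where
  "start (ExtE e) = KE e" | "start (IntE i) = KM i"

text \<open>Solution of the homogeneous equation with value 1 at the end \<open>p\<close> and 0 at
  the other end of the edge; on an external edge the decaying solution.\<close>

fun hat :: "('i \<Rightarrow> real) \<Rightarrow> real \<Rightarrow> ('e, 'i) kidx \<Rightarrow> real \<Rightarrow> real" where
  "hat a \<kappa> (KE e) x = exp (- \<kappa> * x)"
| "hat a \<kappa> (KM i) x = sinh (\<kappa> * (a i - x)) / sinh (\<kappa> * a i)"
| "hat a \<kappa> (KP i) x = sinh (\<kappa> * x) / sinh (\<kappa> * a i)"

text \<open>Sturm-Liouville form: \<open>sinh (\<kappa> x) / \<kappa>\<close> vanishes at the start,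
  the hat function of the start vanishes at the far end or decays, and their Wronskian is 1 in
  absolute value.\<close>

definition dirichlet_green :: "('i \<Rightarrow> real) \<Rightarrow> real \<Rightarrow> ('e, 'i) edge \<Rightarrow> real \<Rightarrow> real \<Rightarrow> real" where
  "dirichlet_green a \<kappa> j x y = sinh (\<kappa> * min x y) / \<kappa> * hat a \<kappa> (start j) (max x y)"

fun edge_pos :: "('i \<Rightarrow> real) \<Rightarrow> ('e, 'i) edge \<Rightarrow> bool" where
  "edge_pos a (ExtE e) = True" | "edge_pos a (IntE i) = (0 < a i)"

lemma continuous_hat: "continuous_on S (hat a \<kappa> p)"
proof (cases p)
  case (KE e)
  have "hat a \<kappa> p = (\<lambda>x. exp (- \<kappa> * x))" using KE by auto
  then show ?thesis by (auto intro!: continuous_intros)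
next
  case (KM i)
  have "hat a \<kappa> p = (\<lambda>x. sinh (\<kappa> * (a i - x)) * inverse (sinh (\<kappa> * a i)))" using KM by (auto simp: divide_inverse)
  then show ?thesis by (auto intro!: continuous_intros)
next
  case (KP i)
  have "hat a \<kappa> p = (\<lambda>x. sinh (\<kappa> * x) * inverse (sinh (\<kappa> * a i)))" using KP by (auto simp: divide_inverse)
  then show ?thesis by (auto intro!: continuous_intros)
qed

lemma intv_lebesgue [simp]: "intv a j \<in> sets lebesgue"
  by (cases j) auto

lemma intv_props:
  shows "x \<in> intv a j \<Longrightarrow> {0..x} \<subseteq> intv a j" "x \<in> intv a j \<Longrightarrow> 0 \<le> x" "edge_pos a j \<Longrightarrow> 0 \<in> intv a j"
  by (cases j; auto)+

lemma L2_continuous_Icc: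
  fixes f :: "real \<Rightarrow> complex"
  assumes "continuous_on {0..b} f"
  shows "L2 {0..b} f"
  using assms by (auto simp: L2_iff continuous_imp_measurable_on_sets_lebesgue
      intro!: integrable_continuous_real continuous_intros)

lemma L2_hat:
  assumes "\<kappa> > 0" "p \<in> ends j"
  shows "L2 (intv a j) (\<lambda>x. complex_of_real (hat a \<kappa> p x))"
proof (cases j)
  case (ExtE e)
  then have "hat a \<kappa> p = (\<lambda>x. exp (- \<kappa> * x))" using assms(2) by auto
  then show ?thesis using ExtE exp_L2[OF assms(1)] by simp
next
  case (IntE i)
  then show ?thesis by (auto intro!: L2_continuous_Icc continuous_intros continuous_hat)
qed

text \<open>Allows internal and external edges to be treated together: on an external edge
  \<open>dn_coth\<close> is 1 and the identity is
  \<open>exp (- \<kappa> x) = cosh (\<kappa> x) - sinh (\<kappa> x)\<close>.\<close>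

lemma hat_start:
  assumes "\<kappa> > 0" "edge_pos a j"
  shows "hat a \<kappa> (start j) x = cosh (\<kappa> * x) - dn_coth a \<kappa> (start j) * sinh (\<kappa> * x)"
  using assms
  by (cases j) (simp_all add: cosh_minus_sinh right_diff_distrib sinh_diff field_simps)

text \<open>Exchanging \<open>x\<close> and \<open>y\<close> in the product form changes it by
  \<open>sinh (\<kappa> (x - y)) / \<kappa>\<close>, by the addition formula. The kernel becomes a
  homogeneous solution in \<open>x\<close> minus a Volterra kernel, to which Duhamel's formula
  applies.\<close>

lemma dirichlet_green_Volterra:
  assumes "\<kappa> > 0" "edge_pos a j"
  shows "dirichlet_green a \<kappa> j x y = sinh (\<kappa> * x) / \<kappa> * hat a \<kappa> (start j) y
    - (if y \<in> {..x} then sinh (\<kappa> * (x - y)) / \<kappa> else 0)"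
  unfolding dirichlet_green_def hat_start[OF assms] using assms
  by (simp add: min_def max_def right_diff_distrib sinh_diff field_simps)

section \<open>The solution on one edge with given boundary values and source\<close>

definition edge_solution :: "('i \<Rightarrow> real) \<Rightarrow> real \<Rightarrow> (('e, 'i) kidx \<Rightarrow> complex) \<Rightarrow> (('e, 'i) edge \<Rightarrow> real \<Rightarrow> complex)
    \<Rightarrow> ('e, 'i) edge \<Rightarrow> real \<Rightarrow> complex" where
  "edge_solution a \<kappa> f \<phi> j x = (\<Sum>p\<in>ends j. of_real (hat a \<kappa> p x) * f p)
     + integral (intv a j) (\<lambda>y. of_real (dirichlet_green a \<kappa> j x y) * \<phi> j y)"

fun host_edge :: "('e, 'i) kidx \<Rightarrow> ('e, 'i) edge" where
  "host_edge (KE e) = ExtE e" | "host_edge (KM i) = IntE i" | "host_edge (KP i) = IntE i"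

text \<open>The source term \<open>\<beta>\<close>: the inward derivative at \<open>p\<close> of the
  Dirichlet solution, written as the pairing of the source with the homogeneous solution belonging
  to \<open>p\<close>.\<close>

definition hat_mass :: "('i \<Rightarrow> real) \<Rightarrow> real \<Rightarrow> (('e, 'i) edge \<Rightarrow> real \<Rightarrow> complex) \<Rightarrow> ('e, 'i) kidx \<Rightarrow> complex" where
  "hat_mass a \<kappa> \<phi> p = integral (intv a (host_edge p)) (\<lambda>y. of_real (hat a \<kappa> p y) * \<phi> (host_edge p) y)"

lemma dirichlet_green_integrable:
  assumes k: "\<kappa> > 0" and e: "edge_pos a j" and phi: "L2 (intv a j) \<phi>" and x: "x \<in> intv a j"
  shows "(\<lambda>y. of_real (dirichlet_green a \<kappa> j x y) * \<phi> y) absolutely_integrable_on intv a j"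
    and "integral (intv a j) (\<lambda>y. of_real (dirichlet_green a \<kappa> j x y) * \<phi> y)
       = (sinh (\<kappa> * x) / \<kappa>) *\<^sub>R integral (intv a j) (\<lambda>y. of_real (hat a \<kappa> (start j) y) * \<phi> y)
         - integral {0..x} (\<lambda>y. (sinh (\<kappa> * (x - y)) / \<kappa>) *\<^sub>R \<phi> y)"
proof -
  let ?S = "intv a j" and ?v = "\<lambda>y. (sinh (\<kappa> * (x - y)) / \<kappa>) *\<^sub>R \<phi> y"
  have S: "{..x} \<inter> ?S = {0..x}" using x by (cases j) auto
  have sj: "start j \<in> ends j" by (cases j) auto
  have h: "(\<lambda>y. of_real (hat a \<kappa> (start j) y) * \<phi> y) absolutely_integrable_on ?S"
    by (rule L2_mult_absolutely_integrable[OF _ L2_hat[OF k sj] phi]) simp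
  have "?v absolutely_integrable_on {0..x}"
    by (intro continuous_on_scale_absolutely_integrable continuous_intros
        L2_imp_absolutely_integrable_Icc[OF phi] intv_props(1) x) (use k in auto)
  then have v: "(\<lambda>y. if y \<in> {..x} then ?v y else 0) absolutely_integrable_on ?S"
    unfolding absolutely_integrable_on_def if_distrib[of norm] norm_zero
    by (simp only: integrable_restrict_Int S simp_thms)
  have eq: "of_real (dirichlet_green a \<kappa> j x y) * \<phi> y = (sinh (\<kappa> * x) / \<kappa>) *\<^sub>R (of_real (hat a \<kappa> (start j) y) * \<phi> y)
      - (if y \<in> {..x} then ?v y else 0)" for y
    unfolding dirichlet_green_Volterra[OF k e] by (simp add: scaleR_conv_of_real algebra_simps)
  show "(\<lambda>y. of_real (dirichlet_green a \<kappa> j x y) * \<phi> y) absolutely_integrable_on ?S"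
    unfolding eq by (intro set_integral_diff absolutely_integrable_scaleR_left h v)
  have "integral ?S (\<lambda>y. of_real (dirichlet_green a \<kappa> j x y) * \<phi> y)
    = integral ?S (\<lambda>y. (sinh (\<kappa> * x) / \<kappa>) *\<^sub>R (of_real (hat a \<kappa> (start j) y) * \<phi> y)) - integral ?S (\<lambda>y. if y \<in> {..x} then ?v y else 0)"
    unfolding eq using h v by (intro integral_diff integrable_cmul set_lebesgue_integral_eq_integral(1))
  also have "\<dots> = (sinh (\<kappa> * x) / \<kappa>) *\<^sub>R integral ?S (\<lambda>y. of_real (hat a \<kappa> (start j) y) * \<phi> y) - integral {0..x} ?v"
    unfolding integral_restrict_Int S by simp
  finally show "integral ?S (\<lambda>y. of_real (dirichlet_green a \<kappa> j x y) * \<phi> y)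
       = (sinh (\<kappa> * x) / \<kappa>) *\<^sub>R integral ?S (\<lambda>y. of_real (hat a \<kappa> (start j) y) * \<phi> y) - integral {0..x} ?v" .
qed

text \<open>Passes from boundary data at both ends to Cauchy data at the start: the value is
  \<open>f\<close>, and the slope is the Dirichlet-to-Neumann expression.\<close>

lemma edge_solution_Volterra:
  assumes k: "\<kappa> > 0" and e: "edge_pos a j" and phi: "L2 (intv a j) (\<phi> j)" and x: "x \<in> intv a j"
  shows "edge_solution a \<kappa> f \<phi> j x = cosh (\<kappa> * x) *\<^sub>R f (start j)
     + (sinh (\<kappa> * x) / \<kappa>) *\<^sub>R dn_data a \<kappa> (hat_mass a \<kappa> \<phi>) f (start j)
     - integral {0..x} (\<lambda>y. (sinh (\<kappa> * (x - y)) / \<kappa>) *\<^sub>R \<phi> j y)"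
proof -
  have m: "hat_mass a \<kappa> \<phi> (start j) = integral (intv a j) (\<lambda>y. of_real (hat a \<kappa> (start j) y) * \<phi> j y)"
    unfolding hat_mass_def by (cases j) auto
  have "(\<Sum>p\<in>ends j. of_real (hat a \<kappa> p x) * f p) = cosh (\<kappa> * x) *\<^sub>R f (start j)
     + (sinh (\<kappa> * x) / \<kappa>) *\<^sub>R (dn_data a \<kappa> (\<lambda>p. 0) f (start j))"
  proof -
    have "(\<Sum>p\<in>ends j. of_real (hat a \<kappa> p x) * f p) = of_real (hat a \<kappa> (start j) x) * f (start j)
        + of_real (dn_csch a \<kappa> (start j) * sinh (\<kappa> * x)) * f (opp (start j))"
      by (cases j) simp_all
    also have "\<dots> = cosh (\<kappa> * x) *\<^sub>R f (start j) + (sinh (\<kappa> * x) / \<kappa>) *\<^sub>R (dn_data a \<kappa> (\<lambda>p. 0) f (start j))"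
      unfolding hat_start[OF k e] using k
      by (simp add: dn_data_def scaleR_conv_of_real algebra_simps)
    finally show ?thesis .
  qed
  then show ?thesis
    unfolding edge_solution_def dirichlet_green_integrable(2)[OF k e phi x]
    by (simp add: dn_data_def m scaleR_right_distrib)
qed

lemma continuous_on_intv:
  fixes f :: "real \<Rightarrow> 'a::topological_space"
  assumes "\<And>x. x \<in> intv a j \<Longrightarrow> continuous_on {0..x} f"
  shows "continuous_on (intv a j) f"
proof (cases j)
  case (ExtE e)
  have "continuous_on {0..b} f" for b using assms[of b] ExtE by (cases "b \<ge> 0") auto
  then show ?thesis using ExtE by (simp add: continuous_on_Ici_real)
next
  case (IntE i)
  then show ?thesis using assms[of "a i"] by (cases "a i \<ge> 0") auto
qed

lemma L2_cong:
  assumes "S \<in> sets lebesgue" "\<And>x. x \<in> S \<Longrightarrow> f x = g x"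
  shows "L2 S f \<longleftrightarrow> L2 S g"
proof -
  have "f \<in> borel_measurable (lebesgue_on S) \<longleftrightarrow> g \<in> borel_measurable (lebesgue_on S)"
    by (intro measurable_cong) (simp add: assms(2))
  moreover have "(\<lambda>x. (cmod (f x))\<^sup>2) integrable_on S \<longleftrightarrow> (\<lambda>x. (cmod (g x))\<^sup>2) integrable_on S"
    by (intro integrable_cong) (simp add: assms(2))
  ultimately show ?thesis by (simp add: L2_iff assms(1))
qed

text \<open>For transferring \<open>H2\<close> between a solution and its explicit formula, which
  are only known to agree on the interval of the edge.\<close>

lemma H2_cong:
  assumes H: "H2 S u u' u''" and v: "\<And>x. x \<in> S \<Longrightarrow> v x = u x" "\<And>x. x \<in> S \<Longrightarrow> v'' x = u'' x"
    and S: "\<And>x. x \<in> S \<Longrightarrow> {0..x} \<subseteq> S" "\<And>x. x \<in> S \<Longrightarrow> 0 \<in> S" "S \<in> sets lebesgue"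
  shows "H2 S v u' v''"
  unfolding H2_def
proof (intro conjI ballI)
  show "L2 S v" "L2 S v''"
    using H L2_cong[OF S(3) v(1)] L2_cong[OF S(3) v(2)] by (auto simp: H2_def)
  fix x assume x: "x \<in> S"
  have eq: "v'' y = u'' y" if "y \<in> {0..x}" for y using v(2) S(1)[OF x] that by blast
  show "v'' absolutely_integrable_on {0..x}"
    using absolutely_integrable_spike[where S = "{}" and f = u'' and T = "{0..x}" and g = v''] eq H x by (simp add: H2_def)
  have "integral {0..x} v'' = integral {0..x} u''" by (intro integral_cong eq)
  then show "u' x = u' 0 + integral {0..x} v''"
    using H x unfolding H2_def by metis
  show "u' absolutely_integrable_on {0..x}" using H x by (simp add: H2_def)
  show "v x = v 0 + integral {0..x} u'"
    using H x v(1)[OF x] v(1)[OF S(2)[OF x]] unfolding H2_def by metis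
qed

text \<open>Derivative of the Volterra form. The kernel
  \<open>sinh (\<kappa> (x - y)) / \<kappa>\<close> vanishes at \<open>y = x\<close>, so the moving
  endpoint contributes nothing.\<close>

definition edge_solution_deriv :: "('i \<Rightarrow> real) \<Rightarrow> real \<Rightarrow> (('e, 'i) kidx \<Rightarrow> complex) \<Rightarrow> (('e, 'i) edge \<Rightarrow> real \<Rightarrow> complex)
    \<Rightarrow> ('e, 'i) edge \<Rightarrow> real \<Rightarrow> complex" where
  "edge_solution_deriv a \<kappa> f \<phi> j x = (\<kappa> * sinh (\<kappa> * x)) *\<^sub>R f (start j)
     + cosh (\<kappa> * x) *\<^sub>R dn_data a \<kappa> (hat_mass a \<kappa> \<phi>) f (start j)
     - integral {0..x} (\<lambda>y. cosh (\<kappa> * (x - y)) *\<^sub>R \<phi> j y)"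

text \<open>The equation and the regularity come from \<open>second_order_linear_ode\<close>. Square
  integrability is immediate from continuity on an internal edge; on an external edge the growing
  and the decaying component are estimated separately.\<close>

lemma edge_solution_H2:
  fixes f :: "('e, 'i) kidx \<Rightarrow> complex"
  assumes k: "\<kappa> > 0" and e: "edge_pos a j" and phi: "L2 (intv a j) (\<phi> j)"
  shows "H2 (intv a j) (edge_solution a \<kappa> f \<phi> j) (edge_solution_deriv a \<kappa> f \<phi> j)
    (\<lambda>x. \<kappa>\<^sup>2 *\<^sub>R edge_solution a \<kappa> f \<phi> j x - \<phi> j x)"
proof -
  let ?S = "intv a j" and ?u = "edge_solution a \<kappa> f \<phi> j"
  define g where "g = dn_data a \<kappa> (hat_mass a \<kappa> \<phi>) f"
  define u' where "u' = edge_solution_deriv a \<kappa> f \<phi> j"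
  have u'_eq: "u' x = (\<kappa> * sinh (\<kappa> * x)) *\<^sub>R f (start j) + cosh (\<kappa> * x) *\<^sub>R g (start j)
              - integral {0..x} (\<lambda>y. cosh (\<kappa> * (x - y)) *\<^sub>R \<phi> j y)" for x
    unfolding u'_def g_def edge_solution_deriv_def ..
  define u where "u x = cosh (\<kappa> * x) *\<^sub>R f (start j) + (sinh (\<kappa> * x) / \<kappa>) *\<^sub>R g (start j)
              - integral {0..x} (\<lambda>y. (sinh (\<kappa> * (x - y)) / \<kappa>) *\<^sub>R \<phi> j y)" for x
  define w where "w l x = exp (l * x) *\<^sub>R ((1/2) *\<^sub>R (f (start j) + g (start j) /\<^sub>R l)
      + integral {0..x} (\<lambda>y. exp (- l * y) *\<^sub>R ((- 1 / (2 * l)) *\<^sub>R \<phi> j y)))" for l x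
  have uu: "?u x = u x" if "x \<in> ?S" for x
    unfolding u_def g_def by (intro edge_solution_Volterra k e phi that)
  have phi_i: "\<phi> j absolutely_integrable_on {0..b}" if "b \<in> ?S" for b
    by (intro L2_imp_absolutely_integrable_Icc[OF phi] intv_props(1) that) simp
  note ode = second_order_linear_ode[OF phi_i k u_def u'_eq w_def]
  have cu: "continuous_on ?S u" by (intro continuous_on_intv ode(1))
  have cu': "continuous_on {0..x} u'" if "x \<in> ?S" for x using ode(2)[OF that] .
  have L2u: "L2 ?S u"
  proof (cases j)
    case (IntE i)
    then show ?thesis using cu L2_continuous_Icc by simp
  next
    case (ExtE v)
    have phi': "L2 {0..} (\<phi> j)" using phi ExtE by simp
    have phis: "L2 {0..} (\<lambda>y. (1 / (2 * \<kappa>)) *\<^sub>R \<phi> j y)"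
      using L2_cmult[OF _ phi', of "of_real (1 / (2 * \<kappa>))"] by (simp add: scaleR_conv_of_real)
    \<comment> \<open>This slope makes the coefficient of the growing exponential equal to
      \<open>1 / (2 \<kappa>)\<close> times the full integral of
      \<open>exp (- \<kappa> y) \<phi> y\<close>, so that component reduces to a tail
      convolution.\<close>
    have gj: "g (start j) = - of_real \<kappa> * f (start j) + integral {0..} (\<lambda>y. exp (- \<kappa> * y) *\<^sub>R \<phi> j y)"
      using ExtE by (simp add: g_def dn_data_def hat_mass_def scaleR_conv_of_real)
    have int1: "integral {0..x} (\<lambda>y. exp (- l * y) *\<^sub>R ((- 1 / (2 * l)) *\<^sub>R \<phi> j y)) = (- 1 / (2 * l)) *\<^sub>R integral {0..x} (\<lambda>y. exp (- l * y) *\<^sub>R \<phi> j y)" for l x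
      unfolding integral_cmul[symmetric] by (simp add: mult.commute)
    have wp: "w \<kappa> x = of_real (1 / (2 * \<kappa>)) * (exp (\<kappa> * x) *\<^sub>R (integral {0..} (\<lambda>y. exp (- \<kappa> * y) *\<^sub>R \<phi> j y) - integral {0..x} (\<lambda>y. exp (- \<kappa> * y) *\<^sub>R \<phi> j y)))" for x
      unfolding w_def int1 gj using k by (simp add: scaleR_conv_of_real field_simps)
    have wm: "w (- \<kappa>) x = (of_real (1/2) * (f (start j) - g (start j) / of_real \<kappa>)) * of_real (exp (- \<kappa> * x))
        + of_real (1 / (2 * \<kappa>)) * (exp (- \<kappa> * x) *\<^sub>R integral {0..x} (\<lambda>y. exp (\<kappa> * y) *\<^sub>R \<phi> j y))" for x
      unfolding w_def int1 using k by (simp add: scaleR_conv_of_real field_simps)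
    have "L2 {0..} (w \<kappa>)"
      unfolding wp[abs_def] by (intro L2_cmult L2_tail_convolution k phi') simp
    moreover have "L2 {0..} (w (- \<kappa>))"
      unfolding wm[abs_def] by (intro L2_add L2_cmult L2_decaying_convolution exp_L2 k phi') simp_all
    ultimately have "L2 {0..} (\<lambda>x. w \<kappa> x + w (- \<kappa>) x)" by (intro L2_add) simp_all
    then show ?thesis
      using ode(5) ExtE by (subst L2_cong[where g = "\<lambda>x. w \<kappa> x + w (- \<kappa>) x"]) auto
  qed
  have "H2 ?S u u' (\<lambda>x. \<kappa>\<^sup>2 *\<^sub>R u x - \<phi> j x)"
    unfolding H2_def
  proof (intro conjI ballI)
    show "L2 ?S u" by fact
    have "L2 ?S (\<lambda>x. of_real (\<kappa>\<^sup>2) * u x + (- 1) * \<phi> j x)"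
      by (intro L2_add L2_cmult L2u phi) simp_all
    then show "L2 ?S (\<lambda>x. \<kappa>\<^sup>2 *\<^sub>R u x - \<phi> j x)" by (simp add: scaleR_conv_of_real)
    fix x assume x: "x \<in> ?S"
    have "0 \<le> x" using intv_props(2)[OF x] .
    then have "0 \<in> {0..x}" "x \<in> {0..x}" by auto
    show "(\<lambda>x. \<kappa>\<^sup>2 *\<^sub>R u x - \<phi> j x) absolutely_integrable_on {0..x}"
      by (intro set_integral_diff absolutely_integrable_continuous_real continuous_intros ode(1)[OF x] phi_i x)
    show "u' absolutely_integrable_on {0..x}"
      by (intro absolutely_integrable_continuous_real cu' x)
    show "u' x = u' 0 + integral {0..x} (\<lambda>x. \<kappa>\<^sup>2 *\<^sub>R u x - \<phi> j x)"
      using ode(4)[OF x \<open>x \<in> {0..x}\<close>] by (simp add: u'_eq)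
    show "u x = u 0 + integral {0..x} u'"
      using ode(3)[OF x \<open>x \<in> {0..x}\<close>] by (simp add: u_def)
  qed
  then show ?thesis
    unfolding u'_def
  proof (rule H2_cong)
    show "{0..x} \<subseteq> ?S" if "x \<in> ?S" for x using intv_props(1)[OF that] .
    show "0 \<in> ?S" using intv_props(3)[OF e] .
  qed (simp_all add: uu)
qed

lemma Kset_cases:
  assumes "p \<in> Kset E I"
  obtains e where "p = KE e" "e \<in> E" | i where "p = KM i" "i \<in> I" | i where "p = KP i" "i \<in> I"
  using assms by (auto simp: Kset_def)

lemma bval_edge_solution:
  assumes k: "\<kappa> > 0" and e: "edge_pos a (host_edge p)" and phi: "L2 (intv a (host_edge p)) (\<phi> (host_edge p))"
  shows "bval a (edge_solution a \<kappa> f \<phi>) p = f p"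
proof -
  have zero: "edge_solution a \<kappa> f \<phi> (host_edge p) 0 = f (start (host_edge p))"
    using edge_solution_Volterra[where \<phi> = \<phi> and j = "host_edge p" and x = 0, OF k e phi] intv_props(3)[OF e] by simp
  show ?thesis
  proof (cases p)
    case (KP i)
    have ai: "a i > 0" using e KP by simp
    have "integral {0..a i} (\<lambda>y. of_real (dirichlet_green a \<kappa> (IntE i) (a i) y) * \<phi> (IntE i) y) = integral {0..a i} (\<lambda>y. 0)"
      by (intro integral_cong) (auto simp: dirichlet_green_def max_def)
    then show ?thesis using KP k ai by (simp add: edge_solution_def)
  qed (use zero in simp_all)
qed

lemma cosh_coth_diff_sinh:
  assumes "x > 0"
  shows "cosh x * (cosh x / sinh x) - sinh x = 1 / sinh (x::real)"
proof -
  have "C * (C / S) - S = 1 / S" if "C\<^sup>2 - S\<^sup>2 = 1" "S > 0" for C S :: real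
    using that by (simp add: field_simps power2_eq_square)
  then show ?thesis using assms by (simp add: hyperbolic_pythagoras)
qed

text \<open>At a start the inward derivative is the Cauchy datum. At the far end of an internal
  edge, \<open>cosh (\<kappa> (a - y))\<close> minus \<open>cosh (\<kappa> a)\<close> times the hat
  function of the start is the hat function of the far end, which merges the two source
  contributions into its \<open>hat_mass\<close>.\<close>

lemma bder_edge_solution:
  fixes p :: "('e, 'i) kidx"
  assumes k: "\<kappa> > 0" and e: "edge_pos a (host_edge p)" and phi: "L2 (intv a (host_edge p)) (\<phi> (host_edge p))"
  shows "bder a (edge_solution_deriv a \<kappa> f \<phi>) p = dn_data a \<kappa> (hat_mass a \<kappa> \<phi>) f p"
proof (cases p)
  case (KP i)
  have ai: "a i > 0" and sp: "sinh (\<kappa> * a i) > 0" using e k KP by simp_all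
  let ?\<phi> = "\<phi> (IntE i)"
  have phi_i: "?\<phi> absolutely_integrable_on {0..a i}"
    using L2_imp_absolutely_integrable_Icc[OF phi, of "a i"] KP by simp
  have i: "(\<lambda>y. cosh (\<kappa> * (a i - y)) *\<^sub>R ?\<phi> y) integrable_on {0..a i}" "(\<lambda>y. hat a \<kappa> (KM i :: ('e, 'i) kidx) y *\<^sub>R ?\<phi> y) integrable_on {0..a i}"
    by (intro set_lebesgue_integral_eq_integral(1) continuous_on_scale_absolutely_integrable phi_i continuous_hat continuous_intros)+
  have "((\<lambda>y. cosh (\<kappa> * (a i - y)) *\<^sub>R ?\<phi> y - cosh (\<kappa> * a i) *\<^sub>R (hat a \<kappa> (KM i :: ('e, 'i) kidx) y *\<^sub>R ?\<phi> y)) has_integral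
      integral {0..a i} (\<lambda>y. cosh (\<kappa> * (a i - y)) *\<^sub>R ?\<phi> y) - cosh (\<kappa> * a i) *\<^sub>R integral {0..a i} (\<lambda>y. hat a \<kappa> (KM i :: ('e, 'i) kidx) y *\<^sub>R ?\<phi> y)) {0..a i}"
    by (rule has_integral_diff[OF integrable_integral[OF i(1)] has_integral_cmul[OF integrable_integral[OF i(2)]]])
  moreover have "cosh (\<kappa> * (a i - y)) *\<^sub>R ?\<phi> y - cosh (\<kappa> * a i) *\<^sub>R (hat a \<kappa> (KM i :: ('e, 'i) kidx) y *\<^sub>R ?\<phi> y) = of_real (hat a \<kappa> (KP i :: ('e, 'i) kidx) y) * ?\<phi> y" for y
  proof -
    have "cosh (\<kappa> * (a i - y)) - cosh (\<kappa> * a i) * hat a \<kappa> (KM i :: ('e, 'i) kidx) y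
        = ((cosh (\<kappa> * a i))\<^sup>2 - (sinh (\<kappa> * a i))\<^sup>2) * sinh (\<kappa> * y) / sinh (\<kappa> * a i)"
    proof -
      have "(C * C' - S * S') - C * ((S * C' - C * S') / S) = (C\<^sup>2 - S\<^sup>2) * S' / S" if "S > 0" for C S C' S' :: real
        using that by (simp add: field_simps power2_eq_square)
      from this[OF sp] show ?thesis by (simp add: right_diff_distrib cosh_diff sinh_diff)
    qed
    also have "\<dots> = hat a \<kappa> (KP i :: ('e, 'i) kidx) y" by (simp add: hyperbolic_pythagoras)
    finally show ?thesis by (metis scaleR_left_diff_distrib scaleR_scaleR scaleR_conv_of_real)
  qed
  ultimately have I: "((\<lambda>y. of_real (hat a \<kappa> (KP i :: ('e, 'i) kidx) y) * ?\<phi> y) has_integral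
      integral {0..a i} (\<lambda>y. cosh (\<kappa> * (a i - y)) *\<^sub>R ?\<phi> y) - cosh (\<kappa> * a i) *\<^sub>R integral {0..a i} (\<lambda>y. hat a \<kappa> (KM i :: ('e, 'i) kidx) y *\<^sub>R ?\<phi> y)) {0..a i}"
    by (simp only:)
  have m: "hat_mass a \<kappa> \<phi> (KP i) = integral {0..a i} (\<lambda>y. cosh (\<kappa> * (a i - y)) *\<^sub>R ?\<phi> y)
      - cosh (\<kappa> * a i) *\<^sub>R hat_mass a \<kappa> \<phi> (KM i)"
  proof -
    have "hat_mass a \<kappa> \<phi> (KM i) = integral {0..a i} (\<lambda>y. hat a \<kappa> (KM i :: ('e, 'i) kidx) y *\<^sub>R ?\<phi> y)"
      "hat_mass a \<kappa> \<phi> (KP i) = integral {0..a i} (\<lambda>y. of_real (hat a \<kappa> (KP i :: ('e, 'i) kidx) y) * ?\<phi> y)"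
      by (simp_all only: hat_mass_def host_edge.simps intv.simps scaleR_conv_of_real)
    then show ?thesis using integral_unique[OF I] by (simp only:)
  qed
  have c: "cosh (\<kappa> * a i) * (cosh (\<kappa> * a i) / sinh (\<kappa> * a i)) - sinh (\<kappa> * a i) = 1 / sinh (\<kappa> * a i)"
    using ai k by (intro cosh_coth_diff_sinh) simp
  have "bder a (edge_solution_deriv a \<kappa> f \<phi>) p
     = (\<kappa> * (cosh (\<kappa> * a i) * (cosh (\<kappa> * a i) / sinh (\<kappa> * a i)) - sinh (\<kappa> * a i))) *\<^sub>R f (KM i)
       - (\<kappa> * (cosh (\<kappa> * a i) / sinh (\<kappa> * a i))) *\<^sub>R f (KP i) + hat_mass a \<kappa> \<phi> (KP i)"
    unfolding m using KP by (simp add: edge_solution_deriv_def dn_data_def scaleR_conv_of_real algebra_simps)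
  then show ?thesis unfolding c using KP by (simp add: dn_data_def scaleR_conv_of_real)
qed (simp_all add: edge_solution_deriv_def)

section \<open>Vanishing of square integrable homogeneous solutions\<close>

lemma absolutely_integrable_const_Ici:
  fixes c :: "'a::euclidean_space"
  assumes "(\<lambda>x. c) absolutely_integrable_on {0::real..}"
  shows "c = 0"
proof (rule ccontr)
  assume "c \<noteq> 0"
  have i: "(\<lambda>x. norm c) integrable_on {0::real..}" using assms by (auto simp: absolutely_integrable_on_def)
  obtain n where n: "integral {0::real..} (\<lambda>x. norm c) / norm c < real n" using reals_Archimedean2 by blast
  have "integral {0..real n} (\<lambda>x. norm c) \<le> integral {0::real..} (\<lambda>x. norm c)"
    by (intro integral_subset_le i) auto
  then show False using n \<open>c \<noteq> 0\<close> by (simp add: field_simps)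
qed

text \<open>Multiplying \<open>v\<close> by \<open>2 exp (- \<kappa> x)\<close> and subtracting the
  integrable decaying contribution leaves the constant \<open>c + d / \<kappa>\<close>, the
  coefficient of the growing exponential up to a factor. An integrable constant on the half-line is
  0.\<close>

lemma L2_exponential_decay:
  fixes c d :: complex
  assumes k: "\<kappa> > 0" and L: "L2 {0..} v"
    and v: "\<And>x. x \<ge> 0 \<Longrightarrow> v x = cosh (\<kappa> * x) *\<^sub>R c + (sinh (\<kappa> * x) / \<kappa>) *\<^sub>R d"
  shows "d = - of_real \<kappa> * c"
proof -
  have e: "L2 {0..} (\<lambda>x. of_real (exp (- \<kappa> * x)))" by (rule exp_L2[OF k])
  let ?B = "c - d / of_real \<kappa>"
  have int: "(\<lambda>x. of_real 2 * (of_real (exp (- \<kappa> * x)) * v x) - ?B * (of_real (exp (- \<kappa> * x)) * of_real (exp (- \<kappa> * x)))) absolutely_integrable_on {0..}"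
    by (intro set_integral_diff set_integrable_mult_right L2_mult_absolutely_integrable e L) auto
  have eq: "of_real 2 * (of_real (exp (- \<kappa> * x)) * v x) - ?B * (of_real (exp (- \<kappa> * x)) * of_real (exp (- \<kappa> * x))) = c + d / of_real \<kappa>"
    if "x \<in> {0..}" for x
    using that k by (simp add: v cosh_def sinh_def scaleR_conv_of_real exp_minus field_simps)
  have "(\<lambda>x. c + d / of_real \<kappa>) absolutely_integrable_on {0::real..}"
    by (rule absolutely_integrable_spike[OF int negligible_empty]) (simp only: eq Diff_empty)
  then have "c + d / of_real \<kappa> = 0" by (rule absolutely_integrable_const_Ici)
  then show ?thesis using k by (simp add: field_simps add_eq_0_iff)
qed

text \<open>The boundary data satisfy the Dirichlet-to-Neumann relation without source, by the
  hyperbolic formulas on internal edges and by square integrability on external ones. Then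
  \<open>F\<close> with \<open>\<beta> = 0\<close> forces zero boundary values, the relation gives
  zero slopes, and so the Cauchy data at the start of every edge vanish.\<close>

lemma homogeneous_solution_zero:
  fixes v v' :: "('e, 'i) edge \<Rightarrow> real \<Rightarrow> complex"
  assumes k: "\<kappa> > 0" and a: "\<And>i. i \<in> I \<Longrightarrow> a i > 0"
    and F: "\<And>f \<beta>. (restr (Kset E I) f, restr (Kset E I) (dn_data a \<kappa> \<beta> f)) \<in> M \<longleftrightarrow>
       (\<forall>p\<in>Kset E I. f p = (\<Sum>q\<in>Kset E I. of_real (F p q :: real) * \<beta> q))"
    and L: "\<And>j. j \<in> Edges E I \<Longrightarrow> L2 (intv a j) (v j)"
    and i: "\<And>j x. j \<in> Edges E I \<Longrightarrow> x \<in> intv a j \<Longrightarrow> v' j integrable_on {0..x}"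
    and v: "\<And>j x. j \<in> Edges E I \<Longrightarrow> x \<in> intv a j \<Longrightarrow> v j x = v j 0 + integral {0..x} (v' j)"
    and v': "\<And>j x. j \<in> Edges E I \<Longrightarrow> x \<in> intv a j \<Longrightarrow> v' j x = v' j 0 + integral {0..x} (\<lambda>s. \<kappa>\<^sup>2 *\<^sub>R v j s)"
    and M: "(restr (Kset E I) (bval a v), restr (Kset E I) (bder a v')) \<in> M"
    and j: "j \<in> Edges E I" and x: "x \<in> intv a j"
  shows "v j x = 0"
proof -
  let ?P = "Kset E I"
  have sol: "v j x = cosh (\<kappa> * x) *\<^sub>R v j 0 + (sinh (\<kappa> * x) / \<kappa>) *\<^sub>R v' j 0"
    "v' j x = (\<kappa> * sinh (\<kappa> * x)) *\<^sub>R v j 0 + cosh (\<kappa> * x) *\<^sub>R v' j 0"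
    if j: "j \<in> Edges E I" and x: "x \<in> intv a j" for j x
  proof -
    have sub: "s \<in> intv a j" if "s \<in> {0..x}" for s using intv_props(1)[OF x] that by blast
    have "x \<in> {0..x}" using intv_props(2)[OF x] by simp
    note exp = exponentials_of_ode[OF v[OF j sub] v'[OF j sub] i[OF j x] less_imp_neq[OF k, symmetric] this]
    show "v j x = cosh (\<kappa> * x) *\<^sub>R v j 0 + (sinh (\<kappa> * x) / \<kappa>) *\<^sub>R v' j 0"
      by (rule exp(1))
    show "v' j x = (\<kappa> * sinh (\<kappa> * x)) *\<^sub>R v j 0 + cosh (\<kappa> * x) *\<^sub>R v' j 0"
      by (rule exp(2))
  qed
  have dn: "bder a v' p = dn_data a \<kappa> (\<lambda>p. 0) (bval a v) p" if "p \<in> ?P" for p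
    using that
  proof (cases rule: Kset_cases)
    case (1 e)
    have j: "ExtE e \<in> Edges E I" using 1 by (simp add: Edges_def)
    have "v' (ExtE e) 0 = - of_real \<kappa> * v (ExtE e) 0"
    proof (rule L2_exponential_decay[OF k])
      show "L2 {0..} (v (ExtE e))" using L[OF j] by simp
      show "v (ExtE e) x = cosh (\<kappa> * x) *\<^sub>R v (ExtE e) 0 + (sinh (\<kappa> * x) / \<kappa>) *\<^sub>R v' (ExtE e) 0" if "x \<ge> 0" for x
        by (rule sol(1)[OF j]) (simp add: that)
    qed
    then show ?thesis using 1 by (simp add: dn_data_def)
  next
    case (2 i)
    have j: "IntE i \<in> Edges E I" using 2 by (simp add: Edges_def)
    have "sinh (\<kappa> * a i) > 0" using k a[OF 2(2)] by simp
    then show ?thesis using 2 k a[OF 2(2)] sol(1)[OF j, of "a i"]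
      by (simp add: dn_data_def scaleR_conv_of_real field_simps)
  next
    case (3 i)
    have j: "IntE i \<in> Edges E I" using 3 by (simp add: Edges_def)
    have sp: "sinh (\<kappa> * a i) > 0" using k a[OF 3(2)] by simp
    have c: "sinh (\<kappa> * a i) = cosh (\<kappa> * a i) * (cosh (\<kappa> * a i) / sinh (\<kappa> * a i)) - 1 / sinh (\<kappa> * a i)"
      using cosh_coth_diff_sinh[of "\<kappa> * a i"] k a[OF 3(2)] by simp
    have "v' (IntE i) (a i) = (\<kappa> * sinh (\<kappa> * a i)) *\<^sub>R v (IntE i) 0 + cosh (\<kappa> * a i) *\<^sub>R v' (IntE i) 0"
      using sol(2)[OF j, of "a i"] a[OF 3(2)] by simp
    also have "\<dots> = (\<kappa> * (cosh (\<kappa> * a i) * (cosh (\<kappa> * a i) / sinh (\<kappa> * a i)) - 1 / sinh (\<kappa> * a i))) *\<^sub>R v (IntE i) 0 + cosh (\<kappa> * a i) *\<^sub>R v' (IntE i) 0"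
      by (subst c) (rule refl)
    also have "\<dots> = (\<kappa> * (cosh (\<kappa> * a i) / sinh (\<kappa> * a i))) *\<^sub>R v (IntE i) (a i) - (\<kappa> / sinh (\<kappa> * a i)) *\<^sub>R v (IntE i) 0"
    proof -
      have va: "v (IntE i) (a i) = cosh (\<kappa> * a i) *\<^sub>R v (IntE i) 0 + (sinh (\<kappa> * a i) / \<kappa>) *\<^sub>R v' (IntE i) 0"
        using a[OF 3(2)] by (intro sol(1)[OF j]) simp
      show ?thesis
        unfolding va using k a[OF 3(2)] by (simp add: scaleR_conv_of_real field_simps)
    qed
    finally show ?thesis using 3 by (simp add: dn_data_def scaleR_conv_of_real)
  qed
  have "restr ?P (bder a v') = restr ?P (dn_data a \<kappa> (\<lambda>p. 0) (bval a v))"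
    using dn by (auto simp: restr_def)
  then have b0: "bval a v p = 0" if "p \<in> ?P" for p
    using M F[of "bval a v" "\<lambda>p. 0"] that by simp
  have "start j \<in> ?P" "opp (start j) \<in> ?P" using j by (auto simp: Edges_def Kset_def)
  then have "bval a v (start j) = 0" "bder a v' (start j) = 0"
    using b0 dn[of "start j"] by (simp_all add: dn_data_def)
  then have "v j 0 = 0" "v' j 0 = 0" by (cases j; simp)+
  then show ?thesis using sol(1)[OF j x] by simp
qed

section \<open>The Green function\<close>

text \<open>A formula of Krein type. Read from the right, the finite-rank part turns the source into
  \<open>hat_mass\<close>, maps it by \<open>F\<close> to boundary values, and extends these to the
  edge as a homogeneous solution.\<close>

definition graph_green :: "('i \<Rightarrow> real) \<Rightarrow> real \<Rightarrow> (('e, 'i) kidx \<Rightarrow> ('e, 'i) kidx \<Rightarrow> real)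
    \<Rightarrow> ('e, 'i) edge \<Rightarrow> ('e, 'i) edge \<Rightarrow> real \<Rightarrow> real \<Rightarrow> real" where
  "graph_green a \<kappa> F j j' x y = (if j = j' then dirichlet_green a \<kappa> j x y else 0)
     + (\<Sum>p\<in>ends j. \<Sum>q\<in>ends j'. hat a \<kappa> p x * F p q * hat a \<kappa> q y)"

lemma finite_ends [simp]: "finite (ends j)"
  by (cases j) auto

lemma hat_nonneg:
  assumes "\<kappa> > 0" "edge_pos a j" "p \<in> ends j" "x \<in> intv a j"
  shows "hat a \<kappa> p x \<ge> 0"
  using assms by (cases j) auto

text \<open>Secures strict positivity up to the ends of an edge, where the Dirichlet kernel
  vanishes: at either end of an internal edge one hat function is 0 but the other is 1.\<close>

lemma hat_pos_ex:
  fixes j :: "('e, 'i) edge"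
  assumes "\<kappa> > 0" "edge_pos a j" "x \<in> intv a j"
  shows "\<exists>p\<in>ends j. hat a \<kappa> p x > 0"
proof (cases j)
  case (IntE i)
  have s: "sinh (\<kappa> * a i) > 0" and x: "0 \<le> x" "x \<le> a i" "0 < a i" using assms IntE by simp_all
  show ?thesis
  proof (cases "x < a i")
    case True
    then have "hat a \<kappa> (KM i :: ('e, 'i) kidx) x > 0" using assms(1) s by simp
    then show ?thesis using IntE by auto
  next
    case False
    then have "hat a \<kappa> (KP i :: ('e, 'i) kidx) x > 0" using assms(1) s x by simp
    then show ?thesis using IntE by auto
  qed
qed auto

lemma start_ends: "start j \<in> ends j"
  by (cases j) auto

lemma graph_green_pos:
  assumes k: "\<kappa> > 0" and e: "edge_pos a j" "edge_pos a j'"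
    and F: "\<And>p q. p \<in> ends j \<Longrightarrow> q \<in> ends j' \<Longrightarrow> F p q > 0"
    and x: "x \<in> intv a j" and y: "y \<in> intv a j'"
  shows "graph_green a \<kappa> F j j' x y > 0"
proof -
  obtain p q where p: "p \<in> ends j" "hat a \<kappa> p x > 0" and q: "q \<in> ends j'" "hat a \<kappa> q y > 0"
    using hat_pos_ex[OF k e(1) x] hat_pos_ex[OF k e(2) y] by blast
  have nn: "0 \<le> hat a \<kappa> p x * F p q * hat a \<kappa> q y" if "p \<in> ends j" "q \<in> ends j'" for p q
    using hat_nonneg[OF k e(1) that(1) x] hat_nonneg[OF k e(2) that(2) y] F[OF that]
    by (intro mult_nonneg_nonneg) auto
  have "0 < hat a \<kappa> p x * F p q * hat a \<kappa> q y"
    using p q F by (intro mult_pos_pos) auto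
  also have "\<dots> \<le> (\<Sum>q\<in>ends j'. hat a \<kappa> p x * F p q * hat a \<kappa> q y)"
    using nn p q by (intro member_le_sum[of q _ "\<lambda>q. hat a \<kappa> p x * F p q * hat a \<kappa> q y"]) auto
  also have "\<dots> \<le> (\<Sum>p\<in>ends j. \<Sum>q\<in>ends j'. hat a \<kappa> p x * F p q * hat a \<kappa> q y)"
    using nn p by (intro member_le_sum[of p _ "\<lambda>p. \<Sum>q\<in>ends j'. hat a \<kappa> p x * F p q * hat a \<kappa> q y"] sum_nonneg) auto
  finally have "0 < (\<Sum>p\<in>ends j. \<Sum>q\<in>ends j'. hat a \<kappa> p x * F p q * hat a \<kappa> q y)" .
  moreover have "(if j = j' then dirichlet_green a \<kappa> j x y else 0) \<ge> 0"
  proof (cases "j = j'")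
    case True
    have "max x y \<in> intv a j" "0 \<le> min x y"
      using x y True intv_props(2)[OF x] intv_props(2)[OF y] by (auto simp: max_def)
    then show ?thesis
      using True k hat_nonneg[OF k e(1) start_ends] by (simp add: dirichlet_green_def)
  qed simp
  ultimately show ?thesis unfolding graph_green_def by linarith
qed

lemma kernel_continuous_graph_green:
  "kernel_continuous E I a (\<lambda>j j' x y. complex_of_real (graph_green a \<kappa> F j j' x y))"
proof -
  have h: "continuous_on S (\<lambda>z. hat a \<kappa> p (g z))" if "continuous_on S g" for S p and g :: "real \<times> real \<Rightarrow> real"
    using continuous_on_compose2[OF continuous_hat[of UNIV] that] by auto
  have "continuous_on S (\<lambda>z. complex_of_real (graph_green a \<kappa> F j j' (fst z) (snd z)))" for S j j'
    unfolding graph_green_def dirichlet_green_def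
    by (cases "j = j'"; simp only: if_True if_False)
      (auto simp: divide_inverse intro!: continuous_intros h)
  then show ?thesis unfolding kernel_continuous_def by (simp add: case_prod_unfold)
qed

lemma sum_Kset_ends:
  fixes h :: "('e, 'i) kidx \<Rightarrow> complex"
  assumes "finite E" "finite I"
  shows "(\<Sum>q\<in>Kset E I. h q) = (\<Sum>j\<in>Edges E I. \<Sum>q\<in>ends j. h q)"
proof -
  have "Kset E I = (\<Union>j\<in>Edges E I. ends j)" by (auto simp: Kset_def Edges_def)
  moreover have "(\<Sum>q\<in>(\<Union>j\<in>Edges E I. ends j). h q) = (\<Sum>j\<in>Edges E I. \<Sum>q\<in>ends j. h q)"
  proof (rule sum.UNION_disjoint)
    show "finite (Edges E I)" using assms by (simp add: Edges_def)
    have "ends j \<inter> ends j' = {}" if "j \<noteq> j'" for j j' :: "('e, 'i) edge" using that by (cases j; cases j') auto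
    then show "\<forall>j\<in>Edges E I. \<forall>j'\<in>Edges E I. j \<noteq> j' \<longrightarrow> ends j \<inter> ends j' = {}" by blast
  qed simp
  ultimately show ?thesis by simp
qed

lemma host_edge_ends: "q \<in> ends j \<Longrightarrow> host_edge q = j"
  by (cases j) auto

lemma host_edge_Edges: "p \<in> Kset E I \<Longrightarrow> host_edge p \<in> Edges E I"
  by (auto simp: Kset_def Edges_def)

lemma graph_green_integral:
  assumes fin: "finite E" "finite I" and k: "\<kappa> > 0" and e: "\<And>j. j \<in> Edges E I \<Longrightarrow> edge_pos a j"
    and phi: "\<And>j. j \<in> Edges E I \<Longrightarrow> L2 (intv a j) (\<phi> j)" and j: "j \<in> Edges E I" and x: "x \<in> intv a j"
  shows "j' \<in> Edges E I \<Longrightarrow> (\<lambda>y. of_real (graph_green a \<kappa> F j j' x y) * \<phi> j' y) absolutely_integrable_on intv a j'"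
    and "(\<Sum>j'\<in>Edges E I. integral (intv a j') (\<lambda>y. of_real (graph_green a \<kappa> F j j' x y) * \<phi> j' y))
      = edge_solution a \<kappa> (\<lambda>p. \<Sum>q\<in>Kset E I. of_real (F p q) * hat_mass a \<kappa> \<phi> q) \<phi> j x"
proof -
  let ?d = "\<lambda>j' y. of_real (dirichlet_green a \<kappa> j x y) * \<phi> j' y"
  let ?h = "\<lambda>j' p q y. of_real (hat a \<kappa> p x * F p q) * (of_real (hat a \<kappa> q y) * \<phi> j' y)"
  have eq: "of_real (graph_green a \<kappa> F j j' x y) * \<phi> j' y
      = (if j = j' then ?d j' y else 0) + (\<Sum>p\<in>ends j. \<Sum>q\<in>ends j'. ?h j' p q y)" for j' y
    unfolding graph_green_def
    by (cases "j = j'") (simp_all add: distrib_right sum_distrib_right mult.assoc)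
  have hi: "(\<lambda>y. of_real (hat a \<kappa> q y) * \<phi> j' y) absolutely_integrable_on intv a j'"
    if "j' \<in> Edges E I" "q \<in> ends j'" for j' q
    by (intro L2_mult_absolutely_integrable L2_hat k that phi intv_lebesgue)
  have hh: "?h j' p q absolutely_integrable_on intv a j'" if "j' \<in> Edges E I" "q \<in> ends j'" for j' p q
    using hi[OF that] set_integrable_mult_right by (cases "complex_of_real (hat a \<kappa> p x * F p q) = 0") (auto simp: set_integrable_def)
  have di: "(\<lambda>y. if j = j' then ?d j' y else 0) absolutely_integrable_on intv a j'" if "j' \<in> Edges E I" for j'
    using dirichlet_green_integrable(1)[OF k e[OF j] phi[OF j] x] by (cases "j = j'") (auto simp: set_integrable_def)
  have si: "(\<lambda>y. \<Sum>p\<in>ends j. \<Sum>q\<in>ends j'. ?h j' p q y) absolutely_integrable_on intv a j'" if "j' \<in> Edges E I" for j'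
    by (intro absolutely_integrable_sum finite_ends hh that)
  show "(\<lambda>y. of_real (graph_green a \<kappa> F j j' x y) * \<phi> j' y) absolutely_integrable_on intv a j'" if "j' \<in> Edges E I"
    unfolding eq by (intro set_integral_add di si that)
  have "integral (intv a j') (\<lambda>y. of_real (graph_green a \<kappa> F j j' x y) * \<phi> j' y)
    = (if j = j' then integral (intv a j') (?d j') else 0)
      + (\<Sum>p\<in>ends j. of_real (hat a \<kappa> p x) * (\<Sum>q\<in>ends j'. of_real (F p q) * hat_mass a \<kappa> \<phi> q))"
    if j': "j' \<in> Edges E I" for j'
  proof -
    have "integral (intv a j') (\<lambda>y. of_real (graph_green a \<kappa> F j j' x y) * \<phi> j' y)
      = integral (intv a j') (\<lambda>y. if j = j' then ?d j' y else 0) + integral (intv a j') (\<lambda>y. \<Sum>p\<in>ends j. \<Sum>q\<in>ends j'. ?h j' p q y)"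
      unfolding eq by (intro integral_add set_lebesgue_integral_eq_integral(1) di si j')
    also have "integral (intv a j') (\<lambda>y. \<Sum>p\<in>ends j. \<Sum>q\<in>ends j'. ?h j' p q y)
      = (\<Sum>p\<in>ends j. \<Sum>q\<in>ends j'. integral (intv a j') (?h j' p q))"
      by (intro integral_unique has_integral_sum finite_ends integrable_integral
          set_lebesgue_integral_eq_integral(1) hh j')
    also have "\<dots> = (\<Sum>p\<in>ends j. of_real (hat a \<kappa> p x) * (\<Sum>q\<in>ends j'. of_real (F p q) * hat_mass a \<kappa> \<phi> q))"
      by (intro sum.cong refl) (simp add: sum_distrib_left hat_mass_def host_edge_ends mult.assoc cong: sum.cong)
    finally show ?thesis by (cases "j = j'") simp_all
  qed
  then have "(\<Sum>j'\<in>Edges E I. integral (intv a j') (\<lambda>y. of_real (graph_green a \<kappa> F j j' x y) * \<phi> j' y))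
    = (\<Sum>j'\<in>Edges E I. (if j = j' then integral (intv a j') (?d j') else 0)
      + (\<Sum>p\<in>ends j. of_real (hat a \<kappa> p x) * (\<Sum>q\<in>ends j'. of_real (F p q) * hat_mass a \<kappa> \<phi> q)))"
    by (rule sum.cong[OF refl])
  also have "\<dots> = integral (intv a j) (?d j)
      + (\<Sum>p\<in>ends j. of_real (hat a \<kappa> p x) * (\<Sum>j'\<in>Edges E I. \<Sum>q\<in>ends j'. of_real (F p q) * hat_mass a \<kappa> \<phi> q))"
  proof -
    have "finite (Edges E I)" using fin by (simp add: Edges_def)
    then show ?thesis
      using j by (simp add: sum.distrib sum.delta' sum.swap[of _ "ends j"] sum_distrib_left)
  qed
  finally show "(\<Sum>j'\<in>Edges E I. integral (intv a j') (\<lambda>y. of_real (graph_green a \<kappa> F j j' x y) * \<phi> j' y))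
      = edge_solution a \<kappa> (\<lambda>p. \<Sum>q\<in>Kset E I. of_real (F p q) * hat_mass a \<kappa> \<phi> q) \<phi> j x"
    unfolding edge_solution_def sum_Kset_ends[OF fin] by simp
qed

lemma bval_cong:
  assumes "\<And>j x. j \<in> Edges E I \<Longrightarrow> x \<in> intv a j \<Longrightarrow> u j x = v j x" "\<And>i. i \<in> I \<Longrightarrow> a i > 0"
  shows "restr (Kset E I) (bval a u) = restr (Kset E I) (bval a v)"
  using assms by (force simp: restr_def Kset_def Edges_def fun_eq_iff)

lemma green_kernel_graph_green:
  fixes M :: "((('e, 'i) kidx \<Rightarrow> complex) \<times> (('e, 'i) kidx \<Rightarrow> complex)) set"
  assumes fin: "finite E" "finite I" and k: "\<kappa> > 0" and a: "\<And>i. i \<in> I \<Longrightarrow> a i > 0"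
    and F: "\<And>f \<beta>. (restr (Kset E I) f, restr (Kset E I) (dn_data a \<kappa> \<beta> f)) \<in> M \<longleftrightarrow>
       (\<forall>p\<in>Kset E I. f p = (\<Sum>q\<in>Kset E I. of_real (F p q :: real) * \<beta> q))"
  shows "green_kernel E I a M \<kappa> (\<lambda>j j' x y. complex_of_real (graph_green a \<kappa> F j j' x y))"
  unfolding green_kernel_def Let_def
proof (intro allI impI conjI)
  have e: "edge_pos a j" if "j \<in> Edges E I" for j using that a by (cases j) (auto simp: Edges_def)
  fix \<phi> :: "('e, 'i) edge \<Rightarrow> real \<Rightarrow> complex" assume "\<forall>j\<in>Edges E I. L2 (intv a j) (\<phi> j)"
  then have phi: "L2 (intv a j) (\<phi> j)" if "j \<in> Edges E I" for j using that by blast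
  note gi = graph_green_integral[where F = F and E = E and I = I and \<phi> = \<phi>, OF fin k e phi]
  show "\<forall>j\<in>Edges E I. \<forall>j'\<in>Edges E I. \<forall>x\<in>intv a j.
      (\<lambda>y. complex_of_real (graph_green a \<kappa> F j j' x y) * \<phi> j' y) absolutely_integrable_on intv a j'"
    using gi(1) by blast
  define f where "f p = (\<Sum>q\<in>Kset E I. of_real (F p q) * hat_mass a \<kappa> \<phi> q)" for p
  define u where "u j x = (\<Sum>j'\<in>Edges E I. integral (intv a j') (\<lambda>y. of_real (graph_green a \<kappa> F j j' x y) * \<phi> j' y))" for j x
  \<comment> \<open>The second derivative is defined by the equation itself, so the equation holds
    at every point and the exceptional set below is empty.\<close>
  define u'' where "u'' j x = \<kappa>\<^sup>2 *\<^sub>R edge_solution a \<kappa> f \<phi> j x - \<phi> j x" for j x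
  have uu: "u j x = edge_solution a \<kappa> f \<phi> j x" if "j \<in> Edges E I" "x \<in> intv a j" for j x
    unfolding u_def f_def[abs_def] by (rule graph_green_integral(2)[OF fin k e phi that])
  have H: "H2 (intv a j) (u j) (edge_solution_deriv a \<kappa> f \<phi> j) (u'' j)" if j: "j \<in> Edges E I" for j
  proof (rule H2_cong[OF edge_solution_H2[where \<phi> = \<phi> and f = f, OF k e[OF j] phi[OF j]]])
    show "{0..x} \<subseteq> intv a j" if "x \<in> intv a j" for x using intv_props(1)[OF that] .
    show "0 \<in> intv a j" using intv_props(3)[OF e[OF j]] .
  qed (simp_all add: uu j u''_def)
  have "restr (Kset E I) (bval a u) = restr (Kset E I) (bval a (edge_solution a \<kappa> f \<phi>))"
    by (rule bval_cong[OF uu a])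
  also have "\<dots> = restr (Kset E I) f"
    using bval_edge_solution[where \<phi> = \<phi>, OF k e phi] host_edge_Edges by (fastforce simp: restr_def)
  finally have 1: "restr (Kset E I) (bval a u) = restr (Kset E I) f" .
  have 2: "restr (Kset E I) (bder a (edge_solution_deriv a \<kappa> f \<phi>)) = restr (Kset E I) (dn_data a \<kappa> (hat_mass a \<kappa> \<phi>) f)"
    using bder_edge_solution[where \<phi> = \<phi>, OF k e phi] host_edge_Edges by (fastforce simp: restr_def)
  have "in_domain E I a M u (edge_solution_deriv a \<kappa> f \<phi>) u''"
    unfolding in_domain_def 1 2 F using H by (simp add: f_def)
  moreover have "\<forall>j\<in>Edges E I. \<exists>N. negligible N \<and> (\<forall>x\<in>intv a j - N. - u'' j x + complex_of_real (\<kappa>\<^sup>2) * u j x = \<phi> j x)"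
    by (intro ballI exI[of _ "{}"]) (simp add: u''_def uu scaleR_conv_of_real)
  ultimately show "\<exists>u' u''. in_domain E I a M (\<lambda>j x. \<Sum>j'\<in>Edges E I. integral (intv a j') (\<lambda>y. of_real (graph_green a \<kappa> F j j' x y) * \<phi> j' y)) u' u'' \<and>
    (\<forall>j\<in>Edges E I. \<exists>N. negligible N \<and> (\<forall>x\<in>intv a j - N. - u'' j x + complex_of_real (\<kappa>\<^sup>2) *
      (\<Sum>j'\<in>Edges E I. integral (intv a j') (\<lambda>y. of_real (graph_green a \<kappa> F j j' x y) * \<phi> j' y)) = \<phi> j x))"
    unfolding u_def[abs_def] by blast
qed

section \<open>Uniqueness of the resolvent and of its continuous kernel\<close>

lemma resolvent_unique:
  fixes u1 u2 :: "('e, 'i) edge \<Rightarrow> real \<Rightarrow> complex"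
  assumes k: "\<kappa> > 0" and a: "\<And>i. i \<in> I \<Longrightarrow> a i > 0" and M: "csubspace M"
    and F: "\<And>f \<beta>. (restr (Kset E I) f, restr (Kset E I) (dn_data a \<kappa> \<beta> f)) \<in> M \<longleftrightarrow>
       (\<forall>p\<in>Kset E I. f p = (\<Sum>q\<in>Kset E I. of_real (F p q :: real) * \<beta> q))"
    and d1: "in_domain E I a M u1 u1' u1''" and d2: "in_domain E I a M u2 u2' u2''"
    and s1: "\<forall>j\<in>Edges E I. \<exists>N. negligible N \<and> (\<forall>x\<in>intv a j - N. - u1'' j x + complex_of_real (\<kappa>\<^sup>2) * u1 j x = \<phi> j x)"
    and s2: "\<forall>j\<in>Edges E I. \<exists>N. negligible N \<and> (\<forall>x\<in>intv a j - N. - u2'' j x + complex_of_real (\<kappa>\<^sup>2) * u2 j x = \<phi> j x)"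
    and j: "j \<in> Edges E I" and x: "x \<in> intv a j"
  shows "u1 j x = u2 j x"
proof -
  define v v' where "v j x = u1 j x - u2 j x" and "v' j x = u1' j x - u2' j x" for j x
  have H: "H2 (intv a j) (u1 j) (u1' j) (u1'' j)" "H2 (intv a j) (u2 j) (u2' j) (u2'' j)" if "j \<in> Edges E I" for j
    using d1 d2 that by (auto simp: in_domain_def)
  have "v j x = 0"
  proof (rule homogeneous_solution_zero[of \<kappa> I a E M F v v'])
    show "L2 (intv a j) (v j)" if "j \<in> Edges E I" for j
    proof -
      have "L2 (intv a j) (\<lambda>x. u1 j x + (- 1) * u2 j x)"
        using H[OF that] by (intro L2_add L2_cmult) (auto simp: H2_def)
      then show ?thesis by (simp add: v_def[abs_def])
    qed
    fix j x assume j: "j \<in> Edges E I" and x: "x \<in> intv a j"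
    have i': "u1' j integrable_on {0..x}" "u2' j integrable_on {0..x}"
      using H[OF j] x by (auto simp: H2_def intro: set_lebesgue_integral_eq_integral(1))
    have i'': "u1'' j integrable_on {0..x}" "u2'' j integrable_on {0..x}"
      using H[OF j] x by (auto simp: H2_def intro: set_lebesgue_integral_eq_integral(1))
    show "v' j integrable_on {0..x}"
      unfolding v'_def[abs_def] by (intro integrable_diff i')
    have "u1 j x = u1 j 0 + integral {0..x} (u1' j)" "u2 j x = u2 j 0 + integral {0..x} (u2' j)"
      using H[OF j] x unfolding H2_def by blast+
    then show "v j x = v j 0 + integral {0..x} (v' j)"
      unfolding v_def v'_def[abs_def] integral_diff[OF i'] by (simp add: algebra_simps)
    have e: "u1' j x = u1' j 0 + integral {0..x} (u1'' j)" "u2' j x = u2' j 0 + integral {0..x} (u2'' j)"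
      using H[OF j] x unfolding H2_def by blast+
    obtain N1 N2 where N: "negligible N1" "negligible N2"
      "\<And>x. x \<in> intv a j - N1 \<Longrightarrow> - u1'' j x + complex_of_real (\<kappa>\<^sup>2) * u1 j x = \<phi> j x"
      "\<And>x. x \<in> intv a j - N2 \<Longrightarrow> - u2'' j x + complex_of_real (\<kappa>\<^sup>2) * u2 j x = \<phi> j x"
      using s1 s2 j by metis
    \<comment> \<open>The two equations hold only almost everywhere; this is enough, because the
      homogeneous equation is required only under the integral sign.\<close>
    have "integral {0..x} (\<lambda>s. \<kappa>\<^sup>2 *\<^sub>R v j s) = integral {0..x} (\<lambda>s. u1'' j s - u2'' j s)"
    proof (rule integral_spike[of "N1 \<union> N2"])
      show "negligible (N1 \<union> N2)" using N by simp
      fix s assume s: "s \<in> {0..x} - (N1 \<union> N2)"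
      then have "s \<in> intv a j - N1" "s \<in> intv a j - N2" using intv_props(1)[OF x] by auto
      from N(3)[OF this(1)] N(4)[OF this(2)]
      have "- u1'' j s + complex_of_real (\<kappa>\<^sup>2) * u1 j s = - u2'' j s + complex_of_real (\<kappa>\<^sup>2) * u2 j s" by simp
      then show "u1'' j s - u2'' j s = \<kappa>\<^sup>2 *\<^sub>R v j s"
        by (simp add: v_def scaleR_conv_of_real algebra_simps)
    qed
    then show "v' j x = v' j 0 + integral {0..x} (\<lambda>s. \<kappa>\<^sup>2 *\<^sub>R v j s)"
      unfolding v'_def integral_diff[OF i''] using e by (simp add: algebra_simps)
  next
    have "restr (Kset E I) (bval a v) = (\<lambda>p. restr (Kset E I) (bval a u1) p - restr (Kset E I) (bval a u2) p)"
    proof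
      fix p show "restr (Kset E I) (bval a v) p = restr (Kset E I) (bval a u1) p - restr (Kset E I) (bval a u2) p"
        by (cases p) (simp_all add: restr_def v_def)
    qed
    moreover have "restr (Kset E I) (bder a v') = (\<lambda>p. restr (Kset E I) (bder a u1') p - restr (Kset E I) (bder a u2') p)"
    proof
      fix p show "restr (Kset E I) (bder a v') p = restr (Kset E I) (bder a u1') p - restr (Kset E I) (bder a u2') p"
        by (cases p) (simp_all add: restr_def v'_def)
    qed
    ultimately show "(restr (Kset E I) (bval a v), restr (Kset E I) (bder a v')) \<in> M"
      using csubspace_diff[OF M] d1 d2 unfolding in_domain_def by presburger
  qed (use k a F j x in blast)+
  then show ?thesis by (simp add: v_def)
qed

text \<open>Both kernels give the same solution at the point \<open>x\<close> for every source. The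
  source is taken to be the conjugate of their difference \<open>d\<close> on a bounded piece of
  edge \<open>j'\<close>, and zero elsewhere; then the integral of the squared modulus of
  \<open>d\<close> vanishes, and continuity gives \<open>d = 0\<close> at \<open>y\<close>
  itself.\<close>

lemma green_kernel_unique:
  fixes M :: "((('e, 'i) kidx \<Rightarrow> complex) \<times> (('e, 'i) kidx \<Rightarrow> complex)) set"
  assumes fin: "finite E" "finite I" and k: "\<kappa> > 0" and a: "\<And>i. i \<in> I \<Longrightarrow> a i > 0" and M: "csubspace M"
    and F: "\<And>f \<beta>. (restr (Kset E I) f, restr (Kset E I) (dn_data a \<kappa> \<beta> f)) \<in> M \<longleftrightarrow>
       (\<forall>p\<in>Kset E I. f p = (\<Sum>q\<in>Kset E I. of_real (F p q :: real) * \<beta> q))"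
    and r1: "green_kernel E I a M \<kappa> r1" "kernel_continuous E I a r1"
    and r2: "green_kernel E I a M \<kappa> r2" "kernel_continuous E I a r2"
    and j: "j \<in> Edges E I" "j' \<in> Edges E I" and x: "x \<in> intv a j" and y: "y \<in> intv a j'"
  shows "r1 j j' x y = r2 j j' x y"
proof -
  define d where "d y = r1 j j' x y - r2 j j' x y" for y
  have cr: "continuous_on (intv a j') (\<lambda>y. r j j' x y)" if "kernel_continuous E I a r" for r
  proof -
    have "continuous_on (intv a j \<times> intv a j') (\<lambda>(x, y). r j j' x y)"
      using that j by (simp add: kernel_continuous_def)
    moreover have "continuous_on (intv a j') (\<lambda>y. (x, y))" by (intro continuous_intros)
    ultimately have "continuous_on (intv a j') (\<lambda>y. case (x, y) of (x, y) \<Rightarrow> r j j' x y)"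
      by (rule continuous_on_compose2) (use x in auto)
    then show ?thesis by simp
  qed
  have cd: "continuous_on (intv a j') d"
    unfolding d_def[abs_def] by (intro continuous_intros cr r1 r2)
  \<comment> \<open>A bounded interval makes the test source square integrable whatever the decay of
    the kernels; \<open>y + 1\<close> keeps \<open>b\<close> positive also for
    \<open>y = 0\<close>.\<close>
  obtain b where b: "b > 0" "y \<in> {0..b}" "{0..b} \<subseteq> intv a j'"
  proof (cases j')
    case (ExtE e)
    then show ?thesis using y by (intro that[of "y + 1"]) auto
  next
    case (IntE i)
    then show ?thesis using y j(2) a by (intro that[of "a i"]) (auto simp: Edges_def)
  qed
  have cdb: "continuous_on {0..b} d" using cd b(3) by (rule continuous_on_subset)
  define \<phi> where "\<phi> l s = (if l = j' \<and> s \<in> {0..b} then cnj (d s) else 0)" for l s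
  have L: "L2 (intv a l) (\<phi> l)" for l
  proof (cases "l = j'")
    case False
    then show ?thesis by (simp add: \<phi>_def[abs_def] L2_iff integrable_0)
  next
    case True
    have eq: "\<phi> l = (\<lambda>s. if s \<in> {0..b} then cnj (d s) else 0)" using True by (simp add: \<phi>_def[abs_def])
    have L2d: "L2 {0..b} (\<lambda>s. cnj (d s))" by (intro L2_continuous_Icc continuous_on_cnj cdb)
    have I: "{0..b} \<inter> intv a l = {0..b}" using True b(3) by auto
    have n: "(\<lambda>s. (cmod (\<phi> l s))\<^sup>2) = (\<lambda>s. if s \<in> {0..b} then (cmod (cnj (d s)))\<^sup>2 else 0)"
      unfolding eq by auto
    have "(\<lambda>s. (cmod (\<phi> l s))\<^sup>2) integrable_on intv a l"
      unfolding n integrable_restrict_Int I using L2d by (simp add: L2_iff)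
    moreover have "\<phi> l absolutely_integrable_on intv a l"
    proof -
      have "(\<lambda>s. cnj (d s)) absolutely_integrable_on {0..b}"
        by (intro absolutely_integrable_continuous_real continuous_on_cnj cdb)
      then show ?thesis
        unfolding eq absolutely_integrable_on_def if_distrib[of norm] norm_zero
        by (simp only: integrable_restrict_Int I simp_thms)
    qed
    then have "\<phi> l \<in> borel_measurable (lebesgue_on (intv a l))"
      by (simp add: absolutely_integrable_measurable)
    ultimately show ?thesis by (simp add: L2_iff)
  qed
  define u where "u r l x = (\<Sum>j'\<in>Edges E I. integral (intv a j') (\<lambda>y. r l j' x y * \<phi> j' y))"
    for r :: "('e, 'i) edge \<Rightarrow> ('e, 'i) edge \<Rightarrow> real \<Rightarrow> real \<Rightarrow> complex" and l x
  have ex: "\<exists>u' u''. in_domain E I a M (u r) u' u'' \<and> (\<forall>j\<in>Edges E I. \<exists>N. negligible N \<and>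
      (\<forall>x\<in>intv a j - N. - u'' j x + complex_of_real (\<kappa>\<^sup>2) * u r j x = \<phi> j x))"
    and ir: "(\<lambda>y. r j j' x y * \<phi> j' y) integrable_on intv a j'" if "green_kernel E I a M \<kappa> r" for r
    using that L j x unfolding green_kernel_def Let_def u_def[abs_def]
    by (blast intro: set_lebesgue_integral_eq_integral(1))+
  have "u r1 j x = u r2 j x"
  proof -
    obtain u1' u1'' where 1: "in_domain E I a M (u r1) u1' u1''" "\<forall>j\<in>Edges E I. \<exists>N. negligible N \<and>
      (\<forall>x\<in>intv a j - N. - u1'' j x + complex_of_real (\<kappa>\<^sup>2) * u r1 j x = \<phi> j x)" using ex[OF r1(1)] by blast
    obtain u2' u2'' where 2: "in_domain E I a M (u r2) u2' u2''" "\<forall>j\<in>Edges E I. \<exists>N. negligible N \<and>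
      (\<forall>x\<in>intv a j - N. - u2'' j x + complex_of_real (\<kappa>\<^sup>2) * u r2 j x = \<phi> j x)" using ex[OF r2(1)] by blast
    show ?thesis by (rule resolvent_unique[OF k a M F 1(1) 2(1) 1(2) 2(2) j(1) x])
  qed
  moreover have "u r j x = integral (intv a j') (\<lambda>y. r j j' x y * \<phi> j' y)" for r
  proof -
    have "u r j x = (\<Sum>l\<in>Edges E I. if l = j' then integral (intv a j') (\<lambda>y. r j j' x y * \<phi> j' y) else 0)"
      unfolding u_def by (intro sum.cong) (auto simp: \<phi>_def)
    also have "\<dots> = integral (intv a j') (\<lambda>y. r j j' x y * \<phi> j' y)"
      using j(2) fin by (simp add: Edges_def sum.delta)
    finally show ?thesis .
  qed
  ultimately have "0 = integral (intv a j') (\<lambda>y. r1 j j' x y * \<phi> j' y) - integral (intv a j') (\<lambda>y. r2 j j' x y * \<phi> j' y)"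
    by simp
  also have "\<dots> = integral (intv a j') (\<lambda>y. r1 j j' x y * \<phi> j' y - r2 j j' x y * \<phi> j' y)"
    by (rule integral_diff[symmetric]) (intro ir r1 r2)+
  also have "\<dots> = integral (intv a j') (\<lambda>s. if s \<in> {0..b} then complex_of_real ((cmod (d s))\<^sup>2) else 0)"
  proof (intro integral_cong)
    fix s
    have "r1 j j' x s * \<phi> j' s - r2 j j' x s * \<phi> j' s = d s * \<phi> j' s"
      by (simp add: d_def left_diff_distrib)
    then show "r1 j j' x s * \<phi> j' s - r2 j j' x s * \<phi> j' s
        = (if s \<in> {0..b} then complex_of_real ((cmod (d s))\<^sup>2) else 0)"
      by (simp add: \<phi>_def complex_norm_square del: of_real_power)
  qed
  also have "\<dots> = integral {0..b} (\<lambda>s. complex_of_real ((cmod (d s))\<^sup>2))"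
    using b(3) by (simp only: integral_restrict_Int Int_absorb2)
  also have "\<dots> = of_real (integral {0..b} (\<lambda>s. (cmod (d s))\<^sup>2))"
    by (intro integral_unique has_integral_of_real integrable_integral integrable_continuous_real continuous_intros cdb)
  finally have z: "integral {0..b} (\<lambda>s. (cmod (d s))\<^sup>2) = 0" by simp
  have c: "continuous_on {0..b} (\<lambda>s. (cmod (d s))\<^sup>2)" by (intro continuous_intros cdb)
  have "\<forall>s\<in>{0..b}. (cmod (d s))\<^sup>2 = 0"
    using iffD1[OF integral_eq_0_iff[OF c b(1) zero_le_power2] z] .
  from bspec[OF this b(2)] show ?thesis by (simp add: d_def)
qed

theorem theorem5p1:
  fixes V :: "'v set" and E :: "'e set" and I :: "'i set"
    and dm dp :: "'i \<Rightarrow> 'v" and de :: "'e \<Rightarrow> 'v" and a :: "'i \<Rightarrow> real"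
    and M :: "((('e, 'i) kidx \<Rightarrow> complex) \<times> (('e, 'i) kidx \<Rightarrow> complex)) set"
  assumes "graph V E I dm dp de"
    and "graph_connected V I dm dp"
    and "I \<noteq> {}"
    and "no_tadpoles I dm dp"
    and "\<forall>i\<in>I. a i > 0"
    and "max_isotropic (Kset E I) M"
    and "locally_strictly_positive V E I dm dp de M"
  shows "\<exists>\<kappa>0\<ge>0. \<forall>\<kappa>::real. \<kappa> \<ge> \<kappa>0 \<longrightarrow>
           (\<exists>r. green_kernel E I a M \<kappa> r \<and> kernel_continuous E I a r) \<and>
           (\<forall>r. green_kernel E I a M \<kappa> r \<and> kernel_continuous E I a r \<longrightarrow>
              (\<forall>j\<in>Edges E I. \<forall>j'\<in>Edges E I. \<forall>x\<in>intv a j. \<forall>y\<in>intv a j'. cpos (r j j' x y)))"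
proof (rule positive_boundary_response[OF assms(1-3,5,7)], goal_cases)
  case (1 \<kappa>2 F)
  have fin: "finite E" "finite I" using assms(1) by (simp_all add: graph_def)
  have a: "a i > 0" if "i \<in> I" for i using assms(5) that by blast
  have M: "csubspace M" using assms(6) by (simp add: max_isotropic_def isotropic_def)
  show ?case
  proof (intro exI[of _ \<kappa>2] conjI allI impI ballI; (elim conjE)?)
    show "\<kappa>2 \<ge> 0" using 1(1) by simp
    fix \<kappa> assume "\<kappa> \<ge> \<kappa>2"
    then have k: "\<kappa> > 0" using 1(1) by simp
    note F = 1(3)[OF \<open>\<kappa> \<ge> \<kappa>2\<close>]
    define g where "g j j' x y = complex_of_real (graph_green a \<kappa> (F \<kappa>) j j' x y)" for j j' x y
    have g: "green_kernel E I a M \<kappa> g" "kernel_continuous E I a g"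
      unfolding g_def[abs_def]
      using green_kernel_graph_green[OF fin k a F] kernel_continuous_graph_green by blast+
    then show "\<exists>r. green_kernel E I a M \<kappa> r \<and> kernel_continuous E I a r" by blast
    fix r j j' x y
    assume r: "green_kernel E I a M \<kappa> r" "kernel_continuous E I a r"
      and j: "j \<in> Edges E I" "j' \<in> Edges E I" and x: "x \<in> intv a j" and y: "y \<in> intv a j'"
    have "r j j' x y = g j j' x y"
      by (rule green_kernel_unique[OF fin k a M F r g j x y])
    moreover have "graph_green a \<kappa> (F \<kappa>) j j' x y > 0"
    proof (rule graph_green_pos[OF k _ _ _ x y])
      show "edge_pos a j" "edge_pos a j'" using j a by (cases j; cases j'; auto simp: Edges_def)+
      fix p q assume "p \<in> ends j" "q \<in> ends j'"
      then show "F \<kappa> p q > 0"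
        using j by (intro 1(2)[OF \<open>\<kappa> \<ge> \<kappa>2\<close>]) (cases j; cases j'; auto simp: Edges_def Kset_def)+
    qed
    ultimately show "cpos (r j j' x y)" by (simp add: g_def cpos_def)
  qed
qed

end
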